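(* Let $1\le p<\infty$. If $X$ is a dual Banach space with the Radon–Nikodym property, then both $\mathrm{FBL}^{(p)}[X]$ and $\overline{I}_{w^*}^{p}[X]$ are $1$-monotonically bounded.
   Context: All Banach spaces are real. Let $1/p+1/p'=1$. For $z_1,\dots,z_n$ in a Banach space, $\|(z_i)_{i=1}^n\|_{p,\mathrm{weak}}=\sup\{\|\sum_i\alpha_i z_i\| : \|(\alpha_i)_i\|_{\ell_{p'}}\le 1\}$. For a Banach space $X$, $H_{w^*}[X]$ is the vector lattice (pointwise operations and order) of positively homogeneous functions $f:X^*\to\mathbb R$ that are weak$^*$-continuous on bounded sets. For $f\in H_{w^*}[X]$, $\|f\|_p$ is the infimum of all $C\ge 0$ such that $(\sum_{i=1}^n|f(x_i^* )|^p)^{1/p}\le C\|(x_i^* )_{i=1}^n\|_{p,\mathrm{weak}}$ for all $n$ and all $x_1^*,\dots,x_n^*\in X^*$. $H_{w^*}^p[X]=\{f\in H_{w^*}[X]:\|f\|_p<\infty\}$, normed by $\|\cdot\|_p$. For $x\in X$, $\delta_x(x^* )=\langle x^*,x\rangle$. $\mathrm{FVL}[X]$ is the vector sublattice of $H_{w^*}[X]$ generated by $\{\delta_x:x\in X\}$; $\mathrm{FBL}^{(p)}[X]$ is the closure of $\mathrm{FVL}[X]$ in $H_{w^*}^p[X]$; $I_{w^*}[X]$ is the (order) ideal of $H_{w^*}[X]$ generated by $\{\delta_x:x\in X\}$; $\overline{I}_{w^*}^p[X]$ is the closure of $I_{w^*}[X]$ in $H_{w^*}^p[X]$. Both are Banach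 lattices under $\|\cdot\|_p$. A Banach lattice $Z$ is $\lambda$-monotonically bounded ($\lambda\ge1$) if every norm-bounded increasing net $(z_\alpha)\subset Z_+$ has an upper bound $z_0\in Z$ with $\|z_0\|\le\lambda\sup_\alpha\|z_\alpha\|$. *)

theory Defs
  imports "HOL-Analysis.Analysis"
begin

section \<open>Dual spaces and the Radon--Nikodym property\<close>

text \<open>\<open>is_dual_of TYPE('x) TYPE('y)\<close>: the space \<open>'x\<close> is isometrically isomorphic to the norm dual
  of \<open>'y\<close>.\<close>

definition is_dual_of :: "'x::real_normed_vector itself \<Rightarrow> 'y::real_normed_vector itself \<Rightarrow> bool" where
  "is_dual_of _ _ \<longleftrightarrow>
     (\<exists>T :: 'x \<Rightarrow> ('y \<Rightarrow>\<^sub>L real). linear T \<and> (\<forall>x. norm (T x) = norm x) \<and> surj T)"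

text \<open>The library's \<^const>\<open>has_bochner_integral\<close> is only available for second countable (hence
  separable) codomains. The following is the same definition with that sort constraint removed; the
  approximation by simple functions forces \<open>f\<close> to be essentially separably valued.\<close>

definition has_strong_bochner_integral ::
    "'w measure \<Rightarrow> ('w \<Rightarrow> 'x::real_normed_vector) \<Rightarrow> 'x \<Rightarrow> bool" where
  "has_strong_bochner_integral M f v \<longleftrightarrow>
     f \<in> borel_measurable M \<and>
     (\<exists>s :: nat \<Rightarrow> 'w \<Rightarrow> 'x. (\<forall>k. Bochner_Integration.simple_bochner_integrable M (s k)) \<and>
        (\<lambda>k. \<integral>\<^sup>+w. ennreal (norm (f w - s k w)) \<partial>M) \<longlonglongrightarrow> 0 \<and>
        (\<lambda>k. Bochner_Integration.simple_bochner_integral M (s k)) \<longlonglongrightarrow> v)"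

definition vector_measure :: "'w measure \<Rightarrow> ('w set \<Rightarrow> 'x::real_normed_vector) \<Rightarrow> bool" where
  "vector_measure M G \<longleftrightarrow>
     (\<forall>A :: nat \<Rightarrow> 'w set. range A \<subseteq> sets M \<longrightarrow> disjoint_family A \<longrightarrow>
        (\<lambda>k. G (A k)) sums G (\<Union>k. A k))"

definition bounded_variation :: "'w measure \<Rightarrow> ('w set \<Rightarrow> 'x::real_normed_vector) \<Rightarrow> bool" where
  "bounded_variation M G \<longleftrightarrow>
     (\<exists>C. \<forall>P. finite P \<longrightarrow> P \<subseteq> sets M \<longrightarrow> partition_on (space M) P \<longrightarrow>
        (\<Sum>E\<in>P. norm (G E)) \<le> C)"

definition radon_nikodym_wrt :: "'w measure \<Rightarrow> 'x::banach itself \<Rightarrow> bool" where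
  "radon_nikodym_wrt M _ \<longleftrightarrow>
     (\<forall>G :: 'w set \<Rightarrow> 'x. vector_measure M G \<longrightarrow> bounded_variation M G \<longrightarrow>
        (\<forall>E\<in>null_sets M. G E = 0) \<longrightarrow>
        (\<exists>g. \<forall>E\<in>sets M. has_strong_bochner_integral M (\<lambda>w. indicator E w *\<^sub>R g w) (G E)))"

text \<open>A definition in HOL cannot quantify over the carrier types of measure spaces, so a universe
  has to be fixed: all finite measure spaces whose points are functions on the dual space
  (arbitrary carrier set, arbitrary \<open>\<sigma>\<close>-algebra, arbitrary finite measure). Up to isomorphism this
  covers every finite measure space on a subset of the reals, of the space itself, of its dual or of
  its bidual. Nothing is lost, since the instance of Lebesgue measure on the unit interval already
  implies the Radon--Nikodym property for all finite measure spaces (Diestel and Uhl, Vector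
  Measures, Chapter V).\<close>

definition radon_nikodym_property :: "'x::banach itself \<Rightarrow> bool" where
  "radon_nikodym_property X \<longleftrightarrow>
     (\<forall>M :: (('x \<Rightarrow>\<^sub>L real) \<Rightarrow> real) measure. finite_measure M \<longrightarrow> radon_nikodym_wrt M X)"


section \<open>The weak p-norm of a finite sequence\<close>

definition conjugate_exponent :: "real \<Rightarrow> ereal" where
  "conjugate_exponent p = (if p = 1 then \<infinity> else ereal (p / (p - 1)))"

definition lq_norm :: "ereal \<Rightarrow> nat \<Rightarrow> (nat \<Rightarrow> real) \<Rightarrow> real" where
  "lq_norm q n a =
     (if q = \<infinity> then Max (insert 0 ((\<lambda>i. \<bar>a i\<bar>) ` {..<n}))
      else (\<Sum>i<n. \<bar>a i\<bar> powr real_of_ereal q) powr (1 / real_of_ereal q))"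

definition weak_norm :: "real \<Rightarrow> nat \<Rightarrow> (nat \<Rightarrow> 'z::real_normed_vector) \<Rightarrow> real" where
  "weak_norm p n z =
     (SUP a \<in> {a. lq_norm (conjugate_exponent p) n a \<le> 1}. norm (\<Sum>i<n. a i *\<^sub>R z i))"


section \<open>Lattices of positively homogeneous functions on the dual space\<close>

text \<open>The weak* topology on \<open>'x \<Rightarrow>\<^sub>L real\<close> is the topology of pointwise convergence, that is, the
  strong operator topology for the codomain \<open>real\<close>.\<close>

abbreviation weak_star_topology :: "('x::real_normed_vector \<Rightarrow>\<^sub>L real) topology" where
  "weak_star_topology \<equiv> strong_operator_topology"

definition Hw :: "(('x::banach \<Rightarrow>\<^sub>L real) \<Rightarrow> real) set" where
  "Hw = {f. (\<forall>c \<phi>. 0 \<le> c \<longrightarrow> f (c *\<^sub>R \<phi>) = c * f \<phi>) \<and>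
            (\<forall>B. bounded B \<longrightarrow>
               continuous_map (subtopology weak_star_topology B) euclideanreal f)}"

text \<open>The extended-real norm; it is \<open>\<infinity>\<close> when no constant is admissible.\<close>

definition pnorm :: "real \<Rightarrow> (('x::banach \<Rightarrow>\<^sub>L real) \<Rightarrow> real) \<Rightarrow> ennreal" where
  "pnorm p f = Inf {ennreal C | C. 0 \<le> C \<and>
     (\<forall>n (z :: nat \<Rightarrow> 'x \<Rightarrow>\<^sub>L real).
        (\<Sum>i<n. \<bar>f (z i)\<bar> powr p) powr (1 / p) \<le> C * weak_norm p n z)}"

definition Hwp :: "real \<Rightarrow> (('x::banach \<Rightarrow>\<^sub>L real) \<Rightarrow> real) set" where
  "Hwp p = {f \<in> Hw. pnorm p f < \<infinity>}"

definition closure_Hwp ::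
    "real \<Rightarrow> (('x::banach \<Rightarrow>\<^sub>L real) \<Rightarrow> real) set \<Rightarrow> (('x \<Rightarrow>\<^sub>L real) \<Rightarrow> real) set" where
  "closure_Hwp p S = {f \<in> Hwp p. \<forall>\<epsilon>>0. \<exists>g\<in>S. pnorm p (\<lambda>\<phi>. f \<phi> - g \<phi>) < ennreal \<epsilon>}"

definition point_eval :: "'x::banach \<Rightarrow> ('x \<Rightarrow>\<^sub>L real) \<Rightarrow> real" where
  "point_eval x \<phi> = blinfun_apply \<phi> x"

definition function_subspace :: "('w \<Rightarrow> real) set \<Rightarrow> bool" where
  "function_subspace S \<longleftrightarrow>
     (\<lambda>_. 0) \<in> S \<and> (\<forall>f\<in>S. \<forall>g\<in>S. (\<lambda>w. f w + g w) \<in> S) \<and> (\<forall>c. \<forall>f\<in>S. (\<lambda>w. c * f w) \<in> S)"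

text \<open>\<^const>\<open>sup\<close>, \<^const>\<open>inf\<close> and the order on functions are pointwise.\<close>

definition vector_sublattice :: "('w \<Rightarrow> real) set \<Rightarrow> ('w \<Rightarrow> real) set \<Rightarrow> bool" where
  "vector_sublattice H S \<longleftrightarrow>
     S \<subseteq> H \<and> function_subspace S \<and> (\<forall>f\<in>S. \<forall>g\<in>S. sup f g \<in> S \<and> inf f g \<in> S)"

definition order_ideal :: "('w \<Rightarrow> real) set \<Rightarrow> ('w \<Rightarrow> real) set \<Rightarrow> bool" where
  "order_ideal H J \<longleftrightarrow>
     J \<subseteq> H \<and> function_subspace J \<and>
     (\<forall>g\<in>J. \<forall>f\<in>H. (\<lambda>w. \<bar>f w\<bar>) \<le> (\<lambda>w. \<bar>g w\<bar>) \<longrightarrow> f \<in> J)"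

definition FVL :: "(('x::banach \<Rightarrow>\<^sub>L real) \<Rightarrow> real) set" where
  "FVL = vector_sublattice Hw hull range point_eval"

definition Iw :: "(('x::banach \<Rightarrow>\<^sub>L real) \<Rightarrow> real) set" where
  "Iw = order_ideal Hw hull range point_eval"

definition FBL :: "real \<Rightarrow> (('x::banach \<Rightarrow>\<^sub>L real) \<Rightarrow> real) set" where
  "FBL p = closure_Hwp p FVL"

definition Iwp_closure :: "real \<Rightarrow> (('x::banach \<Rightarrow>\<^sub>L real) \<Rightarrow> real) set" where
  "Iwp_closure p = closure_Hwp p Iw"


section \<open>Monotone boundedness\<close>

definition directed_index :: "'i set \<Rightarrow> ('i \<Rightarrow> 'i \<Rightarrow> bool) \<Rightarrow> bool" where
  "directed_index I le \<longleftrightarrow>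
     I \<noteq> {} \<and> reflp_on I le \<and> transp_on I le \<and> (\<forall>i\<in>I. \<forall>j\<in>I. \<exists>k\<in>I. le i k \<and> le j k)"

text \<open>Monotone boundedness of a lattice \<open>Z\<close> of functions with norm \<open>N\<close>, for nets indexed by
  directed sets in the type \<open>'i\<close>. To speak of all nets, leave \<open>'i\<close> a free type variable in the
  conclusion of a theorem.\<close>

definition monotonically_bounded ::
    "'i itself \<Rightarrow> real \<Rightarrow> ('w \<Rightarrow> real) set \<Rightarrow> (('w \<Rightarrow> real) \<Rightarrow> ennreal) \<Rightarrow> bool" where
  "monotonically_bounded _ c Z N \<longleftrightarrow>
     (\<forall>(I :: 'i set) le z. directed_index I le \<longrightarrow>
        (\<forall>i\<in>I. z i \<in> Z \<and> (\<lambda>_. 0) \<le> z i) \<longrightarrow>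
        (\<forall>i\<in>I. \<forall>j\<in>I. le i j \<longrightarrow> z i \<le> z j) \<longrightarrow>
        (SUP i\<in>I. N (z i)) < \<infinity> \<longrightarrow>
        (\<exists>z0\<in>Z. (\<forall>i\<in>I. z i \<le> z0) \<and> N z0 \<le> ennreal c * (SUP i\<in>I. N (z i))))"

end

theory Submission
  imports Defs "HOL-Probability.Projective_Limit"
begin

text \<open>Let \<open>X = Y*\<close> and let \<open>z\<^sub>i\<close> be an increasing net with \<open>\<parallel>z\<^sub>i\<parallel>\<^sub>p \<le> C\<close>. A Pietsch-type separation argument
  together with compactness gives one finitely additive probability \<open>L\<close> on the unit ball of \<open>X\<close> with
  \<open>z\<^sub>i(\<phi>)\<^sup>p \<le> C\<^sup>p L(|\<phi>|\<^sup>p)\<close> for all \<open>i\<close> and all \<open>\<phi>\<close> in \<open>X*\<close>. Kolmogorov's extension theorem turns \<open>L\<close>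
  into a countably additive probability \<open>\<nu>\<close> and random variables \<open>U\<^sub>\<phi>\<close>, almost surely linear in \<open>\<phi>\<close>
  and bounded by \<open>\<parallel>\<phi>\<parallel>\<close>. For \<open>\<phi> = y\<close> in \<open>Y\<close>, the weak* integrals of \<open>U\<^sub>y\<close> over measurable sets define an
  \<open>X\<close>-valued measure dominated by \<open>\<nu>\<close>, whose Radon--Nikodym density \<open>g\<close> satisfies \<open>\<langle>g, y\<rangle> = U\<^sub>y\<close> and
  \<open>\<parallel>g\<parallel> \<le> 1\<close> almost surely. The upper bound is \<open>h(\<phi>) = C (\<integral> |\<phi>(g)|\<^sup>p d\<nu>)\<^sup>1\<^sup>/\<^sup>p\<close>. It has norm at most \<open>C\<close>, and
  since \<open>g\<close> is a Bochner limit of simple functions it lies in the closure of the lattice expressions.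
  By construction \<open>z\<^sub>i \<le> h\<close> on \<open>Y\<close>, and Goldstine's theorem with weak* continuity on bounded sets extends this to \<open>X*\<close>.\<close>

text \<open>The pointwise supremum of the net is in general only a supremum of continuous functions,
  so it cannot serve as the bound; a mean is carried through the limit instead, and a bound is
  rebuilt from it. Strong measurability of \<open>g\<close> decides whether the rebuilt function
  lies in the lattice: the \<open>L\<^sub>p\<close>-norm of \<phi> over a simple function is an
  \<open>\<ell>\<^sub>p\<close>-combination of finitely many evaluations, and convergence in mean to
  \<open>g\<close> becomes approximation in the lattice norm. The density is found by testing
  against the predual only, so it represents the random functional only on the image of
  \<open>J\<close>; hence weak* continuity of the bound must be known before the domination can be
  extended. The members of the net enter merely as nonnegative elements of \<open>Hw\<close> with
  norm at most C, while the bound is found in the smaller lattice \<open>FBL p\<close>, so one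
  construction serves both lattices. No constant is lost: the mean has total mass one, the density
  has norm at most one, and crude factors such as \<open>2 powr p\<close> occur only in
  integrability and approximation arguments.\<close>

section \<open>A finite minimax principle\<close>

text \<open>A near-minimiser of the squared total deficit \<open>\<Phi>\<close> is tested against the weights given by its own
  deficits: moving towards the competitor supplied by the duality hypothesis would decrease \<open>\<Phi>\<close>.\<close>

lemma finite_minimax:
  fixes S :: "('j \<Rightarrow> real) set"
  assumes fin: "finite F" and ne: "S \<noteq> {}"
    and conv: "\<And>k l t. k \<in> S \<Longrightarrow> l \<in> S \<Longrightarrow> 0 \<le> t \<Longrightarrow> t \<le> 1 \<Longrightarrow> (\<lambda>j. (1 - t) * k j + t * l j) \<in> S"
    and bd: "\<And>k j. k \<in> S \<Longrightarrow> j \<in> F \<Longrightarrow> \<bar>k j\<bar> \<le> B j"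
    and dual: "\<And>c \<eta>. (\<And>j. j \<in> F \<Longrightarrow> 0 \<le> c j) \<Longrightarrow> 0 < \<eta> \<Longrightarrow> \<exists>k\<in>S. (\<Sum>j\<in>F. c j * (a j - k j)) \<le> \<eta>"
    and eps: "0 < \<epsilon>"
  shows "\<exists>k\<in>S. \<forall>j\<in>F. a j \<le> k j + \<epsilon>"
proof -
  define \<Phi> where "\<Phi> k = (\<Sum>j\<in>F. (max 0 (a j - k j))\<^sup>2)" for k
  define d where "d = Inf (\<Phi> ` S)"
  have \<Phi>0: "0 \<le> \<Phi> k" for k unfolding \<Phi>_def by (simp add: sum_nonneg)
  have d0: "0 \<le> d" unfolding d_def using ne \<Phi>0 by (intro cINF_greatest) auto
  have dle: "d \<le> \<Phi> k" if "k \<in> S" for k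
    unfolding d_def using that \<Phi>0 by (intro cINF_lower bdd_belowI2[where m=0]) auto
  have near: "\<exists>k\<in>S. \<Phi> k < d + e" if "0 < e" for e
    using cINF_less_iff[of S \<Phi> "d + e"] ne \<Phi>0 that bdd_belowI2[of S 0 \<Phi>]
    unfolding d_def by auto
  have "d \<le> 0"
  proof (rule ccontr)
    assume "\<not> d \<le> 0"
    hence dp: "0 < d" by simp
    \<comment> \<open>\<open>2 * B j\<close> bounds the distance of two members of \<open>S\<close>
      at j, so \<open>M\<close> bounds the quadratic term of the move; \<open>t\<close> is small
      enough that this term costs at most \<open>t * d / 2\<close>.\<close>
    define M where "M = (\<Sum>j\<in>F. (2 * B j)\<^sup>2)"
    have M0: "0 \<le> M" unfolding M_def by (simp add: sum_nonneg)
    define t where "t = min 1 (d / (2 * (M + 1)))"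
    have t: "0 < t" "t \<le> 1" using dp M0 by (auto simp: t_def)
    have "t * M \<le> (d / (2 * (M + 1))) * M" using M0 by (intro mult_right_mono) (auto simp: t_def)
    also have "\<dots> \<le> d / 2" using dp M0 by (simp add: field_simps)
    finally have tM: "t * M \<le> d / 2" .
    \<comment> \<open>Near-minimality is tuned to the step length: the move gains at least
      \<open>2 * t * (7 * d / 8)\<close>, while the losses are below \<open>t * d / 4\<close> here
      and at most \<open>t * d / 2\<close> from the quadratic term.\<close>
    obtain k where k: "k \<in> S" "\<Phi> k < d + t * d / 4" using near[of "t * d / 4"] t dp by auto
    define c where "c j = max 0 (a j - k j)" for j
    obtain l where l: "l \<in> S" "(\<Sum>j\<in>F. c j * (a j - l j)) \<le> d / 8"
      using dual[of c "d / 8"] dp unfolding c_def by auto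
    \<comment> \<open>Second-order bound for the squared positive part, whose derivative
      \<open>2 * max 0 s\<close> has Lipschitz constant 2.\<close>
    have max_sq: "(max 0 (s - r))\<^sup>2 \<le> (max 0 s)\<^sup>2 - 2 * (max 0 s * r) + r\<^sup>2" for s r :: real
    proof (cases "0 \<le> s - r")
      case True
      show ?thesis
      proof (cases "0 \<le> s")
        case False
        hence "(s - r)\<^sup>2 \<le> (- r)\<^sup>2" using True by (intro power_mono) auto
        thus ?thesis using True False by (simp add: max_def)
      qed (use True in \<open>simp add: max_def power2_eq_square algebra_simps\<close>)
    next
      case False
      have "0 \<le> (max 0 s - r)\<^sup>2" by simp
      thus ?thesis using False by (simp add: max_def power2_eq_square algebra_simps)
    qed
    have "d \<le> \<Phi> (\<lambda>j. (1 - t) * k j + t * l j)" using k l t by (intro dle conv) auto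
    also have "\<dots> \<le> (\<Sum>j\<in>F. (c j)\<^sup>2 - 2 * t * (c j * (l j - k j)) + t\<^sup>2 * (2 * B j)\<^sup>2)"
      unfolding \<Phi>_def
    proof (rule sum_mono)
      fix j assume j: "j \<in> F"
      have "\<bar>l j - k j\<bar> \<le> \<bar>2 * B j\<bar>" using bd[OF k(1) j] bd[OF l(1) j] by linarith
      hence "(l j - k j)\<^sup>2 \<le> (2 * B j)\<^sup>2" by (simp only: abs_le_square_iff)
      hence "t\<^sup>2 * (l j - k j)\<^sup>2 \<le> t\<^sup>2 * (2 * B j)\<^sup>2" by (intro mult_left_mono) auto
      thus "(max 0 (a j - ((1 - t) * k j + t * l j)))\<^sup>2
          \<le> (c j)\<^sup>2 - 2 * t * (c j * (l j - k j)) + t\<^sup>2 * (2 * B j)\<^sup>2"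
        using max_sq[of "a j - k j" "t * (l j - k j)"] unfolding c_def power_mult_distrib[of t]
        by (simp add: algebra_simps)
    qed
    also have "\<dots> = \<Phi> k - 2 * t * (\<Sum>j\<in>F. c j * (l j - k j)) + t\<^sup>2 * M"
      unfolding \<Phi>_def c_def M_def by (simp add: sum.distrib sum_subtractf sum_distrib_left)
    finally have A: "d \<le> \<Phi> k - 2 * t * (\<Sum>j\<in>F. c j * (l j - k j)) + t\<^sup>2 * M" .
    have "(\<Sum>j\<in>F. c j * (a j - k j)) = \<Phi> k"
      unfolding \<Phi>_def c_def by (intro sum.cong) (auto simp: max_def power2_eq_square)
    hence "(\<Sum>j\<in>F. c j * (l j - k j)) = \<Phi> k - (\<Sum>j\<in>F. c j * (a j - l j))"
      by (simp add: sum_subtractf algebra_simps)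
    hence "d - d / 8 \<le> (\<Sum>j\<in>F. c j * (l j - k j))" using l dle[OF k(1)] by linarith
    hence "2 * t * (d - d / 8) \<le> 2 * t * (\<Sum>j\<in>F. c j * (l j - k j))"
      using t by (intro mult_left_mono) auto
    moreover have "t\<^sup>2 * M \<le> t * (d / 2)"
      using mult_left_mono[OF tM, of t] t by (simp add: power2_eq_square algebra_simps)
    ultimately have "2 * t * (d - d / 8) \<le> t * d / 4 + t * (d / 2)" using A k(2) by linarith
    hence "t * d \<le> 0" by (simp add: algebra_simps)
    thus False using t dp by (simp add: mult_le_0_iff)
  qed
  then obtain k where k: "k \<in> S" "\<Phi> k < \<epsilon>\<^sup>2" using near[of "\<epsilon>\<^sup>2"] d0 eps by auto
  have "a j \<le> k j + \<epsilon>" if j: "j \<in> F" for j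
  proof -
    have "(max 0 (a j - k j))\<^sup>2 \<le> \<Phi> k"
      unfolding \<Phi>_def using fin j by (intro member_le_sum) auto
    hence "max 0 (a j - k j) < \<epsilon>" using k eps by (intro power2_less_imp_less[of _ \<epsilon>]) auto
    thus ?thesis by simp
  qed
  thus ?thesis using k by blast
qed

section \<open>Duality of finite sequence spaces and the weak p-norm\<close>

lemma conjugate_exponent_gt_1:
  assumes "1 < p"
  shows "conjugate_exponent p \<noteq> \<infinity>" "real_of_ereal (conjugate_exponent p) = p / (p - 1)"
  using assms by (auto simp: conjugate_exponent_def)

lemma powr_le_one_iff_base:
  fixes x :: real
  assumes "0 < e" "0 \<le> x"
  shows "x powr e \<le> 1 \<longleftrightarrow> x \<le> 1"
proof
  assume "x powr e \<le> 1"
  thus "x \<le> 1" using gr_one_powr[of x e] assms(1) by (meson not_le)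
next
  assume "x \<le> 1"
  thus "x powr e \<le> 1" using powr_mono2[of e x 1] assms by auto
qed

text \<open>Only the unit ball of the conjugate norm matters below, and membership in it is
  unaffected by the outer root.\<close>

lemma lq_norm_conjugate_le_1_iff:
  assumes "1 \<le> p"
  shows "lq_norm (conjugate_exponent p) n a \<le> 1 \<longleftrightarrow>
    (if p = 1 then \<forall>i<n. \<bar>a i\<bar> \<le> 1 else (\<Sum>i<n. \<bar>a i\<bar> powr (p / (p - 1))) \<le> 1)"
proof (cases "p = 1")
  case True
  thus ?thesis by (auto simp: lq_norm_def conjugate_exponent_def)
next
  case False
  hence p: "1 < p" using assms by simp
  have "x powr (1 / (p / (p - 1))) \<le> 1 \<longleftrightarrow> x \<le> 1" if "0 \<le> x" for x
    using p that by (intro powr_le_one_iff_base) auto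
  thus ?thesis
    using False conjugate_exponent_gt_1[OF p] by (simp add: lq_norm_def sum_nonneg)
qed

text \<open>Solidity of the dual ball; it allows coefficients to be rounded towards zero.\<close>

lemma lq_norm_conjugate_le_1_mono:
  assumes "1 \<le> p" "lq_norm (conjugate_exponent p) n a \<le> 1" "\<And>i. i < n \<Longrightarrow> \<bar>b i\<bar> \<le> \<bar>a i\<bar>"
  shows "lq_norm (conjugate_exponent p) n b \<le> 1"
proof -
  have "(\<Sum>i<n. \<bar>b i\<bar> powr (p / (p - 1))) \<le> (\<Sum>i<n. \<bar>a i\<bar> powr (p / (p - 1)))"
    using assms by (intro sum_mono powr_mono2) auto
  moreover have "(\<forall>i<n. \<bar>a i\<bar> \<le> 1) \<Longrightarrow> (\<forall>i<n. \<bar>b i\<bar> \<le> 1)"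
    using assms(3) order_trans by blast
  ultimately show ?thesis
    using assms(2) unfolding lq_norm_conjugate_le_1_iff[OF assms(1)] by (auto split: if_splits)
qed

lemma lq_norm_conjugate_le_1_coord:
  assumes "1 \<le> p" "lq_norm (conjugate_exponent p) n a \<le> 1" "i < n"
  shows "\<bar>a i\<bar> \<le> 1"
proof (cases "p = 1")
  case False
  hence p: "1 < p" using assms by simp
  have "\<bar>a i\<bar> powr (p / (p - 1)) \<le> (\<Sum>i<n. \<bar>a i\<bar> powr (p / (p - 1)))"
    using assms by (intro member_le_sum) auto
  also have "\<dots> \<le> 1" using assms False by (simp add: lq_norm_conjugate_le_1_iff)
  finally show ?thesis
    using p by (subst (asm) powr_le_one_iff_base) auto
qed (use assms in \<open>auto simp: lq_norm_conjugate_le_1_iff\<close>)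

lemma powr_inverse_powr:
  fixes x :: real
  assumes "p \<noteq> 0" "0 \<le> x"
  shows "(x powr p) powr (1 / p) = x" "(x powr (1 / p)) powr p = x"
  using assms by (auto simp: powr_powr)

text \<open>Young's inequality for \<open>\<bar>t i\<bar> / S\<close> and
  \<open>\<bar>a i\<bar>\<close>, where \<open>S\<close> is the right-hand side: after normalisation
  the two sums of powers are 1 and at most 1. The case S = 0 is separate because of the
  division.\<close>

lemma Hoelder_sum:
  assumes p: "1 \<le> p" and a: "lq_norm (conjugate_exponent p) n a \<le> 1"
  shows "\<bar>\<Sum>i<n. a i * t i\<bar> \<le> (\<Sum>i<n. \<bar>t i\<bar> powr p) powr (1 / p)"
proof (cases "p = 1")
  case True
  have "\<bar>\<Sum>i<n. a i * t i\<bar> \<le> (\<Sum>i<n. \<bar>a i * t i\<bar>)" by (rule sum_abs)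
  also have "\<dots> \<le> (\<Sum>i<n. \<bar>t i\<bar>)"
    using a True by (intro sum_mono) (auto simp: lq_norm_conjugate_le_1_iff abs_mult intro: mult_left_le_one_le)
  finally show ?thesis using True by (simp add: sum_nonneg)
next
  case False
  hence p1: "1 < p" using p by simp
  define q where "q = p / (p - 1)"
  have q: "1 < q" "1 / p + 1 / q = 1" using p1 by (auto simp: q_def field_simps)
  have aq: "(\<Sum>i<n. \<bar>a i\<bar> powr q) \<le> 1" using a False by (simp add: lq_norm_conjugate_le_1_iff[OF p] q_def)
  define S where "S = (\<Sum>i<n. \<bar>t i\<bar> powr p) powr (1 / p)"
  have Sp: "S powr p = (\<Sum>i<n. \<bar>t i\<bar> powr p)"
    unfolding S_def using p1 by (intro powr_inverse_powr) (auto simp: sum_nonneg)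
  show ?thesis
  proof (cases "S = 0")
    case True
    hence "(\<Sum>i<n. \<bar>t i\<bar> powr p) = 0" using Sp p1 by simp
    hence "\<forall>i<n. t i = 0" by (subst (asm) sum_nonneg_eq_0_iff) auto
    thus ?thesis by simp
  next
    case False
    hence S: "0 < S" using S_def by (metis less_eq_real_def powr_ge_zero)
    have u: "(\<Sum>i<n. (\<bar>t i\<bar> / S) powr p) = 1"
      using S by (simp add: powr_divide flip: sum_divide_distrib Sp)
    have "\<bar>\<Sum>i<n. a i * t i\<bar> \<le> (\<Sum>i<n. \<bar>a i * t i\<bar>)" by (rule sum_abs)
    also have "\<dots> = S * (\<Sum>i<n. (\<bar>t i\<bar> / S) * \<bar>a i\<bar>)"
      using S by (simp add: sum_distrib_left abs_mult algebra_simps)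
    also have "\<dots> \<le> S * (\<Sum>i<n. (\<bar>t i\<bar> / S) powr p / p + \<bar>a i\<bar> powr q / q)"
      using S p1 q by (intro mult_left_mono sum_mono Youngs_inequality) auto
    also have "\<dots> = S * (1 / p + (\<Sum>i<n. \<bar>a i\<bar> powr q) / q)"
      using u by (simp add: sum.distrib flip: sum_divide_distrib)
    also have "\<dots> \<le> S * (1 / p + 1 / q)"
      using aq q S by (intro mult_left_mono add_left_mono divide_right_mono) auto
    finally show ?thesis using q by (simp add: S_def)
  qed
qed

text \<open>The extremal coefficients are signs for p = 1 and otherwise
  \<open>sgn (t i) * (\<bar>t i\<bar> / S) powr (p - 1)\<close>, the equality case of Young's
  inequality.\<close>

lemma Hoelder_sum_attained:
  assumes p: "1 \<le> p"
  obtains a where "lq_norm (conjugate_exponent p) n a \<le> 1"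
    "(\<Sum>i<n. a i * t i) = (\<Sum>i<n. \<bar>t i\<bar> powr p) powr (1 / p)"
proof (cases "p = 1")
  case True
  show ?thesis
    by (rule that[of "\<lambda>i. sgn (t i)"])
      (use True in \<open>auto simp: lq_norm_conjugate_le_1_iff sgn_if sum_nonneg intro!: sum.cong\<close>)
next
  case False
  hence p1: "1 < p" using p by simp
  define S where "S = (\<Sum>i<n. \<bar>t i\<bar> powr p) powr (1 / p)"
  have Sp: "S powr p = (\<Sum>i<n. \<bar>t i\<bar> powr p)"
    unfolding S_def using p1 by (intro powr_inverse_powr) (auto simp: sum_nonneg)
  show ?thesis
  proof (cases "S = 0")
    case True
    thus ?thesis using that[of "\<lambda>_. 0"] False p by (auto simp: lq_norm_conjugate_le_1_iff S_def)
  next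
    case False
    hence S: "0 < S" using S_def by (metis less_eq_real_def powr_ge_zero)
    define a where "a i = sgn (t i) * (\<bar>t i\<bar> / S) powr (p - 1)" for i
    have "\<bar>a i\<bar> powr (p / (p - 1)) = (\<bar>t i\<bar> / S) powr p" for i
      using p1 by (auto simp: a_def abs_mult powr_powr sgn_if)
    hence 1: "(\<Sum>i<n. \<bar>a i\<bar> powr (p / (p - 1))) = 1"
      using S by (simp add: powr_divide flip: sum_divide_distrib Sp)
    have "a i * t i = S * (\<bar>t i\<bar> / S) powr p" for i
    proof -
      have "a i * t i = S * ((\<bar>t i\<bar> / S) * (\<bar>t i\<bar> / S) powr (p - 1))"
        using S by (simp add: a_def sgn_if)
      also have "(\<bar>t i\<bar> / S) * (\<bar>t i\<bar> / S) powr (p - 1) = (\<bar>t i\<bar> / S) powr p"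
        using S powr_mult_base[of "\<bar>t i\<bar> / S" "p - 1"] by simp
      finally show ?thesis .
    qed
    hence "(\<Sum>i<n. a i * t i) = S"
      using S by (simp add: powr_divide flip: sum_divide_distrib sum_distrib_left Sp)
    thus ?thesis using that[of a] 1 p p1 by (simp add: lq_norm_conjugate_le_1_iff S_def)
  qed
qed

section \<open>Weak p-norms of sequences of functionals\<close>

lemma bdd_above_weak_norm:
  assumes "1 \<le> p"
  shows "bdd_above ((\<lambda>a. norm (\<Sum>i<n. a i *\<^sub>R z i)) ` {a. lq_norm (conjugate_exponent p) n a \<le> 1})"
proof (rule bdd_aboveI2)
  fix a assume a: "a \<in> {a. lq_norm (conjugate_exponent p) n a \<le> 1}"
  show "norm (\<Sum>i<n. a i *\<^sub>R z i) \<le> (\<Sum>i<n. norm (z i))"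
    using lq_norm_conjugate_le_1_coord[OF assms, of n a] a
    by (intro sum_norm_le) (auto intro: mult_left_le_one_le)
qed

lemma weak_norm_upper:
  assumes "1 \<le> p" "lq_norm (conjugate_exponent p) n a \<le> 1"
  shows "norm (\<Sum>i<n. a i *\<^sub>R z i) \<le> weak_norm p n z"
  unfolding weak_norm_def using assms by (intro cSUP_upper bdd_above_weak_norm) auto

lemma weak_norm_least:
  assumes "1 \<le> p" "\<And>a. lq_norm (conjugate_exponent p) n a \<le> 1 \<Longrightarrow> norm (\<Sum>i<n. a i *\<^sub>R z i) \<le> s"
  shows "weak_norm p n z \<le> s"
proof -
  have "(\<lambda>_. 0) \<in> {a. lq_norm (conjugate_exponent p) n a \<le> 1}"
    using assms(1) by (simp add: lq_norm_conjugate_le_1_iff)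
  thus ?thesis unfolding weak_norm_def using assms(2) by (intro cSUP_least) auto
qed

lemma weak_norm_nonneg: "1 \<le> p \<Longrightarrow> 0 \<le> weak_norm p n z"
  using weak_norm_upper[of p n "\<lambda>_. 0" z] by (simp add: lq_norm_conjugate_le_1_iff)

lemma weak_norm_single: "1 \<le> p \<Longrightarrow> weak_norm p 1 (\<lambda>_. z) \<le> norm z"
  using lq_norm_conjugate_le_1_coord[of p 1 _ 0]
  by (intro weak_norm_least) (auto intro!: mult_left_le_one_le)

text \<open>With extremal coefficients for the scalars \<open>z i x\<close>, the left-hand side
  becomes the value at x of one linear combination of the \<open>z i\<close>, whose norm the weak
  norm controls.\<close>

lemma sum_powr_apply_le_weak_norm:
  fixes z :: "nat \<Rightarrow> 'x::real_normed_vector \<Rightarrow>\<^sub>L real"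
  assumes "1 \<le> p"
  shows "(\<Sum>i<n. \<bar>blinfun_apply (z i) x\<bar> powr p) powr (1 / p) \<le> weak_norm p n z * norm x"
    "(\<Sum>i<n. \<bar>blinfun_apply (z i) x\<bar> powr p) \<le> weak_norm p n z powr p * norm x powr p"
proof -
  obtain a where a: "lq_norm (conjugate_exponent p) n a \<le> 1"
    "(\<Sum>i<n. a i * blinfun_apply (z i) x) = (\<Sum>i<n. \<bar>blinfun_apply (z i) x\<bar> powr p) powr (1 / p)"
    using Hoelder_sum_attained[OF assms] by metis
  have "(\<Sum>i<n. a i * blinfun_apply (z i) x) = blinfun_apply (\<Sum>i<n. a i *\<^sub>R z i) x"
    by (simp add: blinfun.sum_left blinfun.scaleR_left)
  also have "\<dots> \<le> norm (\<Sum>i<n. a i *\<^sub>R z i) * norm x"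
    using norm_blinfun[of "\<Sum>i<n. a i *\<^sub>R z i" x] by simp
  also have "\<dots> \<le> weak_norm p n z * norm x"
    using weak_norm_upper[OF assms a(1)] by (intro mult_right_mono) auto
  finally show 1: "(\<Sum>i<n. \<bar>blinfun_apply (z i) x\<bar> powr p) powr (1 / p) \<le> weak_norm p n z * norm x"
    using a by simp
  have "((\<Sum>i<n. \<bar>blinfun_apply (z i) x\<bar> powr p) powr (1 / p)) powr p \<le> (weak_norm p n z * norm x) powr p"
    using 1 assms by (intro powr_mono2) auto
  thus "(\<Sum>i<n. \<bar>blinfun_apply (z i) x\<bar> powr p) \<le> weak_norm p n z powr p * norm x powr p"
    using assms by (simp add: powr_inverse_powr sum_nonneg powr_mult weak_norm_nonneg)
qed

text \<open>Converse of the previous estimate: by Hoelder, a bound at all points of the unit ball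
  bounds every admissible combination in operator norm. So the weak p-norm of functionals is
  computed on the ball of the space itself, without the bidual.\<close>

lemma weak_norm_powr_le:
  fixes z :: "nat \<Rightarrow> 'x::real_normed_vector \<Rightarrow>\<^sub>L real"
  assumes p: "1 \<le> p" and s: "0 \<le> s"
    and le: "\<And>x. norm x \<le> 1 \<Longrightarrow> (\<Sum>i<n. \<bar>blinfun_apply (z i) x\<bar> powr p) \<le> s"
  shows "weak_norm p n z powr p \<le> s"
proof -
  have "norm (\<Sum>i<n. a i *\<^sub>R z i) \<le> s powr (1 / p)"
    if a: "lq_norm (conjugate_exponent p) n a \<le> 1" for a
  proof (rule norm_blinfun_bound)
    fix x :: 'x
    let ?x = "x /\<^sub>R norm x"
    show "norm (blinfun_apply (\<Sum>i<n. a i *\<^sub>R z i) x) \<le> s powr (1 / p) * norm x"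
    proof (cases "x = 0")
      case False
      have "\<bar>\<Sum>i<n. a i * blinfun_apply (z i) ?x\<bar> \<le> (\<Sum>i<n. \<bar>blinfun_apply (z i) ?x\<bar> powr p) powr (1 / p)"
        by (rule Hoelder_sum[OF p a])
      also have "\<dots> \<le> s powr (1 / p)"
        using False p by (intro powr_mono2 le) (auto simp: sum_nonneg)
      finally have *: "\<bar>\<Sum>i<n. a i * blinfun_apply (z i) ?x\<bar> \<le> s powr (1 / p)" .
      have "norm x * (a i * blinfun_apply (z i) ?x) = a i * blinfun_apply (z i) x" for i
        using False by (simp add: blinfun.scaleR_right)
      hence "blinfun_apply (\<Sum>i<n. a i *\<^sub>R z i) x = norm x * (\<Sum>i<n. a i * blinfun_apply (z i) ?x)"
        by (simp only: sum_distrib_left blinfun.sum_left blinfun.scaleR_left real_scaleR_def)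
      thus ?thesis using mult_left_mono[OF *, of "norm x"] by (simp add: abs_mult mult.commute)
    qed auto
  qed auto
  hence "weak_norm p n z \<le> s powr (1 / p)" by (rule weak_norm_least[OF p])
  hence "weak_norm p n z powr p \<le> (s powr (1 / p)) powr p"
    using p by (intro powr_mono2) (auto simp: weak_norm_nonneg)
  thus ?thesis using p s by (simp add: powr_inverse_powr)
qed

section \<open>Positively homogeneous weak* continuous functions\<close>

lemma Hw_I:
  assumes "\<And>c \<phi>. 0 \<le> c \<Longrightarrow> f (c *\<^sub>R \<phi>) = c * f \<phi>"
    and "\<And>B. bounded B \<Longrightarrow> continuous_map (subtopology weak_star_topology B) euclideanreal f"
  shows "f \<in> Hw"
  using assms by (auto simp: Hw_def)

lemma Hw_homogeneous: "f \<in> Hw \<Longrightarrow> 0 \<le> c \<Longrightarrow> f (c *\<^sub>R \<phi>) = c * f \<phi>"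
  by (auto simp: Hw_def)

lemma Hw_continuous: "f \<in> Hw \<Longrightarrow> bounded B \<Longrightarrow> continuous_map (subtopology weak_star_topology B) euclideanreal f"
  by (auto simp: Hw_def)

lemma Hw_zero: "(\<lambda>_. 0) \<in> Hw"
  by (rule Hw_I) auto

lemma Hw_add: "f \<in> Hw \<Longrightarrow> g \<in> Hw \<Longrightarrow> (\<lambda>\<phi>. f \<phi> + g \<phi>) \<in> Hw"
  by (rule Hw_I, simp add: Hw_homogeneous distrib_left, rule continuous_map_add) (auto intro: Hw_continuous)

lemma Hw_cmult: "f \<in> Hw \<Longrightarrow> (\<lambda>\<phi>. c * f \<phi>) \<in> Hw"
  by (rule Hw_I, simp add: Hw_homogeneous mult.left_commute, rule continuous_map_real_mult_left) (auto intro: Hw_continuous)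

lemma Hw_abs: "f \<in> Hw \<Longrightarrow> (\<lambda>\<phi>. \<bar>f \<phi>\<bar>) \<in> Hw"
  by (rule Hw_I, simp add: Hw_homogeneous abs_mult, rule continuous_map_real_abs) (auto intro: Hw_continuous)

lemma Hw_max: "f \<in> Hw \<Longrightarrow> g \<in> Hw \<Longrightarrow> (\<lambda>\<phi>. max (f \<phi>) (g \<phi>)) \<in> Hw"
  by (rule Hw_I, simp add: Hw_homogeneous max_mult_distrib_left, rule continuous_map_real_max) (auto intro: Hw_continuous)

lemma Hw_min: "f \<in> Hw \<Longrightarrow> g \<in> Hw \<Longrightarrow> (\<lambda>\<phi>. min (f \<phi>) (g \<phi>)) \<in> Hw"
  by (rule Hw_I, simp add: Hw_homogeneous min_mult_distrib_left, rule continuous_map_real_min) (auto intro: Hw_continuous)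

lemma sup_inf_real_fun:
  fixes f g :: "'a \<Rightarrow> real"
  shows "sup f g = (\<lambda>w. max (f w) (g w))" "inf f g = (\<lambda>w. min (f w) (g w))"
  by (auto simp: sup_max inf_min)

lemma point_eval_Hw: "point_eval x \<in> Hw"
  by (rule Hw_I) (auto simp: point_eval_def[abs_def] blinfun.scaleR_left
      intro!: continuous_map_from_subtopology strong_operator_topology_continuous_evaluation)

text \<open>An error proportional to \<open>norm \<phi>\<close> is uniform on bounded sets, and
  continuity is required only there.\<close>

lemma Hw_uniform_limit:
  fixes f :: "('x::banach \<Rightarrow>\<^sub>L real) \<Rightarrow> real"
  assumes hom: "\<And>c \<phi>. 0 \<le> c \<Longrightarrow> f (c *\<^sub>R \<phi>) = c * f \<phi>"
    and approx: "\<And>\<epsilon>. 0 < \<epsilon> \<Longrightarrow> \<exists>g\<in>Hw. \<forall>\<phi>. \<bar>g \<phi> - f \<phi>\<bar> \<le> \<epsilon> * norm \<phi>"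
  shows "f \<in> Hw"
proof (rule Hw_I[OF hom])
  fix B :: "('x \<Rightarrow>\<^sub>L real) set" assume B: "bounded B"
  then obtain b where b: "0 < b" "\<And>\<phi>. \<phi> \<in> B \<Longrightarrow> norm \<phi> \<le> b" unfolding bounded_pos by blast
  define g where "g n = (SOME g. g \<in> Hw \<and> (\<forall>\<phi>. \<bar>g \<phi> - f \<phi>\<bar> \<le> inverse (real (Suc n)) * norm \<phi>))" for n
  have g: "g n \<in> Hw" "\<bar>g n \<phi> - f \<phi>\<bar> \<le> inverse (real (Suc n)) * norm \<phi>" for n \<phi>
  proof -
    have "\<exists>g. g \<in> Hw \<and> (\<forall>\<phi>. \<bar>g \<phi> - f \<phi>\<bar> \<le> inverse (real (Suc n)) * norm \<phi>)"
      using approx[of "inverse (real (Suc n))"] by auto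
    from someI_ex[OF this] show "g n \<in> Hw" "\<bar>g n \<phi> - f \<phi>\<bar> \<le> inverse (real (Suc n)) * norm \<phi>"
      unfolding g_def by blast+
  qed
  have "continuous_map (subtopology weak_star_topology B) Met_TC.mtopology f"
  proof (rule Met_TC.continuous_map_uniform_limit[where f = g and F = sequentially])
    show "\<forall>\<^sub>F n in sequentially. continuous_map (subtopology weak_star_topology B) Met_TC.mtopology (g n)"
      using Hw_continuous[OF g(1) B] by auto
    fix \<epsilon> :: real assume "0 < \<epsilon>"
    have "(\<lambda>n. inverse (real (Suc n)) * b) \<longlonglongrightarrow> 0 * b"
      by (intro tendsto_mult LIMSEQ_inverse_real_of_nat tendsto_const)
    hence "\<forall>\<^sub>F n in sequentially. inverse (real (Suc n)) * b < \<epsilon>"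
      using \<open>0 < \<epsilon>\<close> by (simp add: order_tendsto_iff)
    thus "\<forall>\<^sub>F n in sequentially. \<forall>\<phi>\<in>topspace (subtopology weak_star_topology B). f \<phi> \<in> UNIV \<and> dist (g n \<phi>) (f \<phi>) < \<epsilon>"
    proof eventually_elim
      case (elim n)
      have "dist (g n \<phi>) (f \<phi>) < \<epsilon>" if "\<phi> \<in> B" for \<phi>
      proof -
        have "\<bar>g n \<phi> - f \<phi>\<bar> \<le> inverse (real (Suc n)) * norm \<phi>" by (rule g(2))
        also have "\<dots> \<le> inverse (real (Suc n)) * b" using b(2)[OF that] by (intro mult_left_mono) auto
        finally show ?thesis using elim by (simp only: dist_real_def)
      qed
      thus ?case by auto
    qed
  qed simp
  thus "continuous_map (subtopology weak_star_topology B) euclideanreal f" by simp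
qed

lemma openin_weak_star_imp_open_preimage: fixes U :: "('x::real_normed_vector \<Rightarrow>\<^sub>L real) set"
  assumes "openin weak_star_topology U"
  shows "\<exists>V. open V \<and> U = blinfun_apply -` V"
proof -
  have "openin (pullback_topology UNIV blinfun_apply euclidean) U" using assms unfolding strong_operator_topology_def .
  from this[THEN iffD1[OF openin_pullback_topology]]
  obtain V where "openin euclidean V" "U = blinfun_apply -` V \<inter> UNIV" by (elim exE conjE)
  hence "open V \<and> U = blinfun_apply -` V" by (intro conjI) (simp_all only: open_openin Int_UNIV_right)
  thus ?thesis ..
qed
text \<open>A basic neighbourhood in the product topology restricts finitely many coordinates; the
  smallest of the corresponding radii serves for all of them.\<close>

lemma Hw_nbhd:
  fixes f :: "('x::banach \<Rightarrow>\<^sub>L real) \<Rightarrow> real"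
  assumes f: "f \<in> Hw" and B: "bounded B" "\<phi> \<in> B" and e: "0 < \<epsilon>"
  obtains F \<delta> where "finite F" "0 < \<delta>"
    "\<And>\<psi>. \<psi> \<in> B \<Longrightarrow> (\<And>x. x \<in> F \<Longrightarrow> \<bar>blinfun_apply \<psi> x - blinfun_apply \<phi> x\<bar> < \<delta>) \<Longrightarrow> \<bar>f \<psi> - f \<phi>\<bar> < \<epsilon>"
proof -
  have "openin (subtopology weak_star_topology B) {\<psi> \<in> topspace (subtopology weak_star_topology B). f \<psi> \<in> ball (f \<phi>) \<epsilon>}"
    by (rule openin_continuous_map_preimage[OF Hw_continuous[OF f B(1)]]) simp
  then obtain U where U: "openin weak_star_topology U" "{\<psi> \<in> B. f \<psi> \<in> ball (f \<phi>) \<epsilon>} = U \<inter> B"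
    unfolding openin_subtopology topspace_subtopology strong_operator_topology_topspace Int_UNIV_left by blast
  obtain V :: "('x \<Rightarrow> real) set" where V: "open V" "U = blinfun_apply -` V"
    using openin_weak_star_imp_open_preimage[OF U(1)] by (elim exE conjE)
  have "\<phi> \<in> {\<psi> \<in> B. f \<psi> \<in> ball (f \<phi>) \<epsilon>}" using B e by simp
  hence "\<phi> \<in> U" unfolding U(2) by (rule IntD1)
  hence "blinfun_apply \<phi> \<in> V" unfolding V(2) by (rule vimageD)
  moreover have "openin (product_topology (\<lambda>_::'x. euclideanreal) UNIV) V" using V(1) by (simp add: open_fun_def)
  ultimately obtain W where W: "blinfun_apply \<phi> \<in> Pi\<^sub>E UNIV W" "\<And>x. open (W x)" "finite {x. W x \<noteq> UNIV}" "Pi\<^sub>E UNIV W \<subseteq> V"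
    using product_topology_open_contains_basis[of "\<lambda>_::'x. euclideanreal" UNIV V "blinfun_apply \<phi>"]
    by auto
  define F where "F = {x. W x \<noteq> UNIV}"
  have "\<exists>d>0. ball (blinfun_apply \<phi> x) d \<subseteq> W x" for x
    using W(1) open_contains_ball[of "W x"] W(2)[of x] by (auto simp: PiE_def Pi_def)
  then obtain d where d: "\<And>x. 0 < d x" "\<And>x. ball (blinfun_apply \<phi> x) (d x) \<subseteq> W x" by metis
  \<comment> \<open>The inserted 1 keeps \<open>Min\<close> meaningful when no coordinate is
    restricted.\<close>
  define \<delta> where "\<delta> = Min (insert 1 (d ` F))"
  have F: "finite F" using W(3) by (simp add: F_def)
  have \<delta>: "0 < \<delta>" "\<And>x. x \<in> F \<Longrightarrow> \<delta> \<le> d x" using F d by (auto simp: \<delta>_def)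
  show ?thesis
  proof (rule that[OF F \<delta>(1)])
    fix \<psi> assume \<psi>: "\<psi> \<in> B" "\<And>x. x \<in> F \<Longrightarrow> \<bar>blinfun_apply \<psi> x - blinfun_apply \<phi> x\<bar> < \<delta>"
    have "blinfun_apply \<psi> x \<in> W x" for x
    proof (cases "x \<in> F")
      case True
      hence "blinfun_apply \<psi> x \<in> ball (blinfun_apply \<phi> x) (d x)"
        using \<psi>(2)[OF True] \<delta>(2)[OF True] by (simp add: dist_real_def)
      thus ?thesis using d by blast
    qed (simp add: F_def)
    hence "blinfun_apply \<psi> \<in> Pi\<^sub>E UNIV W" by (simp add: PiE_UNIV_domain Pi_def)
    hence "\<psi> \<in> U" using W(4) unfolding V(2) by (intro vimageI2) (rule subsetD)
    hence "\<psi> \<in> {\<psi> \<in> B. f \<psi> \<in> ball (f \<phi>) \<epsilon>}" unfolding U(2) using \<psi>(1) by (rule IntI)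
    hence "f \<psi> \<in> ball (f \<phi>) \<epsilon>" by simp
    thus "\<bar>f \<psi> - f \<phi>\<bar> < \<epsilon>" by (simp add: dist_real_def)
  qed
qed

section \<open>The sublattice and the ideal generated by the evaluations\<close>

lemma vector_sublattice_Inter:
  assumes "T \<noteq> {}" "\<And>S. S \<in> T \<Longrightarrow> vector_sublattice H S"
  shows "vector_sublattice H (\<Inter>T)"
proof -
  have "S \<subseteq> H" "(\<lambda>_. 0) \<in> S" "\<And>f g. f \<in> S \<Longrightarrow> g \<in> S \<Longrightarrow> (\<lambda>w. f w + g w) \<in> S"
    "\<And>c f. f \<in> S \<Longrightarrow> (\<lambda>w. c * f w) \<in> S" "\<And>f g. f \<in> S \<Longrightarrow> g \<in> S \<Longrightarrow> sup f g \<in> S"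
    "\<And>f g. f \<in> S \<Longrightarrow> g \<in> S \<Longrightarrow> inf f g \<in> S" if "S \<in> T" for S
    using assms(2)[OF that] by (auto simp: vector_sublattice_def function_subspace_def)
  with assms(1) show ?thesis
    unfolding vector_sublattice_def function_subspace_def
    by (intro conjI ballI allI InterI) (meson Inter_lower InterE ex_in_conv subset_trans)+
qed

lemma order_ideal_Inter:
  assumes "T \<noteq> {}" "\<And>S. S \<in> T \<Longrightarrow> order_ideal H S"
  shows "order_ideal H (\<Inter>T)"
proof -
  have "S \<subseteq> H" "(\<lambda>_. 0) \<in> S" "\<And>f g. f \<in> S \<Longrightarrow> g \<in> S \<Longrightarrow> (\<lambda>w. f w + g w) \<in> S"
    "\<And>c f. f \<in> S \<Longrightarrow> (\<lambda>w. c * f w) \<in> S"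
    "\<And>f g. g \<in> S \<Longrightarrow> f \<in> H \<Longrightarrow> (\<lambda>w. \<bar>f w\<bar>) \<le> (\<lambda>w. \<bar>g w\<bar>) \<Longrightarrow> f \<in> S" if "S \<in> T" for S
    using assms(2)[OF that] by (auto simp: order_ideal_def function_subspace_def)
  with assms(1) show ?thesis
    unfolding order_ideal_def function_subspace_def
    by (intro conjI ballI allI impI InterI) (meson Inter_lower InterE ex_in_conv subset_trans)+
qed

text \<open>\<open>hull\<close> is an intersection, so it inherits the structure once some
  admissible set, here \<open>Hw\<close> itself, contains all evaluations.\<close>

lemma vector_sublattice_FVL: "vector_sublattice Hw (FVL :: (('x::banach \<Rightarrow>\<^sub>L real) \<Rightarrow> real) set)"
proof -
  let ?H = "Hw :: (('x \<Rightarrow>\<^sub>L real) \<Rightarrow> real) set"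
  have "vector_sublattice ?H ?H"
    by (auto simp: vector_sublattice_def function_subspace_def Hw_zero Hw_add Hw_cmult sup_inf_real_fun Hw_max Hw_min)
  moreover have "range point_eval \<subseteq> ?H" using point_eval_Hw by auto
  ultimately show ?thesis
    unfolding FVL_def hull_def by (intro vector_sublattice_Inter) auto
qed

lemma point_eval_FVL: "point_eval x \<in> FVL"
  unfolding FVL_def by (rule hull_inc) simp

lemma FVL_subset_Hw: "FVL \<subseteq> Hw"
  by (rule conjunct1[OF vector_sublattice_FVL[unfolded vector_sublattice_def]])

lemma order_ideal_Iw: "order_ideal Hw (Iw :: (('x::banach \<Rightarrow>\<^sub>L real) \<Rightarrow> real) set)"
proof -
  let ?H = "Hw :: (('x \<Rightarrow>\<^sub>L real) \<Rightarrow> real) set"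
  have "order_ideal ?H ?H"
    by (auto simp: order_ideal_def function_subspace_def Hw_zero Hw_add Hw_cmult)
  moreover have "range point_eval \<subseteq> ?H" using point_eval_Hw by auto
  ultimately show ?thesis
    unfolding Iw_def hull_def by (intro order_ideal_Inter) auto
qed

text \<open>Maximum and minimum of f and g are dominated by the sum of the absolute values, which
  lies in the ideal, so solidity captures them.\<close>

lemma order_ideal_imp_vector_sublattice:
  assumes J: "order_ideal (Hw :: (('x::banach \<Rightarrow>\<^sub>L real) \<Rightarrow> real) set) J"
  shows "vector_sublattice Hw J"
proof -
  have JH: "J \<subseteq> Hw" and add: "\<And>f g. f \<in> J \<Longrightarrow> g \<in> J \<Longrightarrow> (\<lambda>w. f w + g w) \<in> J"
    and solid: "\<And>f g. g \<in> J \<Longrightarrow> f \<in> Hw \<Longrightarrow> (\<And>w. \<bar>f w\<bar> \<le> \<bar>g w\<bar>) \<Longrightarrow> f \<in> J"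
    using J by (auto simp: order_ideal_def function_subspace_def le_fun_def)
  have abs: "(\<lambda>w. \<bar>f w\<bar>) \<in> J" if "f \<in> J" for f
    using that JH by (intro solid[OF that] Hw_abs) auto
  have "sup f g \<in> J \<and> inf f g \<in> J" if "f \<in> J" "g \<in> J" for f g
  proof -
    have "(\<lambda>w. \<bar>f w\<bar> + \<bar>g w\<bar>) \<in> J" using that by (intro add abs)
    note dominated = solid[OF this]
    have "f \<in> Hw" "g \<in> Hw" using that JH by auto
    thus ?thesis
      unfolding sup_inf_real_fun by (intro conjI dominated Hw_max Hw_min) auto
  qed
  thus ?thesis using J by (auto simp: vector_sublattice_def order_ideal_def)
qed

lemma FVL_subset_Iw: "FVL \<subseteq> Iw"
  unfolding FVL_def
  by (intro hull_minimal order_ideal_imp_vector_sublattice order_ideal_Iw)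
    (auto simp: Iw_def intro: hull_inc)

lemma FVL_sup: "f \<in> FVL \<Longrightarrow> g \<in> FVL \<Longrightarrow> sup f g \<in> FVL"
  using vector_sublattice_FVL unfolding vector_sublattice_def by blast

lemma FVL_Max:
  assumes "finite A" "A \<noteq> {}"
  shows "(\<lambda>\<phi>. Max ((\<lambda>a. blinfun_apply \<phi> (x a)) ` A)) \<in> FVL"
  using assms
proof (induction rule: finite_ne_induct)
  case (singleton a)
  show ?case using point_eval_FVL[of "x a"] by (simp add: point_eval_def[abs_def])
next
  case (insert a A)
  have "sup (point_eval (x a)) (\<lambda>\<phi>. Max ((\<lambda>a. blinfun_apply \<phi> (x a)) ` A)) \<in> FVL"
    by (intro FVL_sup insert.IH point_eval_FVL)
  thus ?case using insert.hyps by (simp add: sup_inf_real_fun point_eval_def)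
qed

lemma closure_Hwp_mono: "S \<subseteq> S' \<Longrightarrow> closure_Hwp p S \<subseteq> closure_Hwp p S'"
  unfolding closure_Hwp_def by blast

text \<open>The infimum in \<open>pnorm\<close> is attained, because the admissible constants are
  cut out by non-strict inequalities. In p-th powers the bound becomes one on sums, which can later
  be exchanged with integrals.\<close>

lemma pnorm_le_iff:
  fixes f :: "('x::banach \<Rightarrow>\<^sub>L real) \<Rightarrow> real"
  assumes p: "1 \<le> p" and C: "0 \<le> C"
  shows "pnorm p f \<le> ennreal C \<longleftrightarrow>
    (\<forall>n z. (\<Sum>i<n. \<bar>f (z i)\<bar> powr p) \<le> C powr p * weak_norm p n z powr p)" (is "_ \<longleftrightarrow> ?R")
proof -
  have root_le_iff: "s powr (1 / p) \<le> b \<longleftrightarrow> s \<le> b powr p" if "0 \<le> s" "0 \<le> b" for s b :: real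
    using that p powr_mono2[of p "s powr (1 / p)" b] powr_mono2[of "1 / p" s "b powr p"]
    by (auto simp: powr_inverse_powr)
  have iff: "(\<Sum>i<n. \<bar>f (z i)\<bar> powr p) powr (1 / p) \<le> c * weak_norm p n z \<longleftrightarrow>
      (\<Sum>i<n. \<bar>f (z i)\<bar> powr p) \<le> c powr p * weak_norm p n z powr p" if "0 \<le> c" for c n z
    using that p by (subst root_le_iff) (auto simp: sum_nonneg weak_norm_nonneg powr_mult)
  let ?P = "\<lambda>c. \<forall>n z. (\<Sum>i<n. \<bar>f (z i)\<bar> powr p) powr (1 / p) \<le> c * weak_norm p n z"
  have "?P C" if le: "pnorm p f \<le> ennreal C"
  proof (intro allI)
    fix n and z :: "nat \<Rightarrow> 'x \<Rightarrow>\<^sub>L real"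
    let ?s = "(\<Sum>i<n. \<bar>f (z i)\<bar> powr p) powr (1 / p)" and ?W = "weak_norm p n z"
    have W: "0 \<le> ?W" using p by (rule weak_norm_nonneg)
    show "?s \<le> C * ?W"
    proof (rule field_le_epsilon)
      fix e :: real assume e: "0 < e"
      \<comment> \<open>An admissible constant below \<open>C + d\<close> overshoots by at most
        \<open>d * ?W\<close>; the added 1 covers \<open>?W = 0\<close>.\<close>
      define d where "d = e / (?W + 1)"
      have d: "0 < d" using e W by (simp add: d_def)
      have "pnorm p f < ennreal (C + d)"
        using le d C by (auto intro: le_less_trans simp: ennreal_less_iff)
      then obtain c where c: "0 \<le> c" "?P c" "c < C + d"
        unfolding pnorm_def Inf_less_iff by (auto simp: ennreal_less_iff)
      have "?s \<le> c * ?W" using c by blast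
      also have "\<dots> \<le> (C + d) * ?W" using c W by (intro mult_right_mono) auto
      also have "\<dots> = C * ?W + e * (?W / (?W + 1))" by (simp add: d_def algebra_simps)
      also have "\<dots> \<le> C * ?W + e * 1" using e W by (intro add_left_mono mult_left_mono) auto
      finally show "?s \<le> C * ?W + e" by simp
    qed
  qed
  moreover have "pnorm p f \<le> ennreal C" if "?P C"
    unfolding pnorm_def using that C by (intro Inf_lower) auto
  ultimately show ?thesis using iff[OF C] by auto
qed

section \<open>Preduals\<close>

text \<open>If all values on the unit ball were at most \<open>norm \<psi> - \<eta>\<close>, testing
  a normalised vector and its negative would make this an operator norm bound.\<close>

lemma exists_almost_norming:
  fixes \<psi> :: "'a::real_normed_vector \<Rightarrow>\<^sub>L real"
  assumes "0 < \<eta>"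
  shows "\<exists>y. norm y \<le> 1 \<and> norm \<psi> - \<eta> < blinfun_apply \<psi> y"
proof (rule ccontr)
  assume "\<not> ?thesis"
  hence le: "blinfun_apply \<psi> y \<le> norm \<psi> - \<eta>" if "norm y \<le> 1" for y
    using that by force
  have nonneg: "0 \<le> norm \<psi> - \<eta>" using le[of 0] by simp
  have "norm \<psi> \<le> norm \<psi> - \<eta>"
  proof (rule norm_blinfun_bound[OF nonneg])
    fix y :: 'a
    show "norm (blinfun_apply \<psi> y) \<le> (norm \<psi> - \<eta>) * norm y"
    proof (cases "y = 0")
      case False
      have "blinfun_apply \<psi> (y /\<^sub>R norm y) \<le> norm \<psi> - \<eta>"
        "blinfun_apply \<psi> (- (y /\<^sub>R norm y)) \<le> norm \<psi> - \<eta>"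
        using False by (auto intro!: le)
      hence "\<bar>blinfun_apply \<psi> (y /\<^sub>R norm y)\<bar> \<le> norm \<psi> - \<eta>"
        by (simp add: blinfun.minus_right abs_le_iff)
      thus ?thesis using False by (simp add: blinfun.scaleR_right abs_mult field_simps)
    qed simp
  qed
  thus False using assms by simp
qed

locale predual =
  fixes T :: "'x::banach \<Rightarrow> ('y::banach \<Rightarrow>\<^sub>L real)"
  assumes linear_T: "linear T" and norm_T: "norm (T x) = norm x" and surj_T: "surj T"
begin

text \<open>The canonical embedding of the predual into its bidual, read through the isometry
  \<open>T\<close>.\<close>

definition J :: "'y \<Rightarrow> ('x \<Rightarrow>\<^sub>L real)" where
  "J y = Blinfun (\<lambda>x. blinfun_apply (T x) y)"

lemma J_apply: "blinfun_apply (J y) x = blinfun_apply (T x) y"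
proof -
  have "bounded_linear (\<lambda>x. blinfun_apply (T x) y)"
  proof (rule bounded_linear_intro[where K = "norm y"])
    fix x show "norm (blinfun_apply (T x) y) \<le> norm x * norm y"
      using norm_blinfun[of "T x" y] by (simp add: norm_T)
  qed (auto simp: linear_add[OF linear_T] linear_cmul[OF linear_T] blinfun.add_left blinfun.scaleR_left)
  thus ?thesis by (simp add: J_def bounded_linear_Blinfun_apply)
qed

lemma J_add: "J (y + y') = J y + J y'"
  by (rule blinfun_eqI) (simp add: J_apply blinfun.add_left blinfun.add_right)

lemma J_scaleR: "J (c *\<^sub>R y) = c *\<^sub>R J y"
  by (rule blinfun_eqI) (simp add: J_apply blinfun.scaleR_left blinfun.scaleR_right)

lemma norm_J_le: "norm (J y) \<le> norm y"
proof (rule norm_blinfun_bound)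
  fix x show "norm (blinfun_apply (J y) x) \<le> norm y * norm x"
    using norm_blinfun[of "T x" y] by (simp add: J_apply norm_T mult.commute)
qed simp

text \<open>The minimax principle replaces separation: nonnegative weights on finitely many vectors
  collapse to a single vector \<open>x0\<close>, and the required competitor comes from an almost
  norming vector for \<open>T x0\<close>. Including the negatives of \<open>F\<close> makes the
  one-sided conclusion two-sided.\<close>

lemma Goldstine:
  fixes \<phi> :: "'x \<Rightarrow>\<^sub>L real"
  assumes F: "finite F" and \<delta>: "0 < \<delta>"
  obtains y where "norm y \<le> norm \<phi>" "\<And>x. x \<in> F \<Longrightarrow> \<bar>blinfun_apply (J y) x - blinfun_apply \<phi> x\<bar> < \<delta>"
proof -
  define S where "S = (\<lambda>y x. blinfun_apply (T x) y) ` cball 0 (norm \<phi>)"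
  have "\<exists>k\<in>S. \<forall>x\<in>F \<union> uminus ` F. blinfun_apply \<phi> x \<le> k x + \<delta> / 2"
  proof (rule finite_minimax[where B = "\<lambda>x. norm x * norm \<phi>"])
    show "finite (F \<union> uminus ` F)" using F by simp
    show "S \<noteq> {}" by (auto simp: S_def)
    show "0 < \<delta> / 2" using \<delta> by simp
    fix k :: "'x \<Rightarrow> real" assume "k \<in> S"
    then obtain y where y: "norm y \<le> norm \<phi>" "k = (\<lambda>x. blinfun_apply (T x) y)" by (auto simp: S_def)
    show "\<bar>k x\<bar> \<le> norm x * norm \<phi>" for x
      using norm_blinfun[of "T x" y] mult_left_mono[OF y(1), of "norm x"] y by (simp add: norm_T)
    fix l and t :: real assume "l \<in> S" and t: "0 \<le> t" "t \<le> 1"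
    then obtain y' where y': "norm y' \<le> norm \<phi>" "l = (\<lambda>x. blinfun_apply (T x) y')" by (auto simp: S_def)
    have "(1 - t) *\<^sub>R y + t *\<^sub>R y' \<in> cball 0 (norm \<phi>)"
      using y y' t by (intro convexD[OF convex_cball]) auto
    thus "(\<lambda>x. (1 - t) * k x + t * l x) \<in> S"
      unfolding S_def y y'
      by (intro image_eqI[of _ _ "(1 - t) *\<^sub>R y + t *\<^sub>R y'"]) (auto simp: blinfun.add_right blinfun.scaleR_right)
  next
    fix c :: "'x \<Rightarrow> real" and \<eta> :: real assume c: "\<And>x. x \<in> F \<union> uminus ` F \<Longrightarrow> 0 \<le> c x" and \<eta>: "0 < \<eta>"
    define x0 where "x0 = (\<Sum>x\<in>F \<union> uminus ` F. c x *\<^sub>R x)"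
    \<comment> \<open>The competitor is scaled by \<open>norm \<phi>\<close>, which also multiplies
      the defect; the added 1 covers \<phi> = 0.\<close>
    obtain y where y: "norm y \<le> 1" "norm (T x0) - \<eta> / (norm \<phi> + 1) < blinfun_apply (T x0) y"
      using exists_almost_norming[of "\<eta> / (norm \<phi> + 1)" "T x0"] \<eta> by (auto simp: add_nonneg_pos)
    let ?k = "\<lambda>x. blinfun_apply (T x) (norm \<phi> *\<^sub>R y)"
    have "?k \<in> S" using mult_left_mono[OF y(1), of "norm \<phi>"] by (auto simp: S_def)
    have "T x0 = (\<Sum>x\<in>F \<union> uminus ` F. c x *\<^sub>R T x)"
      unfolding x0_def by (simp add: linear_sum[OF linear_T] linear_cmul[OF linear_T])
    hence "(\<Sum>x\<in>F \<union> uminus ` F. c x * (blinfun_apply \<phi> x - ?k x)) = blinfun_apply \<phi> x0 - ?k x0"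
      unfolding x0_def by (simp add: blinfun.sum_right blinfun.sum_left blinfun.scaleR_left
          blinfun.scaleR_right right_diff_distrib sum_subtractf sum_distrib_left mult.left_commute)
    also have "\<dots> \<le> norm \<phi> * norm x0 - norm \<phi> * blinfun_apply (T x0) y"
      using norm_blinfun[of \<phi> x0] by (simp add: blinfun.scaleR_right)
    also have "\<dots> = norm \<phi> * (norm (T x0) - blinfun_apply (T x0) y)" by (simp add: norm_T algebra_simps)
    also have "\<dots> \<le> norm \<phi> * (\<eta> / (norm \<phi> + 1))" using y by (intro mult_left_mono) auto
    also have "\<dots> = \<eta> * (norm \<phi> / (norm \<phi> + 1))" by simp
    also have "\<dots> \<le> \<eta> * 1" using \<eta> by (intro mult_left_mono) (auto simp: divide_le_eq add_nonneg_pos)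
    finally show "\<exists>k\<in>S. (\<Sum>x\<in>F \<union> uminus ` F. c x * (blinfun_apply \<phi> x - k x)) \<le> \<eta>"
      using \<open>?k \<in> S\<close> by auto
  qed
  then obtain y where y: "norm y \<le> norm \<phi>"
    "\<And>x. x \<in> F \<union> uminus ` F \<Longrightarrow> blinfun_apply \<phi> x \<le> blinfun_apply (T x) y + \<delta> / 2"
    by (auto simp: S_def)
  show ?thesis
  proof (rule that[OF y(1)])
    fix x assume "x \<in> F"
    thus "\<bar>blinfun_apply (J y) x - blinfun_apply \<phi> x\<bar> < \<delta>"
      using y(2)[of x] y(2)[of "- x"] \<delta>
      by (simp add: J_apply linear_neg[OF linear_T] blinfun.minus_left blinfun.minus_right)
  qed
qed

text \<open>Weak* density of the image of \<open>J\<close> alone would not suffice, since f and g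
  are continuous only on bounded sets; Goldstine's approximants stay in the ball of radius
  \<open>norm \<phi>\<close>.\<close>

lemma Hw_le_if_le_on_predual:
  fixes f g :: "('x \<Rightarrow>\<^sub>L real) \<Rightarrow> real"
  assumes f: "f \<in> Hw" and g: "g \<in> Hw" and le: "\<And>y. f (J y) \<le> g (J y)"
  shows "f \<phi> \<le> g \<phi>"
proof (rule ccontr)
  assume "\<not> f \<phi> \<le> g \<phi>"
  hence e: "0 < (f \<phi> - g \<phi>) / 2" by simp
  have B: "bounded (cball 0 (norm \<phi>))" "\<phi> \<in> cball 0 (norm \<phi>)" by auto
  obtain F1 \<delta>1 where 1: "finite F1" "0 < \<delta>1"
    "\<And>\<psi>. \<psi> \<in> cball 0 (norm \<phi>) \<Longrightarrow> (\<And>x. x \<in> F1 \<Longrightarrow> \<bar>blinfun_apply \<psi> x - blinfun_apply \<phi> x\<bar> < \<delta>1)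
      \<Longrightarrow> \<bar>f \<psi> - f \<phi>\<bar> < (f \<phi> - g \<phi>) / 2"
    using Hw_nbhd[OF f B e] by metis
  obtain F2 \<delta>2 where 2: "finite F2" "0 < \<delta>2"
    "\<And>\<psi>. \<psi> \<in> cball 0 (norm \<phi>) \<Longrightarrow> (\<And>x. x \<in> F2 \<Longrightarrow> \<bar>blinfun_apply \<psi> x - blinfun_apply \<phi> x\<bar> < \<delta>2)
      \<Longrightarrow> \<bar>g \<psi> - g \<phi>\<bar> < (f \<phi> - g \<phi>) / 2"
    using Hw_nbhd[OF g B e] by metis
  obtain y where y: "norm y \<le> norm \<phi>"
    "\<And>x. x \<in> F1 \<union> F2 \<Longrightarrow> \<bar>blinfun_apply (J y) x - blinfun_apply \<phi> x\<bar> < min \<delta>1 \<delta>2"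
    using Goldstine[of "F1 \<union> F2" "min \<delta>1 \<delta>2" \<phi>] 1 2 by auto
  have "J y \<in> cball 0 (norm \<phi>)" using norm_J_le[of y] y(1) by simp
  hence "\<bar>f (J y) - f \<phi>\<bar> < (f \<phi> - g \<phi>) / 2" "\<bar>g (J y) - g \<phi>\<bar> < (f \<phi> - g \<phi>) / 2"
    using 1(3)[of "J y"] 2(3)[of "J y"] y(2) by (meson UnCI min_less_iff_conj)+
  thus False using le[of y] by (simp add: field_simps abs_if split: if_splits)
qed

end

section \<open>Means\<close>

text \<open>Finitely additive probabilities, as integrals. The value \<open>0\<close> on unbounded functions is a
  normalisation that confines \<open>means K\<close> to a compact product of intervals.\<close>

definition means :: "'k set \<Rightarrow> (('k \<Rightarrow> real) \<Rightarrow> real) set" where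
  "means K = {L. (\<forall>f. \<not> bounded (f ` K) \<longrightarrow> L f = 0) \<and>
     (\<forall>f g. bounded (f ` K) \<longrightarrow> bounded (g ` K) \<longrightarrow> L (\<lambda>x. f x + g x) = L f + L g) \<and>
     (\<forall>c f. bounded (f ` K) \<longrightarrow> L (\<lambda>x. c * f x) = c * L f) \<and>
     (\<forall>f. bounded (f ` K) \<longrightarrow> (\<forall>x\<in>K. 0 \<le> f x) \<longrightarrow> 0 \<le> L f) \<and>
     L (\<lambda>_. 1) = 1}"

lemma bounded_image_real_iff: "bounded (f ` K) \<longleftrightarrow> (\<exists>b. \<forall>x\<in>K. \<bar>f x\<bar> \<le> (b::real))"
  by (auto simp: bounded_iff)

lemma means_add: "L \<in> means K \<Longrightarrow> bounded (f ` K) \<Longrightarrow> bounded (g ` K) \<Longrightarrow> L (\<lambda>x. f x + g x) = L f + L g"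
  by (auto simp: means_def)

lemma means_cmult: "L \<in> means K \<Longrightarrow> bounded (f ` K) \<Longrightarrow> L (\<lambda>x. c * f x) = c * L f"
  by (auto simp: means_def)

lemma means_nonneg: "L \<in> means K \<Longrightarrow> bounded (f ` K) \<Longrightarrow> (\<And>x. x \<in> K \<Longrightarrow> 0 \<le> f x) \<Longrightarrow> 0 \<le> L f"
  by (auto simp: means_def)

lemma means_one: "L \<in> means K \<Longrightarrow> L (\<lambda>_. 1) = 1"
  by (auto simp: means_def)

lemma means_const: "L \<in> means K \<Longrightarrow> L (\<lambda>_. c) = c"
  using means_cmult[of L K "\<lambda>_. 1" c] means_one[of L K] by (auto simp: bounded_image_real_iff)

lemma means_mono:
  assumes L: "L \<in> means K" and b: "bounded (f ` K)" "bounded (g ` K)" and le: "\<And>x. x \<in> K \<Longrightarrow> f x \<le> g x"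
  shows "L f \<le> L g"
proof -
  obtain a c where ac: "\<And>x. x \<in> K \<Longrightarrow> \<bar>f x\<bar> \<le> a" "\<And>x. x \<in> K \<Longrightarrow> \<bar>g x\<bar> \<le> c"
    using b unfolding bounded_image_real_iff by blast
  have d: "bounded ((\<lambda>x. g x - f x) ` K)"
    unfolding bounded_image_real_iff
  proof (intro exI[of _ "a + c"] ballI)
    fix x assume "x \<in> K" thus "\<bar>g x - f x\<bar> \<le> a + c" using ac[of x] by linarith
  qed
  have "0 \<le> L (\<lambda>x. g x - f x)" using le by (intro means_nonneg[OF L d]) auto
  thus ?thesis using means_add[OF L b(1) d] by simp
qed

lemma means_cong:
  assumes L: "L \<in> means K" and b: "bounded (f ` K)" and eq: "\<And>x. x \<in> K \<Longrightarrow> f x = g x"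
  shows "L f = L g"
proof -
  have "bounded (g ` K)" using b eq by (metis image_cong)
  thus ?thesis using L b eq by (intro antisym means_mono[of L K]) auto
qed

lemma means_abs_le:
  assumes L: "L \<in> means K" and b: "\<And>x. x \<in> K \<Longrightarrow> \<bar>f x\<bar> \<le> b"
  shows "\<bar>L f\<bar> \<le> b"
proof -
  have f: "bounded (f ` K)" using b by (auto simp: bounded_image_real_iff)
  have c: "bounded ((\<lambda>_. c) ` K)" for c :: real by (auto simp: bounded_image_real_iff)
  have "L f \<le> L (\<lambda>_. b)" "L (\<lambda>_. - b) \<le> L f"
    using b by (auto intro!: means_mono[OF L f c] means_mono[OF L c f] simp: abs_le_iff) (smt (verit) b)+
  thus ?thesis by (simp add: means_const[OF L] abs_le_iff)
qed

lemma means_sum: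
  assumes L: "L \<in> means K" and A: "finite A" and b: "\<And>a. a \<in> A \<Longrightarrow> bounded (f a ` K)"
  shows "L (\<lambda>x. \<Sum>a\<in>A. f a x) = (\<Sum>a\<in>A. L (f a)) \<and> bounded ((\<lambda>x. \<Sum>a\<in>A. f a x) ` K)"
  using A b
proof (induction A rule: finite_induct)
  case empty
  show ?case using means_const[OF L, of 0] by (auto simp: bounded_image_real_iff)
next
  case (insert a A)
  have IH: "L (\<lambda>x. \<Sum>a\<in>A. f a x) = (\<Sum>a\<in>A. L (f a))" "bounded ((\<lambda>x. \<Sum>a\<in>A. f a x) ` K)"
    using insert by auto
  have "bounded ((\<lambda>x. f a x + (\<Sum>a\<in>A. f a x)) ` K)"
    by (rule bounded_plus_comp) (use insert IH in auto)
  thus ?case using insert means_add[OF L, of "f a" "\<lambda>x. \<Sum>a\<in>A. f a x"] IH by simp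
qed

text \<open>Point evaluations show that there are means at all, and they are the competitors in the
  minimax argument below.\<close>

lemma means_dirac:
  assumes "x0 \<in> K"
  shows "(\<lambda>f. if bounded (f ` K) then f x0 else 0) \<in> means K"
proof -
  have 1: "bounded ((\<lambda>x. f x + g x) ` K)" if "bounded (f ` K)" "bounded (g ` K)" for f g :: "'a \<Rightarrow> real"
    using that by (rule bounded_plus_comp)
  have 2: "bounded ((\<lambda>x. c * f x) ` K)" if "bounded (f ` K)" for c and f :: "'a \<Rightarrow> real"
    using bounded_scaleR_comp[OF that, of c] by simp
  have 3: "bounded ((\<lambda>_. c) ` K)" for c :: real by (auto simp: bounded_image_real_iff)
  show ?thesis unfolding means_def using assms by (auto simp: 1 2 3)
qed

lemma means_convex:
  assumes "L \<in> means K" "M \<in> means K" "0 \<le> t" "t \<le> 1"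
  shows "(\<lambda>f. (1 - t) * L f + t * M f) \<in> means K"
  using assms unfolding means_def mem_Collect_eq
  by (intro conjI allI impI) (auto simp: distrib_left mult.left_commute intro!: add_nonneg_nonneg mult_nonneg_nonneg)

text \<open>Tychonoff: the means form a closed subset of a product of compact intervals, one for
  each function.\<close>

lemma compact_means: "compact (means K)"
proof -
  \<comment> \<open>The default 0 for unbounded functions matches the normalisation in
    \<open>means\<close>, so their interval is a single point.\<close>
  define b where "b f = (SOME b. if bounded (f ` K) then \<forall>x\<in>K. \<bar>f x\<bar> \<le> b else b = 0)" for f :: "'a \<Rightarrow> real"
  have b: "if bounded (f ` K) then \<forall>x\<in>K. \<bar>f x\<bar> \<le> b f else b f = 0" for f
    unfolding b_def by (rule someI_ex) (cases "bounded (f ` K)", auto simp: bounded_image_real_iff)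
  have "compactin (product_topology (\<lambda>_. euclideanreal) UNIV) (Pi\<^sub>E UNIV (\<lambda>f::'a \<Rightarrow> real. cball 0 (b f)))"
    unfolding compactin_PiE by simp
  hence comp: "compact (Pi\<^sub>E UNIV (\<lambda>f. cball (0::real) (b f)))"
    by (simp add: euclidean_product_topology)
  \<comment> \<open>The premises in \<open>means\<close> speak of functions and not of
    \<open>L\<close>, so each is a fixed truth value guarding a closed condition.\<close>
  have imp: "closed {L. P \<longrightarrow> Q L}" if "closed {L. Q L}" for P and Q :: "(('a \<Rightarrow> real) \<Rightarrow> real) \<Rightarrow> bool"
    using that by (cases P) auto
  have "closed (means K)"
    unfolding means_def
    by (intro closed_Collect_conj closed_Collect_all imp closed_Collect_eq closed_Collect_le
        continuous_on_add continuous_on_mult_left continuous_on_const continuous_on_product_coordinates)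
  moreover have "means K \<subseteq> Pi\<^sub>E UNIV (\<lambda>f. cball 0 (b f))"
  proof
    fix L assume L: "L \<in> means K"
    have "\<bar>L f\<bar> \<le> b f" for f
    proof (cases "bounded (f ` K)")
      case True
      thus ?thesis using b[of f] by (intro means_abs_le[OF L]) auto
    qed (use L b[of f] in \<open>auto simp: means_def\<close>)
    thus "L \<in> Pi\<^sub>E UNIV (\<lambda>f. cball 0 (b f))" by auto
  qed
  ultimately show ?thesis using closed_Int_compact[OF _ comp] by (metis inf.absorb1)
qed

section \<open>Pietsch domination\<close>

lemma abs_powr_apply_le:
  fixes \<phi> :: "'x::real_normed_vector \<Rightarrow>\<^sub>L real" and p :: real
  assumes "1 \<le> p" "x \<in> cball 0 1"
  shows "\<bar>\<bar>blinfun_apply \<phi> x\<bar> powr p\<bar> \<le> norm \<phi> powr p"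
proof -
  have "\<bar>blinfun_apply \<phi> x\<bar> \<le> norm \<phi> * norm x"
    using norm_blinfun[of \<phi> x] by simp
  also have "\<dots> \<le> norm \<phi> * 1" using assms by (intro mult_left_mono) auto
  finally show ?thesis using assms by (simp add: powr_mono2)
qed

lemma bounded_powr_apply:
  fixes \<phi> :: "'x::real_normed_vector \<Rightarrow>\<^sub>L real" and p :: real
  assumes "1 \<le> p"
  shows "bounded ((\<lambda>x. \<bar>blinfun_apply \<phi> x\<bar> powr p) ` cball 0 1)"
  unfolding bounded_image_real_iff using abs_powr_apply_le[OF assms] by blast

text \<open>The competitor for given weights is the Dirac mean at a suitable point of the ball. If
  no point worked, scaling each \<phi> by \<open>c \<phi> powr (1 / p)\<close> would turn the
  weighted sums into unweighted ones, by homogeneity of f, and give a sequence violating the bound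
  on \<open>pnorm p f\<close>.\<close>

lemma mean_dominating_on_finite_set:
  fixes f :: "('x::banach \<Rightarrow>\<^sub>L real) \<Rightarrow> real"
  assumes p: "1 \<le> p" and C: "0 \<le> C" and f: "f \<in> Hw" "\<And>\<phi>. 0 \<le> f \<phi>" "pnorm p f \<le> ennreal C"
    and F: "finite F" and \<epsilon>: "0 < \<epsilon>"
  shows "\<exists>L\<in>means (cball 0 1). \<forall>\<phi>\<in>F. f \<phi> powr p \<le> C powr p * L (\<lambda>x. \<bar>blinfun_apply \<phi> x\<bar> powr p) + \<epsilon>"
proof -
  define S where "S = (\<lambda>L \<phi>. C powr p * L (\<lambda>x::'x. \<bar>blinfun_apply \<phi> x\<bar> powr p)) ` means (cball 0 1)"
  have "\<exists>k\<in>S. \<forall>\<phi>\<in>F. f \<phi> powr p \<le> k \<phi> + \<epsilon>"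
  proof (rule finite_minimax[OF F _ _ _ _ \<epsilon>, where B = "\<lambda>\<phi>. C powr p * norm \<phi> powr p"])
    show "S \<noteq> {}" using means_dirac[of 0 "cball (0::'x) 1"] by (auto simp: S_def)
    fix k assume "k \<in> S"
    then obtain L where L: "L \<in> means (cball 0 1)" "k = (\<lambda>\<phi>. C powr p * L (\<lambda>x. \<bar>blinfun_apply \<phi> x\<bar> powr p))"
      by (auto simp: S_def)
    show "\<bar>k \<phi>\<bar> \<le> C powr p * norm \<phi> powr p" for \<phi>
    proof -
      have "\<bar>L (\<lambda>x. \<bar>blinfun_apply \<phi> x\<bar> powr p)\<bar> \<le> norm \<phi> powr p"
        by (rule means_abs_le[OF L(1) abs_powr_apply_le[OF p]])
      thus ?thesis using L(2) by (simp add: abs_mult mult_left_mono)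
    qed
    fix l and t :: real assume "l \<in> S" and t: "0 \<le> t" "t \<le> 1"
    then obtain M where M: "M \<in> means (cball 0 1)" "l = (\<lambda>\<phi>. C powr p * M (\<lambda>x. \<bar>blinfun_apply \<phi> x\<bar> powr p))"
      by (auto simp: S_def)
    show "(\<lambda>\<phi>. (1 - t) * k \<phi> + t * l \<phi>) \<in> S"
      unfolding S_def L(2) M(2)
      by (rule image_eqI[OF _ means_convex[OF L(1) M(1) t]]) (auto simp: algebra_simps)
  next
    fix c :: "('x \<Rightarrow>\<^sub>L real) \<Rightarrow> real" and \<eta> :: real
    assume c: "\<And>\<phi>. \<phi> \<in> F \<Longrightarrow> 0 \<le> c \<phi>" and \<eta>: "0 < \<eta>"
    define s where "s = (\<Sum>\<phi>\<in>F. c \<phi> * f \<phi> powr p)"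
    have "\<exists>x. norm x \<le> 1 \<and> s - C powr p * (\<Sum>\<phi>\<in>F. c \<phi> * \<bar>blinfun_apply \<phi> x\<bar> powr p) \<le> \<eta>"
    proof (rule ccontr)
      assume "\<not> ?thesis"
      hence big: "C powr p * (\<Sum>\<phi>\<in>F. c \<phi> * \<bar>blinfun_apply \<phi> x\<bar> powr p) < s - \<eta>" if "norm x \<le> 1" for x
        using that by force
      \<comment> \<open>The point 0 of the ball gives the sign that \<open>weak_norm_powr_le\<close>
        needs and that settles the case of a vanishing constant.\<close>
      have s\<eta>: "0 < s - \<eta>" using big[of 0] p by (simp add: blinfun.zero_right)
      obtain e where e: "bij_betw e {..<card F} F"
        using ex_bij_betw_nat_finite[OF F] by (auto simp: atLeast0LessThan)
      define z where "z i = c (e i) powr (1 / p) *\<^sub>R e i" for i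
      have ce: "0 \<le> c (e i)" if "i < card F" for i
        using c e that by (auto dest: bij_betwE)
      have "(\<Sum>i<card F. \<bar>f (z i)\<bar> powr p) = (\<Sum>i<card F. c (e i) * f (e i) powr p)"
        using ce p f(2) by (intro sum.cong) (auto simp: z_def Hw_homogeneous[OF f(1)] abs_mult powr_mult powr_powr)
      also have "\<dots> = s"
        unfolding s_def by (rule sum.reindex_bij_betw[OF e])
      finally have s: "(\<Sum>i<card F. \<bar>f (z i)\<bar> powr p) = s" .
      have zx: "(\<Sum>i<card F. \<bar>blinfun_apply (z i) x\<bar> powr p) = (\<Sum>\<phi>\<in>F. c \<phi> * \<bar>blinfun_apply \<phi> x\<bar> powr p)" for x
      proof -
        have "(\<Sum>i<card F. \<bar>blinfun_apply (z i) x\<bar> powr p) = (\<Sum>i<card F. c (e i) * \<bar>blinfun_apply (e i) x\<bar> powr p)"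
          using ce p by (intro sum.cong) (auto simp: z_def blinfun.scaleR_left abs_mult powr_mult powr_powr)
        also have "\<dots> = (\<Sum>\<phi>\<in>F. c \<phi> * \<bar>blinfun_apply \<phi> x\<bar> powr p)"
          by (rule sum.reindex_bij_betw[OF e])
        finally show ?thesis .
      qed
      have le: "s \<le> C powr p * weak_norm p (card F) z powr p"
        using f(3) pnorm_le_iff[OF p C, of f] s by auto
      show False
      proof (cases "C powr p = 0")
        case True
        thus False using le s\<eta> \<eta> by simp
      next
        case False
        hence Cp: "0 < C powr p" by (simp add: less_le)
        have "weak_norm p (card F) z powr p \<le> (s - \<eta>) / C powr p"
        proof (rule weak_norm_powr_le[OF p])
          show "0 \<le> (s - \<eta>) / C powr p" using s\<eta> Cp by simp
          fix x :: 'x assume "norm x \<le> 1"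
          thus "(\<Sum>i<card F. \<bar>blinfun_apply (z i) x\<bar> powr p) \<le> (s - \<eta>) / C powr p"
            using big[of x] Cp unfolding zx by (simp add: pos_le_divide_eq mult.commute)
        qed
        hence "C powr p * weak_norm p (card F) z powr p \<le> s - \<eta>"
          using Cp by (simp add: pos_le_divide_eq mult.commute)
        thus False using le \<eta> by simp
      qed
    qed
    then obtain x where x: "norm x \<le> 1" "s - C powr p * (\<Sum>\<phi>\<in>F. c \<phi> * \<bar>blinfun_apply \<phi> x\<bar> powr p) \<le> \<eta>" by blast
    let ?L = "\<lambda>g. if bounded (g ` cball 0 1) then g x else 0 :: real"
    have L: "?L \<in> means (cball 0 1)" using means_dirac[of x "cball 0 1"] x by simp
    have "?L (\<lambda>x. \<bar>blinfun_apply \<phi> x\<bar> powr p) = \<bar>blinfun_apply \<phi> x\<bar> powr p" for \<phi>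
      using bounded_powr_apply[OF p, of \<phi>] by simp
    hence "(\<Sum>\<phi>\<in>F. c \<phi> * (f \<phi> powr p - C powr p * ?L (\<lambda>x. \<bar>blinfun_apply \<phi> x\<bar> powr p))) \<le> \<eta>"
      using x(2) by (simp add: s_def right_diff_distrib sum_subtractf sum_distrib_left mult.left_commute)
    thus "\<exists>k\<in>S. (\<Sum>\<phi>\<in>F. c \<phi> * (f \<phi> powr p - k \<phi>)) \<le> \<eta>"
      unfolding S_def using L by (intro bexI[OF _ imageI[OF L]])
  qed
  thus ?thesis by (auto simp: S_def)
qed

text \<open>Finitely many members of \<open>Z\<close> have a common upper bound in \<open>Z\<close>,
  so the statement for a single function gives the finite intersection property. The slack is part
  of the index and disappears in the intersection.\<close>

lemma mean_dominating_directed_set: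
  fixes Z :: "(('x::banach \<Rightarrow>\<^sub>L real) \<Rightarrow> real) set"
  assumes p: "1 \<le> p" and C: "0 \<le> C" and Z: "Z \<noteq> {}" "Z \<subseteq> Hw" "\<And>f \<phi>. f \<in> Z \<Longrightarrow> 0 \<le> f \<phi>"
      "\<And>f. f \<in> Z \<Longrightarrow> pnorm p f \<le> ennreal C"
    and dir: "\<And>f g. f \<in> Z \<Longrightarrow> g \<in> Z \<Longrightarrow> \<exists>h\<in>Z. f \<le> h \<and> g \<le> h"
  obtains L where "L \<in> means (cball 0 1)"
    "\<And>f \<phi>. f \<in> Z \<Longrightarrow> f \<phi> powr p \<le> C powr p * L (\<lambda>x. \<bar>blinfun_apply \<phi> x\<bar> powr p)"
proof -
  define D where "D = (\<lambda>(f :: ('x \<Rightarrow>\<^sub>L real) \<Rightarrow> real, \<phi>, \<epsilon>).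
    {L. f \<phi> powr p \<le> C powr p * L (\<lambda>x. \<bar>blinfun_apply \<phi> x\<bar> powr p) + \<epsilon>})"
  have upper: "\<exists>h\<in>Z. \<forall>f\<in>A. f \<le> h" if "finite A" "A \<subseteq> Z" for A
    using that
  proof (induction A rule: finite_induct)
    case empty
    thus ?case using Z(1) by auto
  next
    case (insert f A)
    then obtain h where h: "h \<in> Z" "\<forall>f\<in>A. f \<le> h" by auto
    obtain h' where "h' \<in> Z" "f \<le> h'" "h \<le> h'" using dir[of f h] insert.prems h by auto
    thus ?case using h by (auto intro: order_trans)
  qed
  have "means (cball 0 1) \<inter> (\<Inter>i\<in>Z \<times> UNIV \<times> {0<..}. D i) \<noteq> {}"
  proof (rule compact_imp_fip_image[OF compact_means])
    fix i :: "(('x \<Rightarrow>\<^sub>L real) \<Rightarrow> real) \<times> ('x \<Rightarrow>\<^sub>L real) \<times> real"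
    show "closed (D i)"
      unfolding D_def by (auto intro!: closed_Collect_le continuous_on_add continuous_on_mult_left
          continuous_on_const continuous_on_product_coordinates split: prod.split)
  next
    fix I' :: "((('x \<Rightarrow>\<^sub>L real) \<Rightarrow> real) \<times> ('x \<Rightarrow>\<^sub>L real) \<times> real) set"
    assume I': "finite I'" "I' \<subseteq> Z \<times> UNIV \<times> {0<..}"
    obtain h where h: "h \<in> Z" "\<And>f. f \<in> fst ` I' \<Longrightarrow> f \<le> h"
    proof -
      have "finite (fst ` I')" "fst ` I' \<subseteq> Z" using I' by auto
      from upper[OF this] show ?thesis using that by blast
    qed
    define \<epsilon> where "\<epsilon> = Min (insert 1 ((\<lambda>i. snd (snd i)) ` I'))"
    have \<epsilon>: "0 < \<epsilon>" "\<And>i. i \<in> I' \<Longrightarrow> \<epsilon> \<le> snd (snd i)" using I' by (auto simp: \<epsilon>_def)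
    obtain L where L: "L \<in> means (cball 0 1)"
      "\<And>\<phi>. \<phi> \<in> (\<lambda>i. fst (snd i)) ` I' \<Longrightarrow> h \<phi> powr p \<le> C powr p * L (\<lambda>x. \<bar>blinfun_apply \<phi> x\<bar> powr p) + \<epsilon>"
      using mean_dominating_on_finite_set[OF p C, of h "(\<lambda>i. fst (snd i)) ` I'" \<epsilon>] h(1) Z I'(1) \<epsilon>(1) by blast
    have "L \<in> D i" if i: "i \<in> I'" for i
    proof -
      obtain f \<phi> e where ie: "i = (f, \<phi>, e)" by (cases i)
      have f: "f \<in> Z" "f \<le> h" using i I' h(2)[of f] ie by force+
      have "f \<phi> powr p \<le> h \<phi> powr p"
        using Z(3)[OF f(1), of \<phi>] le_funD[OF f(2)] p by (intro powr_mono2) auto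
      also have "\<dots> \<le> C powr p * L (\<lambda>x. \<bar>blinfun_apply \<phi> x\<bar> powr p) + \<epsilon>"
        using i ie by (intro L(2)) force
      also have "\<dots> \<le> C powr p * L (\<lambda>x. \<bar>blinfun_apply \<phi> x\<bar> powr p) + e" using \<epsilon>(2)[OF i] ie by simp
      finally show ?thesis by (simp add: D_def ie)
    qed
    thus "means (cball 0 1) \<inter> (\<Inter>i\<in>I'. D i) \<noteq> {}" using L(1) by blast
  qed
  then obtain L where L: "L \<in> means (cball 0 1)" "\<And>i. i \<in> Z \<times> UNIV \<times> {0<..} \<Longrightarrow> L \<in> D i" by blast
  show ?thesis
  proof (rule that[OF L(1)])
    fix f \<phi> assume f: "f \<in> Z"
    show "f \<phi> powr p \<le> C powr p * L (\<lambda>x. \<bar>blinfun_apply \<phi> x\<bar> powr p)"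
    proof (rule field_le_epsilon)
      fix e :: real assume "0 < e"
      thus "f \<phi> powr p \<le> C powr p * L (\<lambda>x. \<bar>blinfun_apply \<phi> x\<bar> powr p) + e"
        using L(2)[of "(f, \<phi>, e)"] f by (simp add: D_def)
    qed
  qed
qed

section \<open>From a mean to a random functional\<close>

text \<open>A mean is only finitely additive, but the joint law of finitely many functions with
  finite ranges is a finite sum of point masses, hence a measure. Kolmogorov's theorem then restores
  countable additivity on the space of all functions on the index type.\<close>

locale finitely_valued_process =
  fixes K :: "'k set" and L :: "('k \<Rightarrow> real) \<Rightarrow> real" and Q :: "'i \<Rightarrow> 'k \<Rightarrow> real"
  assumes L: "L \<in> means K" and finite_range: "finite (Q i ` K)"
begin

definition q :: "'i set \<Rightarrow> 'k \<Rightarrow> 'i \<Rightarrow> real" where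
  "q J x = restrict (\<lambda>i. Q i x) J"

text \<open>\<open>point_measure\<close> carries all subsets of the range of \<open>q J\<close>;
  \<open>distr\<close> along the identity moves it to the product sigma-algebra.\<close>

definition marginal :: "'i set \<Rightarrow> ('i \<Rightarrow> real) measure" where
  "marginal J = distr (point_measure (q J ` K) (\<lambda>v. ennreal (L (\<lambda>x. indicator {v} (q J x)))))
     (PiM J (\<lambda>_. borel)) (\<lambda>v. v)"

lemma finite_q: assumes "finite J" shows "finite (q J ` K)"
proof (rule finite_subset)
  show "q J ` K \<subseteq> PiE J (\<lambda>i. Q i ` K)" by (auto simp: q_def)
  show "finite (PiE J (\<lambda>i. Q i ` K))" using assms finite_range by (rule finite_PiE)
qed

lemma bounded_indicator: "bounded ((\<lambda>x. indicator (A x) (f x) :: real) ` K)"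
  by (auto simp: bounded_image_real_iff indicator_def intro!: exI[of _ 1])

lemma emeasure_marginal:
  assumes J: "finite J" and A: "A \<in> sets (PiM J (\<lambda>_. borel))"
  shows "emeasure (marginal J) A = ennreal (L (\<lambda>x. indicator A (q J x)))"
proof -
  let ?V = "q J ` K" let ?l = "\<lambda>v. L (\<lambda>x. indicator {v} (q J x))"
  have V: "finite ?V" using finite_q[OF J] .
  have "emeasure (marginal J) A = emeasure (point_measure ?V (\<lambda>v. ennreal (?l v))) (A \<inter> ?V)"
    unfolding marginal_def
    by (subst emeasure_distr[OF _ A])
      (auto simp: measurable_point_measure_eq1 space_point_measure space_PiM q_def)
  also have "\<dots> = (\<Sum>v\<in>A \<inter> ?V. ennreal (?l v))"
    using V by (subst emeasure_point_measure_finite) auto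
  also have "\<dots> = ennreal (\<Sum>v\<in>A \<inter> ?V. ?l v)"
    by (intro sum_ennreal means_nonneg[OF L] bounded_indicator) auto
  also have "(\<Sum>v\<in>A \<inter> ?V. ?l v) = L (\<lambda>x. \<Sum>v\<in>A \<inter> ?V. indicator {v} (q J x))"
    using V by (intro means_sum[OF L, THEN conjunct1, symmetric] bounded_indicator) auto
  also have "\<dots> = L (\<lambda>x. indicator A (q J x))"
    using V by (intro means_cong[OF L, symmetric] bounded_indicator)
      (auto simp: indicator_def if_distrib cong: if_cong)
  finally show ?thesis .
qed

text \<open>Consistency holds because restricting \<open>q H x\<close> to \<open>J\<close> gives
  \<open>q J x\<close>. The projective limit is called \<open>lim\<close>; limits of sequences are
  therefore written \<open>Topological_Spaces.lim\<close> below.\<close>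

sublocale polish_projective UNIV marginal
proof (intro polish_projective.intro projective_family.intro)
  fix J H :: "'i set" assume JH: "J \<subseteq> H" "finite H"
  hence J: "finite J" by (rule finite_subset)
  show "marginal J = distr (marginal H) (PiM J (\<lambda>_. borel)) (\<lambda>f. restrict f J)"
  proof (rule measure_eqI)
    show "sets (marginal J) = sets (distr (marginal H) (PiM J (\<lambda>_. borel)) (\<lambda>f. restrict f J))"
      by (simp add: marginal_def)
    fix A assume "A \<in> sets (marginal J)"
    hence A: "A \<in> sets (PiM J (\<lambda>_. borel))" by (simp add: marginal_def)
    have sH: "sets (marginal H) = sets (PiM H (\<lambda>_. borel))" by (simp add: marginal_def)
    have m: "(\<lambda>f. restrict f J) \<in> measurable (marginal H) (PiM J (\<lambda>_. borel))"
      unfolding measurable_cong_sets[OF sH refl] using JH(1) by (rule measurable_restrict_subset)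
    have A': "(\<lambda>f. restrict f J) -` A \<inter> space (marginal H) \<in> sets (PiM H (\<lambda>_. borel))"
      using measurable_sets[OF m A] sH by simp
    have "emeasure (distr (marginal H) (PiM J (\<lambda>_. borel)) (\<lambda>f. restrict f J)) A
        = ennreal (L (\<lambda>x. indicator ((\<lambda>f. restrict f J) -` A \<inter> space (marginal H)) (q H x)))"
      by (simp only: emeasure_distr[OF m A] emeasure_marginal[OF JH(2) A'])
    also have "(\<lambda>x. indicator ((\<lambda>f. restrict f J) -` A \<inter> space (marginal H)) (q H x) :: real)
        = (\<lambda>x. indicator A (q J x))"
      using JH(1) by (auto simp: indicator_def q_def restrict_restrict Int_absorb1 marginal_def space_PiM)
    finally show "emeasure (marginal J) A = emeasure (distr (marginal H) (PiM J (\<lambda>_. borel)) (\<lambda>f. restrict f J)) A"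
      by (simp only: emeasure_marginal[OF J A])
  qed
next
  fix J :: "'i set" assume J: "finite J"
  show "prob_space (marginal J)"
  proof
    have sp: "space (marginal J) = space (PiM J (\<lambda>_. borel))" by (simp add: marginal_def)
    have "(\<lambda>x. indicator (space (PiM J (\<lambda>_. borel :: real measure))) (q J x) :: real) = (\<lambda>_. 1)"
      by (auto simp: q_def space_PiM)
    thus "emeasure (marginal J) (space (marginal J)) = 1"
      unfolding sp by (subst emeasure_marginal[OF J]) (simp_all add: means_one[OF L])
  qed
qed

text \<open>A relation among finitely many coordinates that holds throughout \<open>K\<close> has
  mean one, hence probability one; the last hypothesis says that \<open>R\<close> reads only the
  coordinates in \<open>J\<close>.\<close>

lemma AE_lim:
  assumes J: "finite J" and m: "{\<omega> \<in> space (PiM J (\<lambda>_. borel)). R \<omega>} \<in> sets (PiM J (\<lambda>_. borel))"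
    and K: "\<And>x. x \<in> K \<Longrightarrow> R (q J x)" and R: "\<And>\<omega>. R (restrict \<omega> J) \<longleftrightarrow> R \<omega>"
  shows "AE \<omega> in lim. R \<omega>"
proof -
  let ?A = "{\<omega> \<in> space (PiM J (\<lambda>_. borel :: real measure)). R \<omega>}"
  have "L (\<lambda>x. indicator ?A (q J x)) = L (\<lambda>_. 1)"
    using K by (intro means_cong[OF L bounded_indicator]) (auto simp: q_def space_PiM)
  hence "measure lim (emb UNIV J ?A) = 1"
    using emeasure_lim_emb[OF _ J m] emeasure_marginal[OF J m] means_one[OF L]
    by (simp add: measure_def)
  moreover have "emb UNIV J ?A \<in> sets lim" using J m by simp
  ultimately have "AE \<omega> in lim. \<omega> \<in> emb UNIV J ?A" by (simp add: P.prob_eq_1)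
  thus ?thesis by eventually_elim (simp add: prod_emb_def R)
qed

text \<open>Three coordinates cover additivity; shorter relations are obtained with zero
  coefficients.\<close>

lemma AE_lim_linear:
  assumes "\<And>x. x \<in> K \<Longrightarrow> \<bar>a * Q i x + b * Q j x + c * Q k x\<bar> \<le> d"
  shows "AE \<omega> in lim. \<bar>a * \<omega> i + b * \<omega> j + c * \<omega> k\<bar> \<le> d"
proof (rule AE_lim[of "{i, j, k}"])
  have [measurable]: "(\<lambda>\<omega>. \<omega> l) \<in> borel_measurable (PiM {i, j, k} (\<lambda>_. borel :: real measure))"
    if "l \<in> {i, j, k}" for l
    using that by (rule measurable_component_singleton)
  show "{\<omega> \<in> space (PiM {i, j, k} (\<lambda>_. borel)). \<bar>a * \<omega> i + b * \<omega> j + c * \<omega> k\<bar> \<le> d} \<in> sets (PiM {i, j, k} (\<lambda>_. borel))"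
    by measurable
qed (use assms in \<open>auto simp: q_def\<close>)

text \<open>The i-th coordinate almost surely takes one of finitely many values, so both sides
  reduce to the same finite sum.\<close>

lemma integral_lim:
  assumes g[measurable]: "g \<in> borel_measurable borel"
  shows "(\<integral>\<omega>. g (\<omega> i) \<partial>lim) = L (\<lambda>x. g (Q i x))"
proof -
  have sets: "sets lim = sets (PiM UNIV (\<lambda>_. borel))" by simp
  have comp[measurable]: "(\<lambda>\<omega>. \<omega> i) \<in> borel_measurable lim"
    unfolding measurable_cong_sets[OF sets refl] by measurable
  let ?V = "Q i ` K"
  have V: "finite ?V" by (rule finite_range)
  have "AE \<omega> in lim. \<omega> i \<in> ?V"
  proof (rule AE_lim[of "{i}"])
    have "?V \<in> sets borel" using V by (intro borel_closed finite_imp_closed)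
    thus "{\<omega> \<in> space (PiM {i} (\<lambda>_. borel)). \<omega> i \<in> ?V} \<in> sets (PiM {i} (\<lambda>_. borel))"
      by measurable
  qed (auto simp: q_def)
  hence ae: "AE \<omega> in lim. g (\<omega> i) = (\<Sum>v\<in>?V. g v * indicator {v} (\<omega> i))"
  proof eventually_elim
    case (elim \<omega>)
    have "(\<Sum>v\<in>?V. g v * indicator {v} (\<omega> i)) = (\<Sum>v\<in>?V. if v = \<omega> i then g v else 0)"
      by (intro sum.cong) (auto simp: indicator_def)
    thus ?case using V elim by simp
  qed
  have prob: "(\<integral>\<omega>. indicator {v} (\<omega> i) \<partial>lim) = L (\<lambda>x. indicator {v} (Q i x))"
    "integrable lim (\<lambda>\<omega>. indicator {v} (\<omega> i) :: real)" for v
  proof -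
    let ?A = "{\<omega> \<in> space (PiM {i} (\<lambda>_. borel :: real measure)). \<omega> i = v}"
    have A: "?A \<in> sets (PiM {i} (\<lambda>_. borel))" by measurable
    have e: "emb UNIV {i} ?A = {\<omega> \<in> space lim. \<omega> i = v}"
      by (auto simp: prod_emb_def space_PiM)
    have "measure lim (emb UNIV {i} ?A) = L (\<lambda>x. indicator ?A (q {i} x))"
      using emeasure_lim_emb[OF _ _ A] emeasure_marginal[OF _ A]
      by (simp add: measure_def means_nonneg[OF L bounded_indicator])
    also have "(\<lambda>x. indicator ?A (q {i} x)) = (\<lambda>x. indicator {v} (Q i x) :: real)"
      by (auto simp: indicator_def q_def space_PiM)
    finally have 1: "measure lim {\<omega> \<in> space lim. \<omega> i = v} = L (\<lambda>x. indicator {v} (Q i x))" by (simp only: e)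
    have 2: "(\<lambda>\<omega>. indicator {v} (\<omega> i) :: real) = indicator {\<omega> \<in> space lim. \<omega> i = v}"
      by (auto simp: indicator_def space_PiM)
    have 3: "{\<omega> \<in> space lim. \<omega> i = v} \<in> sets lim" by measurable
    show "(\<integral>\<omega>. indicator {v} (\<omega> i) \<partial>lim) = L (\<lambda>x. indicator {v} (Q i x))"
      unfolding 2 using 1 3 by simp
    show "integrable lim (\<lambda>\<omega>. indicator {v} (\<omega> i) :: real)"
      unfolding 2 using 3 by (simp add: P.emeasure_eq_measure)
  qed
  have "(\<integral>\<omega>. g (\<omega> i) \<partial>lim) = (\<integral>\<omega>. (\<Sum>v\<in>?V. g v * indicator {v} (\<omega> i)) \<partial>lim)"
    by (rule integral_cong_AE[OF _ _ ae]) measurable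
  also have "\<dots> = (\<Sum>v\<in>?V. g v * L (\<lambda>x. indicator {v} (Q i x)))"
    by (subst Bochner_Integration.integral_sum) (auto simp: prob)
  also have "\<dots> = (\<Sum>v\<in>?V. L (\<lambda>x. g v * indicator {v} (Q i x)))"
    by (simp add: means_cmult[OF L bounded_indicator])
  also have "\<dots> = L (\<lambda>x. \<Sum>v\<in>?V. g v * indicator {v} (Q i x))"
    using V bounded_scaleR_comp[OF bounded_indicator]
    by (intro means_sum[OF L, THEN conjunct1, symmetric]) auto
  also have "\<dots> = L (\<lambda>x. g (Q i x))"
  proof (rule means_cong[OF L, symmetric])
    have "finite ((\<lambda>x. g (Q i x)) ` K)" using finite_imageI[OF V, of g] by (simp add: image_image)
    thus "bounded ((\<lambda>x. g (Q i x)) ` K)" by (rule finite_imp_bounded)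
    fix x assume "x \<in> K"
    hence "(\<Sum>v\<in>?V. if v = Q i x then g v else 0) = g (Q i x)" using V by simp
    moreover have "(\<Sum>v\<in>?V. g v * indicator {v} (Q i x)) = (\<Sum>v\<in>?V. if v = Q i x then g v else 0)"
      by (intro sum.cong) (auto simp: indicator_def)
    ultimately show "g (Q i x) = (\<Sum>v\<in>?V. g v * indicator {v} (Q i x))" by simp
  qed
  finally show ?thesis .
qed

end

text \<open>The integer parts \<open>\<lfloor>\<phi>(x)\<rfloor>\<close> take finitely many values on the ball, so their joint laws under a
  mean are countably additive; the functional itself is recovered as the limit of \<open>\<lfloor>k \<phi>\<rfloor> / k\<close>.\<close>

lemma random_functional_of_mean:
  fixes L :: "('x::real_normed_vector \<Rightarrow> real) \<Rightarrow> real"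
  assumes L: "L \<in> means (cball 0 1)"
  obtains \<nu> :: "(('x \<Rightarrow>\<^sub>L real) \<Rightarrow> real) measure" and U
  where "prob_space \<nu>" "\<And>\<phi>. U \<phi> \<in> borel_measurable \<nu>"
    "\<And>\<phi>. AE \<omega> in \<nu>. \<bar>U \<phi> \<omega>\<bar> \<le> norm \<phi>"
    "\<And>\<phi> \<psi>. AE \<omega> in \<nu>. U (\<phi> + \<psi>) \<omega> = U \<phi> \<omega> + U \<psi> \<omega>"
    "\<And>c \<phi>. AE \<omega> in \<nu>. U (c *\<^sub>R \<phi>) \<omega> = c * U \<phi> \<omega>"
    "\<And>\<phi> p. 1 \<le> p \<Longrightarrow> L (\<lambda>x. \<bar>blinfun_apply \<phi> x\<bar> powr p) \<le> (\<integral>\<omega>. \<bar>U \<phi> \<omega>\<bar> powr p \<partial>\<nu>)"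
proof -
  define Q :: "('x \<Rightarrow>\<^sub>L real) \<Rightarrow> 'x \<Rightarrow> real" where "Q \<phi> x = of_int \<lfloor>blinfun_apply \<phi> x\<rfloor>" for \<phi> x
  have abs_le: "\<bar>blinfun_apply \<phi> x\<bar> \<le> norm \<phi>" if "x \<in> cball 0 1" for \<phi> :: "'x \<Rightarrow>\<^sub>L real" and x
    using norm_blinfun[of \<phi> x] mult_left_mono[of "norm x" 1 "norm \<phi>"] that by simp
  have fin: "finite (Q \<phi> ` cball 0 1)" for \<phi>
  proof (rule finite_subset)
    show "Q \<phi> ` cball 0 1 \<subseteq> of_int ` {\<lfloor>- norm \<phi>\<rfloor>..\<lfloor>norm \<phi>\<rfloor>}"
    proof
      fix v assume "v \<in> Q \<phi> ` cball 0 1"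
      then obtain x where x: "x \<in> cball 0 1" "v = of_int \<lfloor>blinfun_apply \<phi> x\<rfloor>" by (auto simp: Q_def)
      have "- norm \<phi> \<le> blinfun_apply \<phi> x" "blinfun_apply \<phi> x \<le> norm \<phi>"
        using abs_le[OF x(1), of \<phi>] by linarith+
      thus "v \<in> of_int ` {\<lfloor>- norm \<phi>\<rfloor>..\<lfloor>norm \<phi>\<rfloor>}"
        unfolding x(2) by (intro imageI) (auto intro: floor_mono)
    qed
  qed simp
  \<comment> \<open>The coordinates are indexed by the dual space, so \<open>lim\<close> is a
    measure on the type over which \<open>radon_nikodym_property\<close> quantifies.\<close>
  interpret finitely_valued_process "cball 0 1" L Q
    using L fin by unfold_locales auto
  have sets: "sets lim = sets (PiM UNIV (\<lambda>_. borel))" by simp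
  have coord[measurable]: "(\<lambda>\<omega>. \<omega> \<phi>) \<in> borel_measurable lim" for \<phi>
    unfolding measurable_cong_sets[OF sets refl] by measurable
  define W where "W \<phi> k \<omega> = \<omega> (real (Suc k) *\<^sub>R \<phi>) / real (Suc k)" for \<phi> k and \<omega> :: "('x \<Rightarrow>\<^sub>L real) \<Rightarrow> real"
  define U where "U \<phi> \<omega> = Topological_Spaces.lim (\<lambda>k. W \<phi> k \<omega>)" for \<phi> \<omega>
  have W_meas[measurable]: "W \<phi> k \<in> borel_measurable lim" for \<phi> k unfolding W_def by measurable
  have U_meas[measurable]: "U \<phi> \<in> borel_measurable lim" for \<phi>
    unfolding U_def by (rule borel_measurable_lim_metric) measurable
  have Q_bounds: "blinfun_apply \<phi> x - 1 \<le> Q \<phi> x" "Q \<phi> x \<le> blinfun_apply \<phi> x" for \<phi> x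
    unfolding Q_def by linarith+
  \<comment> \<open>Rounding costs at most one unit before the division, uniformly in x; all almost
    sure relations below come from this estimate through \<open>lin\<close>.\<close>
  have Q_scale: "\<bar>Q (real (Suc k) *\<^sub>R \<phi>) x / real (Suc k) - blinfun_apply \<phi> x\<bar> \<le> 1 / real (Suc k)" for k \<phi> x
  proof -
    let ?s = "real (Suc k)"
    have "Q (?s *\<^sub>R \<phi>) x / ?s - blinfun_apply \<phi> x = (Q (?s *\<^sub>R \<phi>) x - ?s * blinfun_apply \<phi> x) / ?s"
      by (simp add: diff_divide_distrib)
    moreover have "\<bar>Q (?s *\<^sub>R \<phi>) x - ?s * blinfun_apply \<phi> x\<bar> \<le> 1"
      using Q_bounds[of "?s *\<^sub>R \<phi>" x] unfolding blinfun.scaleR_left real_scaleR_def by linarith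
    ultimately show ?thesis by (simp add: abs_divide divide_right_mono)
  qed
  have lin: "AE \<omega> in lim. \<bar>a * W \<phi> k \<omega> + b * W \<psi> l \<omega> + c * W \<theta> m \<omega>\<bar> \<le> d"
    if "\<And>x. x \<in> cball 0 1 \<Longrightarrow> \<bar>a * (Q (real (Suc k) *\<^sub>R \<phi>) x / real (Suc k))
      + b * (Q (real (Suc l) *\<^sub>R \<psi>) x / real (Suc l)) + c * (Q (real (Suc m) *\<^sub>R \<theta>) x / real (Suc m))\<bar> \<le> d"
    for a b c d k l m \<phi> \<psi> \<theta>
  proof -
    have "AE \<omega> in lim. \<bar>(a / real (Suc k)) * \<omega> (real (Suc k) *\<^sub>R \<phi>)
      + (b / real (Suc l)) * \<omega> (real (Suc l) *\<^sub>R \<psi>) + (c / real (Suc m)) * \<omega> (real (Suc m) *\<^sub>R \<theta>)\<bar> \<le> d"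
      using that by (intro AE_lim_linear) simp
    thus ?thesis unfolding W_def by simp
  qed
  have inv_lim: "(\<lambda>k. c * (1 / real (Suc k))) \<longlonglongrightarrow> 0" for c
    using tendsto_mult[OF tendsto_const LIMSEQ_inverse_real_of_nat, of c] by (simp add: inverse_eq_divide)
  have W_diff: "AE \<omega> in lim. \<forall>k l. \<bar>W \<phi> k \<omega> - W \<phi> l \<omega>\<bar> \<le> 1 / real (Suc k) + 1 / real (Suc l)" for \<phi>
  proof (simp only: AE_all_countable, intro allI)
    fix k l
    have "AE \<omega> in lim. \<bar>1 * W \<phi> k \<omega> + (-1) * W \<phi> l \<omega> + 0 * W \<phi> l \<omega>\<bar> \<le> 1 / real (Suc k) + 1 / real (Suc l)"
    proof (rule lin)
      fix x :: 'x
      show "\<bar>1 * (Q (real (Suc k) *\<^sub>R \<phi>) x / real (Suc k)) + (-1) * (Q (real (Suc l) *\<^sub>R \<phi>) x / real (Suc l))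
          + 0 * (Q (real (Suc l) *\<^sub>R \<phi>) x / real (Suc l))\<bar> \<le> 1 / real (Suc k) + 1 / real (Suc l)"
        using Q_scale[of k \<phi> x] Q_scale[of l \<phi> x] by linarith
    qed
    thus "AE \<omega> in lim. \<bar>W \<phi> k \<omega> - W \<phi> l \<omega>\<bar> \<le> 1 / real (Suc k) + 1 / real (Suc l)" by simp
  qed
  have W_lim: "AE \<omega> in lim. (\<lambda>k. W \<phi> k \<omega>) \<longlonglongrightarrow> U \<phi> \<omega>" for \<phi>
    using W_diff[of \<phi>]
  proof eventually_elim
    case (elim \<omega>)
    have "Cauchy (\<lambda>k. W \<phi> k \<omega>)"
    proof (rule metric_CauchyI)
      fix e :: real assume e: "0 < e"
      then obtain N where N: "1 / real (Suc N) < e / 2"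
        using reals_Archimedean[of "e / 2"] by (auto simp: inverse_eq_divide)
      have small: "1 / real (Suc k) < e / 2" if "N \<le> k" for k
        by (rule le_less_trans[OF _ N]) (use that in \<open>simp add: frac_le\<close>)
      show "\<exists>M. \<forall>m\<ge>M. \<forall>n\<ge>M. dist (W \<phi> m \<omega>) (W \<phi> n \<omega>) < e"
      proof (intro exI[of _ N] allI impI)
        fix m n assume mn: "N \<le> m" "N \<le> n"
        have "dist (W \<phi> m \<omega>) (W \<phi> n \<omega>) \<le> 1 / real (Suc m) + 1 / real (Suc n)"
          unfolding dist_real_def using elim by blast
        thus "dist (W \<phi> m \<omega>) (W \<phi> n \<omega>) < e" using small[OF mn(1)] small[OF mn(2)] by linarith
      qed
    qed
    thus ?case unfolding U_def by (simp add: Cauchy_convergent convergent_LIMSEQ_iff[symmetric])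
  qed
  have W_bound: "AE \<omega> in lim. \<forall>k. \<bar>W \<phi> k \<omega>\<bar> \<le> norm \<phi> + 1 / real (Suc k)" for \<phi>
  proof (simp only: AE_all_countable, intro allI)
    fix k
    have "AE \<omega> in lim. \<bar>1 * W \<phi> k \<omega> + 0 * W \<phi> k \<omega> + 0 * W \<phi> k \<omega>\<bar> \<le> norm \<phi> + 1 / real (Suc k)"
    proof (rule lin)
      fix x :: 'x assume x: "x \<in> cball 0 1"
      show "\<bar>1 * (Q (real (Suc k) *\<^sub>R \<phi>) x / real (Suc k)) + 0 * (Q (real (Suc k) *\<^sub>R \<phi>) x / real (Suc k))
          + 0 * (Q (real (Suc k) *\<^sub>R \<phi>) x / real (Suc k))\<bar> \<le> norm \<phi> + 1 / real (Suc k)"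
        using Q_scale[of k \<phi> x] abs_le[OF x, of \<phi>] by linarith
    qed
    thus "AE \<omega> in lim. \<bar>W \<phi> k \<omega>\<bar> \<le> norm \<phi> + 1 / real (Suc k)" by simp
  qed
  have zero_if_small: "v = 0" if "X \<longlonglongrightarrow> v" "\<And>k. \<bar>X k\<bar> \<le> c * (1 / real (Suc k))" for X and v c :: real
  proof -
    have "X \<longlonglongrightarrow> 0" by (rule Lim_null_comparison[OF _ inv_lim[of c]]) (use that(2) in auto)
    thus ?thesis using that(1) LIMSEQ_unique by blast
  qed
  show ?thesis
  proof (rule that[of lim U])
    show "prob_space lim" by (rule P.prob_space_axioms)
    show "U \<phi> \<in> borel_measurable lim" for \<phi> by measurable
    show "AE \<omega> in lim. \<bar>U \<phi> \<omega>\<bar> \<le> norm \<phi>" for \<phi>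
      using W_bound[of \<phi>] W_lim[of \<phi>]
    proof eventually_elim
      case (elim \<omega>)
      have "(\<lambda>k. norm \<phi> + 1 * (1 / real (Suc k))) \<longlonglongrightarrow> norm \<phi> + 0"
        by (intro tendsto_add tendsto_const inv_lim)
      moreover have "(\<lambda>k. \<bar>W \<phi> k \<omega>\<bar>) \<longlonglongrightarrow> \<bar>U \<phi> \<omega>\<bar>" using elim by (intro tendsto_rabs) auto
      ultimately show ?case using elim by (intro LIMSEQ_le[of _ "\<bar>U \<phi> \<omega>\<bar>" _ "norm \<phi>"]) auto
    qed
    show "AE \<omega> in lim. U (\<phi> + \<psi>) \<omega> = U \<phi> \<omega> + U \<psi> \<omega>" for \<phi> \<psi>
    proof -
      have "AE \<omega> in lim. \<forall>k. \<bar>W (\<phi> + \<psi>) k \<omega> - W \<phi> k \<omega> - W \<psi> k \<omega>\<bar> \<le> 3 * (1 / real (Suc k))"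
      proof (simp only: AE_all_countable, intro allI)
        fix k
        have "AE \<omega> in lim. \<bar>1 * W (\<phi> + \<psi>) k \<omega> + (-1) * W \<phi> k \<omega> + (-1) * W \<psi> k \<omega>\<bar> \<le> 3 * (1 / real (Suc k))"
        proof (rule lin)
          fix x :: 'x
          show "\<bar>1 * (Q (real (Suc k) *\<^sub>R (\<phi> + \<psi>)) x / real (Suc k)) + (-1) * (Q (real (Suc k) *\<^sub>R \<phi>) x / real (Suc k))
            + (-1) * (Q (real (Suc k) *\<^sub>R \<psi>) x / real (Suc k))\<bar> \<le> 3 * (1 / real (Suc k))"
            using Q_scale[of k "\<phi> + \<psi>" x] Q_scale[of k \<phi> x] Q_scale[of k \<psi> x]
            unfolding blinfun.add_left by linarith
        qed
        thus "AE \<omega> in lim. \<bar>W (\<phi> + \<psi>) k \<omega> - W \<phi> k \<omega> - W \<psi> k \<omega>\<bar> \<le> 3 * (1 / real (Suc k))" by simp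
      qed
      with W_lim[of "\<phi> + \<psi>"] W_lim[of \<phi>] W_lim[of \<psi>] show ?thesis
      proof eventually_elim
        case (elim \<omega>)
        have "U (\<phi> + \<psi>) \<omega> - U \<phi> \<omega> - U \<psi> \<omega> = 0"
        proof (rule zero_if_small)
          show "(\<lambda>k. W (\<phi> + \<psi>) k \<omega> - W \<phi> k \<omega> - W \<psi> k \<omega>) \<longlonglongrightarrow> U (\<phi> + \<psi>) \<omega> - U \<phi> \<omega> - U \<psi> \<omega>"
            by (intro tendsto_diff elim)
        qed (use elim in blast)
        thus ?case by simp
      qed
    qed
    show "AE \<omega> in lim. U (c *\<^sub>R \<phi>) \<omega> = c * U \<phi> \<omega>" for c \<phi>
    proof -
      \<comment> \<open>One rounding error for \<open>c *\<^sub>R \<phi>\<close>, and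
        \<open>\<bar>c\<bar>\<close> times one for \<phi>.\<close>
      have "AE \<omega> in lim. \<forall>k. \<bar>W (c *\<^sub>R \<phi>) k \<omega> - c * W \<phi> k \<omega>\<bar> \<le> (1 + \<bar>c\<bar>) * (1 / real (Suc k))"
      proof (simp only: AE_all_countable, intro allI)
        fix k
        have "AE \<omega> in lim. \<bar>1 * W (c *\<^sub>R \<phi>) k \<omega> + (- c) * W \<phi> k \<omega> + 0 * W \<phi> k \<omega>\<bar> \<le> (1 + \<bar>c\<bar>) * (1 / real (Suc k))"
        proof (rule lin)
          fix x :: 'x
          let ?q = "Q (real (Suc k) *\<^sub>R \<phi>) x / real (Suc k)" and ?r = "Q (real (Suc k) *\<^sub>R (c *\<^sub>R \<phi>)) x / real (Suc k)"
          have "\<bar>c * (?q - blinfun_apply \<phi> x)\<bar> \<le> \<bar>c\<bar> * (1 / real (Suc k))"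
            unfolding abs_mult by (intro mult_left_mono Q_scale) auto
          moreover have "\<bar>?r - c * blinfun_apply \<phi> x\<bar> \<le> 1 / real (Suc k)"
            using Q_scale[of k "c *\<^sub>R \<phi>" x] unfolding blinfun.scaleR_left real_scaleR_def .
          moreover have "1 * ?r + (- c) * ?q + 0 * ?q = (?r - c * blinfun_apply \<phi> x) - c * (?q - blinfun_apply \<phi> x)"
            by (simp add: algebra_simps)
          ultimately show "\<bar>1 * ?r + (- c) * ?q + 0 * ?q\<bar> \<le> (1 + \<bar>c\<bar>) * (1 / real (Suc k))"
            unfolding distrib_right by linarith
        qed
        thus "AE \<omega> in lim. \<bar>W (c *\<^sub>R \<phi>) k \<omega> - c * W \<phi> k \<omega>\<bar> \<le> (1 + \<bar>c\<bar>) * (1 / real (Suc k))" by simp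
      qed
      with W_lim[of "c *\<^sub>R \<phi>"] W_lim[of \<phi>] show ?thesis
      proof eventually_elim
        case (elim \<omega>)
        have "U (c *\<^sub>R \<phi>) \<omega> - c * U \<phi> \<omega> = 0"
        proof (rule zero_if_small)
          show "(\<lambda>k. W (c *\<^sub>R \<phi>) k \<omega> - c * W \<phi> k \<omega>) \<longlonglongrightarrow> U (c *\<^sub>R \<phi>) \<omega> - c * U \<phi> \<omega>"
            by (intro tendsto_diff tendsto_mult tendsto_const elim)
        qed (use elim in blast)
        thus ?case by simp
      qed
    qed
    show "L (\<lambda>x. \<bar>blinfun_apply \<phi> x\<bar> powr p) \<le> (\<integral>\<omega>. \<bar>U \<phi> \<omega>\<bar> powr p \<partial>lim)" if p: "1 \<le> p" for \<phi> p
    proof (rule LIMSEQ_le_const)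
      \<comment> \<open>Rounding may lower the absolute value; adding
        \<open>1 / real (Suc k)\<close> compensates, so the inequality with \<open>L\<close> holds
        for every k and passes to the limit. The error occurs twice in the dominating constant
        \<open>norm \<phi> + 2\<close>.\<close>
      show "(\<lambda>k. \<integral>\<omega>. (\<bar>W \<phi> k \<omega>\<bar> + 1 / real (Suc k)) powr p \<partial>lim) \<longlonglongrightarrow> (\<integral>\<omega>. \<bar>U \<phi> \<omega>\<bar> powr p \<partial>lim)"
      proof (rule integral_dominated_convergence[where w = "\<lambda>_. (norm \<phi> + 2) powr p"])
        show "AE \<omega> in lim. (\<lambda>k. (\<bar>W \<phi> k \<omega>\<bar> + 1 / real (Suc k)) powr p) \<longlonglongrightarrow> \<bar>U \<phi> \<omega>\<bar> powr p"
          using W_lim[of \<phi>]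
        proof eventually_elim
          case (elim \<omega>)
          have "(\<lambda>k. \<bar>W \<phi> k \<omega>\<bar> + 1 * (1 / real (Suc k))) \<longlonglongrightarrow> \<bar>U \<phi> \<omega>\<bar> + 0"
            by (intro tendsto_add tendsto_rabs elim inv_lim)
          thus ?case using p by (intro tendsto_powr') auto
        qed
        show "AE \<omega> in lim. norm ((\<bar>W \<phi> k \<omega>\<bar> + 1 / real (Suc k)) powr p) \<le> (norm \<phi> + 2) powr p" for k
          using W_bound[of \<phi>]
        proof eventually_elim
          case (elim \<omega>)
          have "\<bar>W \<phi> k \<omega>\<bar> \<le> norm \<phi> + 1 / real (Suc k)" using elim by blast
          moreover have "1 / real (Suc k) \<le> 1" by simp
          ultimately have "\<bar>W \<phi> k \<omega>\<bar> + 1 / real (Suc k) \<le> norm \<phi> + 2" by linarith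
          thus ?case using p by (simp add: powr_mono2)
        qed
      qed (use p in measurable)
      show "\<exists>N. \<forall>k\<ge>N. L (\<lambda>x. \<bar>blinfun_apply \<phi> x\<bar> powr p) \<le> (\<integral>\<omega>. (\<bar>W \<phi> k \<omega>\<bar> + 1 / real (Suc k)) powr p \<partial>lim)"
      proof (intro exI[of _ 0] allI impI)
        fix k :: nat
        let ?g = "\<lambda>v. (\<bar>v / real (Suc k)\<bar> + 1 / real (Suc k)) powr p"
        have "L (\<lambda>x. \<bar>blinfun_apply \<phi> x\<bar> powr p) \<le> L (\<lambda>x. ?g (Q (real (Suc k) *\<^sub>R \<phi>) x))"
        proof (rule means_mono[OF L])
          show "bounded ((\<lambda>x. \<bar>blinfun_apply \<phi> x\<bar> powr p) ` cball 0 1)"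
            unfolding bounded_image_real_iff
            using abs_le[of _ \<phi>] p by (intro exI[of _ "norm \<phi> powr p"]) (auto intro!: powr_mono2)
          have "finite ((\<lambda>x. ?g (Q (real (Suc k) *\<^sub>R \<phi>) x)) ` cball 0 1)"
            using finite_imageI[OF fin[of "real (Suc k) *\<^sub>R \<phi>"], of ?g] by (simp add: image_image)
          thus "bounded ((\<lambda>x. ?g (Q (real (Suc k) *\<^sub>R \<phi>) x)) ` cball 0 1)" by (rule finite_imp_bounded)
          fix x :: 'x
          have "\<bar>blinfun_apply \<phi> x\<bar> \<le> \<bar>Q (real (Suc k) *\<^sub>R \<phi>) x / real (Suc k)\<bar> + 1 / real (Suc k)"
            using Q_scale[of k \<phi> x] by linarith
          thus "\<bar>blinfun_apply \<phi> x\<bar> powr p \<le> ?g (Q (real (Suc k) *\<^sub>R \<phi>) x)"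
            using p by (intro powr_mono2) auto
        qed
        also have "\<dots> = (\<integral>\<omega>. ?g (\<omega> (real (Suc k) *\<^sub>R \<phi>)) \<partial>lim)"
          by (rule integral_lim[symmetric]) measurable
        finally show "L (\<lambda>x. \<bar>blinfun_apply \<phi> x\<bar> powr p) \<le> (\<integral>\<omega>. (\<bar>W \<phi> k \<omega>\<bar> + 1 / real (Suc k)) powr p \<partial>lim)"
          unfolding W_def .
      qed
    qed
  qed
qed

section \<open>The Radon--Nikodym density\<close>

text \<open>Differences of Borel functions need not be Borel when the codomain is not separable; subtracting
  a simple function is harmless.\<close>

lemma borel_measurable_norm_diff_simple_function:
  fixes f s :: "'w \<Rightarrow> 'x::real_normed_vector"
  assumes f: "f \<in> borel_measurable M" and s: "simple_function M s"
  shows "(\<lambda>w. norm (f w - s w)) \<in> borel_measurable M"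
proof (rule measurable_compose_countable'[where f = "\<lambda>v w. norm (f w - v)" and I = "s ` space M"])
  fix v
  show "(\<lambda>w. norm (f w - v)) \<in> borel_measurable M"
    using f by (rule measurable_compose)
      (intro borel_measurable_continuous_onI continuous_on_norm continuous_on_diff continuous_on_id continuous_on_const)
next
  show "countable (s ` space M)" using s by (simp add: simple_function_def countable_finite)
  show "s \<in> measurable M (count_space (s ` space M))"
    using s by (subst measurable_count_space_eq2) (auto simp: simple_function_def)
qed

lemma simple_bochner_integrable_imp_simple_function:
  "Bochner_Integration.simple_bochner_integrable M s \<Longrightarrow> simple_function M s"
  by (simp add: simple_bochner_integrable.simps)

text \<open>A functional carries approximating simple functions to approximating simple functions,
  with errors multiplied by at most \<open>norm \<phi>\<close>; this reduces the vector density to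
  scalar densities.\<close>

lemma has_bochner_integral_blinfun_apply:
  fixes f :: "'w \<Rightarrow> 'x::real_normed_vector" and \<phi> :: "'x \<Rightarrow>\<^sub>L real"
  assumes "has_strong_bochner_integral M f v"
  shows "has_bochner_integral M (\<lambda>w. blinfun_apply \<phi> (f w)) (blinfun_apply \<phi> v)"
proof -
  obtain s where f: "f \<in> borel_measurable M"
    and s: "\<And>k. Bochner_Integration.simple_bochner_integrable M (s k)"
    and lim0: "(\<lambda>k. \<integral>\<^sup>+w. ennreal (norm (f w - s k w)) \<partial>M) \<longlonglongrightarrow> 0"
    and limv: "(\<lambda>k. Bochner_Integration.simple_bochner_integral M (s k)) \<longlonglongrightarrow> v"
    using assms unfolding has_strong_bochner_integral_def by blast
  have cont: "blinfun_apply \<phi> \<in> borel_measurable borel"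
    by (rule borel_measurable_continuous_onI) (rule linear_continuous_on[OF blinfun.bounded_linear_right])
  show ?thesis
  proof (rule has_bochner_integral.intros)
    show "(\<lambda>w. blinfun_apply \<phi> (f w)) \<in> borel_measurable M"
      using f cont by (rule measurable_compose)
    show "Bochner_Integration.simple_bochner_integrable M (\<lambda>w. blinfun_apply \<phi> (s k w))" for k
      by (rule simple_bochner_integrable_compose2[where p = "\<lambda>x y. blinfun_apply \<phi> x", OF _ s s])
        (simp add: blinfun.zero_right)
    show "(\<lambda>k. \<integral>\<^sup>+w. ennreal (norm (blinfun_apply \<phi> (f w) - blinfun_apply \<phi> (s k w))) \<partial>M) \<longlonglongrightarrow> 0"
    proof (rule tendsto_sandwich[OF _ _ tendsto_const])
      have "(\<lambda>k. ennreal (norm \<phi>) * (\<integral>\<^sup>+w. ennreal (norm (f w - s k w)) \<partial>M)) \<longlonglongrightarrow> ennreal (norm \<phi>) * 0"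
        by (intro ennreal_tendsto_cmult lim0) simp
      thus "(\<lambda>k. ennreal (norm \<phi>) * (\<integral>\<^sup>+w. ennreal (norm (f w - s k w)) \<partial>M)) \<longlonglongrightarrow> 0" by simp
      show "\<forall>\<^sub>F k in sequentially. (\<integral>\<^sup>+w. ennreal (norm (blinfun_apply \<phi> (f w) - blinfun_apply \<phi> (s k w))) \<partial>M)
        \<le> ennreal (norm \<phi>) * (\<integral>\<^sup>+w. ennreal (norm (f w - s k w)) \<partial>M)"
      proof (intro always_eventually allI)
        fix k
        have meas: "(\<lambda>w. norm (f w - s k w)) \<in> borel_measurable M"
          using f s[THEN simple_bochner_integrable_imp_simple_function]
          by (rule borel_measurable_norm_diff_simple_function)
        have "(\<integral>\<^sup>+w. ennreal (norm (blinfun_apply \<phi> (f w) - blinfun_apply \<phi> (s k w))) \<partial>M)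
            \<le> (\<integral>\<^sup>+w. ennreal (norm \<phi>) * ennreal (norm (f w - s k w)) \<partial>M)"
        proof (rule nn_integral_mono)
          fix w
          have "norm (blinfun_apply \<phi> (f w) - blinfun_apply \<phi> (s k w)) \<le> norm \<phi> * norm (f w - s k w)"
            using norm_blinfun[of \<phi> "f w - s k w"] by (simp add: blinfun.diff_right)
          thus "ennreal (norm (blinfun_apply \<phi> (f w) - blinfun_apply \<phi> (s k w)))
              \<le> ennreal (norm \<phi>) * ennreal (norm (f w - s k w))"
            by (simp add: ennreal_mult[symmetric])
        qed
        also have "\<dots> = ennreal (norm \<phi>) * (\<integral>\<^sup>+w. ennreal (norm (f w - s k w)) \<partial>M)"
          by (rule nn_integral_cmult) (use meas in measurable)
        finally show "(\<integral>\<^sup>+w. ennreal (norm (blinfun_apply \<phi> (f w) - blinfun_apply \<phi> (s k w))) \<partial>M)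
          \<le> ennreal (norm \<phi>) * (\<integral>\<^sup>+w. ennreal (norm (f w - s k w)) \<partial>M)" .
      qed
    qed simp
    have "linear (blinfun_apply \<phi>)"
      by (rule bounded_linear.linear[OF blinfun.bounded_linear_right])
    hence "Bochner_Integration.simple_bochner_integral M (\<lambda>w. blinfun_apply \<phi> (s k w))
        = blinfun_apply \<phi> (Bochner_Integration.simple_bochner_integral M (s k))" for k
      using s by (rule simple_bochner_integral_linear)
    thus "(\<lambda>k. Bochner_Integration.simple_bochner_integral M (\<lambda>w. blinfun_apply \<phi> (s k w)))
        \<longlonglongrightarrow> blinfun_apply \<phi> v"
      by (simp add: tendsto_intros limv)
  qed
qed

text \<open>Essential separability: the distance of g to the set of all values has integral at most
  the k-th error, for every k. For simple functions \<open>s k\<close> this set is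
  countable.\<close>

lemma AE_in_closure_of_values:
  fixes g :: "'w \<Rightarrow> 'x::real_normed_vector"
  assumes g: "g \<in> borel_measurable M"
    and lim0: "(\<lambda>k. \<integral>\<^sup>+w. ennreal (norm (g w - s k w)) \<partial>M) \<longlonglongrightarrow> 0"
  shows "AE w in M. g w \<in> closure (\<Union>k. s k ` space M)"
proof (cases "space M = {}")
  case False
  let ?D = "\<Union>k. s k ` space M"
  \<comment> \<open>Nonemptiness matters because \<open>infdist\<close> to the empty set is
    0.\<close>
  have D: "?D \<noteq> {}" using False by auto
  have meas: "(\<lambda>w. ennreal (infdist (g w) ?D)) \<in> borel_measurable M"
  proof -
    have "(\<lambda>w. infdist (g w) ?D) \<in> borel_measurable M"
      using g by (rule measurable_compose)
        (intro borel_measurable_continuous_onI continuous_on_infdist continuous_on_id)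
    thus ?thesis by measurable
  qed
  have "(\<integral>\<^sup>+w. ennreal (infdist (g w) ?D) \<partial>M) \<le> (\<integral>\<^sup>+w. ennreal (norm (g w - s k w)) \<partial>M)" for k
  proof (rule nn_integral_mono)
    fix w assume "w \<in> space M"
    hence "infdist (g w) ?D \<le> dist (g w) (s k w)" by (intro infdist_le) auto
    thus "ennreal (infdist (g w) ?D) \<le> ennreal (norm (g w - s k w))"
      by (simp add: dist_norm ennreal_leI)
  qed
  hence "(\<integral>\<^sup>+w. ennreal (infdist (g w) ?D) \<partial>M) \<le> 0"
    by (intro LIMSEQ_le_const[OF lim0]) auto
  hence "(\<integral>\<^sup>+w. ennreal (infdist (g w) ?D) \<partial>M) = 0" by simp
  hence "AE w in M. ennreal (infdist (g w) ?D) = 0" by (simp only: nn_integral_0_iff_AE[OF meas])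
  thus ?thesis
  proof eventually_elim
    case (elim w)
    thus ?case using D infdist_nonneg[of "g w" ?D] by (simp add: in_closure_iff_infdist_zero ennreal_eq_0_iff)
  qed
qed (simp add: AE_iff_null null_sets_def)

context predual
begin

text \<open>The single estimate \<open>norm (G E) \<le> measure \<nu> E\<close> yields countable
  additivity, bounded variation and vanishing on null sets. The family u is linear only up to null
  sets that depend on its arguments; integration makes the linearity exact.\<close>

lemma radon_nikodym_density:
  fixes \<nu> :: "(('x \<Rightarrow>\<^sub>L real) \<Rightarrow> real) measure" and u :: "'y \<Rightarrow> (('x \<Rightarrow>\<^sub>L real) \<Rightarrow> real) \<Rightarrow> real"
  assumes prob: "prob_space \<nu>" and rnp: "radon_nikodym_property TYPE('x)"
    and meas[measurable]: "\<And>y. u y \<in> borel_measurable \<nu>"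
    and bd: "\<And>y. AE \<omega> in \<nu>. \<bar>u y \<omega>\<bar> \<le> norm y"
    and add: "\<And>y z. AE \<omega> in \<nu>. u (y + z) \<omega> = u y \<omega> + u z \<omega>"
    and scale: "\<And>c y. AE \<omega> in \<nu>. u (c *\<^sub>R y) \<omega> = c * u y \<omega>"
  obtains g s where "g \<in> borel_measurable \<nu>"
    "\<And>k. simple_function \<nu> (s k)"
    "(\<lambda>k. \<integral>\<^sup>+\<omega>. ennreal (norm (g \<omega> - s k \<omega>)) \<partial>\<nu>) \<longlonglongrightarrow> 0"
    "\<And>y. AE \<omega> in \<nu>. blinfun_apply (T (g \<omega>)) y = u y \<omega>"
    "AE \<omega> in \<nu>. norm (g \<omega>) \<le> 1"
proof -
  interpret prob_space \<nu> by (rule prob)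
  have int_u[simp]: "integrable \<nu> (u y)" for y
    using bd[of y] by (intro integrable_const_bound[of _ "norm y"]) auto
  define I where "I E y = (\<integral>\<omega>. indicator E \<omega> * u y \<omega> \<partial>\<nu>)" for E y
  have int_E[simp]: "integrable \<nu> (\<lambda>\<omega>. indicator E \<omega> * u y \<omega>)" if "E \<in> sets \<nu>" for E y
    using integrable_mult_indicator[OF that int_u[of y]] by simp
  have I_le: "\<bar>I E y\<bar> \<le> measure \<nu> E * norm y" if E[measurable]: "E \<in> sets \<nu>" for E y
  proof -
    have "\<bar>I E y\<bar> \<le> (\<integral>\<omega>. \<bar>indicator E \<omega> * u y \<omega>\<bar> \<partial>\<nu>)"
      unfolding I_def by (rule integral_abs_bound)
    also have "\<dots> \<le> (\<integral>\<omega>. indicator E \<omega> * norm y \<partial>\<nu>)"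
    proof (rule integral_mono_AE)
      show "AE \<omega> in \<nu>. \<bar>indicator E \<omega> * u y \<omega>\<bar> \<le> indicator E \<omega> * norm y"
        using bd[of y] by eventually_elim (auto simp: indicator_def)
    qed (use E in \<open>auto intro!: integrable_mult_left simp: less_top[symmetric]\<close>)
    also have "\<dots> = measure \<nu> E * norm y" using E by simp
    finally show ?thesis .
  qed
  have I_lin: "bounded_linear (I E)" if E[measurable]: "E \<in> sets \<nu>" for E
  proof (rule bounded_linear_intro[where K = "measure \<nu> E"])
    show "I E (y + z) = I E y + I E z" for y z
    proof -
      have "I E (y + z) = (\<integral>\<omega>. indicator E \<omega> * u y \<omega> + indicator E \<omega> * u z \<omega> \<partial>\<nu>)"
        unfolding I_def
        by (rule integral_cong_AE, measurable) (use add[of y z] in \<open>eventually_elim, simp add: distrib_left\<close>)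
      thus ?thesis unfolding I_def using E by simp
    qed
    show "I E (c *\<^sub>R y) = c *\<^sub>R I E y" for c y
    proof -
      have "I E (c *\<^sub>R y) = (\<integral>\<omega>. c * (indicator E \<omega> * u y \<omega>) \<partial>\<nu>)"
        unfolding I_def
        by (rule integral_cong_AE, measurable) (use scale[of c y] in \<open>eventually_elim, simp\<close>)
      thus ?thesis unfolding I_def using E by simp
    qed
    show "norm (I E y) \<le> norm y * measure \<nu> E" for y using I_le[OF E, of y] by (simp add: mult.commute)
  qed
  define G where "G E = inv T (Blinfun (I E))" for E
  have TG: "blinfun_apply (T (G E)) y = I E y" if "E \<in> sets \<nu>" for E y
    unfolding G_def by (simp add: surj_f_inv_f[OF surj_T] bounded_linear_Blinfun_apply[OF I_lin[OF that]])
  have G_norm: "norm (G E) \<le> measure \<nu> E" if "E \<in> sets \<nu>" for E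
    unfolding norm_T[symmetric, of "G E"]
    by (rule norm_blinfun_bound) (simp_all add: TG that I_le)
  have T_inj: "x = x'" if "\<And>y. blinfun_apply (T x) y = blinfun_apply (T x') y" for x x'
  proof -
    have "T (x - x') = 0" using that by (intro blinfun_eqI) (simp add: linear_diff[OF linear_T] blinfun.diff_left)
    thus ?thesis using norm_T[of "x - x'"] by simp
  qed
  have T_add: "blinfun_apply (T (x + x')) y = blinfun_apply (T x) y + blinfun_apply (T x') y" for x x' y
    by (simp add: linear_add[OF linear_T] blinfun.add_left)
  have G_Un: "G (E \<union> F) = G E + G F" if EF: "E \<in> sets \<nu>" "F \<in> sets \<nu>" "E \<inter> F = {}" for E F
  proof (rule T_inj)
    fix y
    have "(\<lambda>\<omega>. indicator (E \<union> F) \<omega> * u y \<omega>) = (\<lambda>\<omega>. indicator E \<omega> * u y \<omega> + indicator F \<omega> * u y \<omega>)"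
    proof
      fix \<omega>
      show "indicator (E \<union> F) \<omega> * u y \<omega> = indicator E \<omega> * u y \<omega> + indicator F \<omega> * u y \<omega>"
        using EF(3) by (cases "\<omega> \<in> E"; cases "\<omega> \<in> F") auto
    qed
    hence "I (E \<union> F) y = I E y + I F y" unfolding I_def using EF by simp
    thus "blinfun_apply (T (G (E \<union> F))) y = blinfun_apply (T (G E + G F)) y" using EF by (simp add: TG T_add)
  qed
  have G_empty: "G {} = 0" using G_norm[of "{}"] by simp
  have G_sum: "(\<Sum>k<n. G (A k)) = G (\<Union>k<n. A k)" if A: "range A \<subseteq> sets \<nu>" "disjoint_family A" for A :: "nat \<Rightarrow> _" and n
  proof (induction n)
    case (Suc n)
    have "A k \<inter> A n = {}" if "k < n" for k
      by (rule disjoint_family_onD[OF A(2)]) (use that in auto)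
    hence "(\<Union>k<n. A k) \<inter> A n = {}" by blast
    moreover have "(\<Union>k<Suc n. A k) = (\<Union>k<n. A k) \<union> A n" by (auto simp: less_Suc_eq)
    moreover have "(\<Union>k<n. A k) \<in> sets \<nu>" "A n \<in> sets \<nu>" using A(1) by auto
    ultimately show ?case using Suc G_Un by simp
  qed (simp add: G_empty)
  have vm: "vector_measure \<nu> G"
    unfolding vector_measure_def sums_def
  proof (intro allI impI)
    fix A :: "nat \<Rightarrow> _" assume A: "range A \<subseteq> sets \<nu>" "disjoint_family A"
    have U: "(\<Union>k<n. A k) \<in> sets \<nu>" "(\<Union>k. A k) - (\<Union>k<n. A k) \<in> sets \<nu>" "(\<Union>k. A k) \<in> sets \<nu>" for n
      using A(1) by auto
    have "(\<lambda>k. measure \<nu> (A k)) sums measure \<nu> (\<Union>k. A k)" by (rule finite_measure_UNION[OF A])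
    hence lim: "(\<lambda>n. measure \<nu> (\<Union>k. A k) - (\<Sum>k<n. measure \<nu> (A k))) \<longlonglongrightarrow> measure \<nu> (\<Union>k. A k) - measure \<nu> (\<Union>k. A k)"
      unfolding sums_def by (intro tendsto_diff tendsto_const)
    have "norm ((\<Sum>k<n. G (A k)) - G (\<Union>k. A k)) \<le> measure \<nu> (\<Union>k. A k) - (\<Sum>k<n. measure \<nu> (A k))" for n
    proof -
      have "(\<Union>k<n. A k) \<union> ((\<Union>k. A k) - (\<Union>k<n. A k)) = (\<Union>k. A k)" by auto
      hence "G (\<Union>k. A k) = G (\<Union>k<n. A k) + G ((\<Union>k. A k) - (\<Union>k<n. A k))"
        using G_Un[OF U(1,2)[of n]] by simp
      hence "norm ((\<Sum>k<n. G (A k)) - G (\<Union>k. A k)) = norm (G ((\<Union>k. A k) - (\<Union>k<n. A k)))"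
        by (simp add: G_sum[OF A])
      also have "\<dots> \<le> measure \<nu> ((\<Union>k. A k) - (\<Union>k<n. A k))" by (rule G_norm[OF U(2)])
      also have "\<dots> = measure \<nu> (\<Union>k. A k) - measure \<nu> (\<Union>k<n. A k)"
        by (rule finite_measure_Diff[OF U(3,1)]) auto
      also have "measure \<nu> (\<Union>k<n. A k) = (\<Sum>k<n. measure \<nu> (A k))"
        using A by (intro finite_measure_finite_Union) (auto simp: disjoint_family_on_def)
      finally show ?thesis .
    qed
    hence "\<forall>\<^sub>F n in sequentially. norm ((\<Sum>k<n. G (A k)) - G (\<Union>k. A k))
        \<le> measure \<nu> (\<Union>k. A k) - (\<Sum>k<n. measure \<nu> (A k))"
      by (intro always_eventually allI)
    moreover have "(\<lambda>n. measure \<nu> (\<Union>k. A k) - (\<Sum>k<n. measure \<nu> (A k))) \<longlonglongrightarrow> 0"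
      using lim by simp
    ultimately have "(\<lambda>n. (\<Sum>k<n. G (A k)) - G (\<Union>k. A k)) \<longlonglongrightarrow> 0"
      by (rule Lim_null_comparison)
    thus "(\<lambda>n. \<Sum>k<n. G (A k)) \<longlonglongrightarrow> G (\<Union>k. A k)" by (rule LIM_zero_cancel)
  qed
  have bv: "bounded_variation \<nu> G"
    unfolding bounded_variation_def
  proof (intro exI[of _ 1] allI impI)
    fix P assume P: "finite P" "P \<subseteq> sets \<nu>" "partition_on (space \<nu>) P"
    have "(\<Sum>E\<in>P. norm (G E)) \<le> (\<Sum>E\<in>P. measure \<nu> E)" using P by (intro sum_mono G_norm) auto
    also have "\<dots> = measure \<nu> (\<Union>E\<in>P. E)"
      using P by (intro finite_measure_finite_Union[symmetric])
        (auto simp: partition_on_def disjoint_family_on_def disjoint_def)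
    also have "\<dots> \<le> 1" by simp
    finally show "(\<Sum>E\<in>P. norm (G E)) \<le> 1" .
  qed
  have "\<forall>E\<in>null_sets \<nu>. G E = 0"
  proof
    fix E assume E: "E \<in> null_sets \<nu>"
    hence "measure \<nu> E = 0" by (simp add: measure_eq_0_null_sets)
    thus "G E = 0" using G_norm[of E] E by auto
  qed
  moreover have "radon_nikodym_wrt \<nu> TYPE('x)"
    using rnp finite_measure_axioms by (simp add: radon_nikodym_property_def)
  ultimately obtain g where g: "\<And>E. E \<in> sets \<nu> \<Longrightarrow> has_strong_bochner_integral \<nu> (\<lambda>\<omega>. indicator E \<omega> *\<^sub>R g \<omega>) (G E)"
    using vm bv unfolding radon_nikodym_wrt_def by blast
  \<comment> \<open>The property gives measurability of g only after multiplication by an indicator;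
    for the whole space this changes g only off \<open>space \<nu>\<close>.\<close>
  let ?g = "\<lambda>\<omega>. indicator (space \<nu>) \<omega> *\<^sub>R g \<omega> :: 'x"
  have "has_strong_bochner_integral \<nu> ?g (G (space \<nu>))" by (rule g) simp
  then obtain s where gm: "?g \<in> borel_measurable \<nu>"
    and s: "\<And>k. Bochner_Integration.simple_bochner_integrable \<nu> (s k)"
    and lim0: "(\<lambda>k. \<integral>\<^sup>+\<omega>. ennreal (norm (?g \<omega> - s k \<omega>)) \<partial>\<nu>) \<longlonglongrightarrow> 0"
    unfolding has_strong_bochner_integral_def by blast
  have ae_u: "AE \<omega> in \<nu>. blinfun_apply (T (?g \<omega>)) y = u y \<omega>" for y
  proof (rule density_unique_real)
    have hb: "has_bochner_integral \<nu> (\<lambda>\<omega>. indicator E \<omega> * blinfun_apply (T (g \<omega>)) y) (I E y)" if "E \<in> sets \<nu>" for E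
      using has_bochner_integral_blinfun_apply[OF g[OF that], of "J y"] TG[OF that, of y]
      by (simp add: J_apply linear_cmul[OF linear_T] blinfun.scaleR_left)
    have eq: "blinfun_apply (T (?g \<omega>)) y = indicator (space \<nu>) \<omega> * blinfun_apply (T (g \<omega>)) y" for \<omega>
      by (simp add: linear_cmul[OF linear_T] blinfun.scaleR_left)
    show "integrable \<nu> (\<lambda>\<omega>. blinfun_apply (T (?g \<omega>)) y)"
      unfolding eq using hb[of "space \<nu>"] by (rule integrable.intros) simp
    show "integrable \<nu> (u y)" by simp
    fix E assume E: "E \<in> sets \<nu>"
    have "(\<integral>\<omega>\<in>E. blinfun_apply (T (?g \<omega>)) y \<partial>\<nu>) = (\<integral>\<omega>. indicator E \<omega> * blinfun_apply (T (g \<omega>)) y \<partial>\<nu>)"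
      unfolding set_lebesgue_integral_def eq
      by (rule Bochner_Integration.integral_cong) (auto simp: indicator_def)
    also have "\<dots> = I E y" using hb[OF E] by (rule has_bochner_integral_integral_eq)
    finally show "(\<integral>\<omega>\<in>E. blinfun_apply (T (?g \<omega>)) y \<partial>\<nu>) = (\<integral>\<omega>\<in>E. u y \<omega> \<partial>\<nu>)"
      by (simp add: I_def set_lebesgue_integral_def)
  qed
  show ?thesis
  proof (rule that[OF gm s[THEN simple_bochner_integrable_imp_simple_function] lim0 ae_u])
    \<comment> \<open>The exceptional null set in \<open>ae_u\<close> depends on y, so the norm
      cannot be read off from all y at once. Almost norming vectors for the countably many values in
      \<open>?D\<close> suffice, since \<open>?g\<close> lies almost surely in the closure of
      \<open>?D\<close>.\<close>
    let ?D = "\<Union>k. s k ` space \<nu>"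
    have "countable (s k ` space \<nu>)" for k
      using s[of k, THEN simple_bochner_integrable_imp_simple_function]
      by (simp add: simple_function_def countable_finite)
    hence "countable ?D" by (intro countable_UN) auto
    have "\<exists>y. norm y \<le> 1 \<and> norm (T d) - 1 / real (Suc j) < blinfun_apply (T d) y" for d j
      by (rule exists_almost_norming) simp
    then obtain y where y: "\<And>d j. norm (y d j) \<le> 1"
      "\<And>d j. norm (T d) - 1 / real (Suc j) < blinfun_apply (T d) (y d j)" by metis
    have "AE \<omega> in \<nu>. \<forall>d\<in>?D. \<forall>j. blinfun_apply (T (?g \<omega>)) (y d j) \<le> 1"
      unfolding AE_ball_countable[OF \<open>countable ?D\<close>] AE_all_countable
    proof (intro ballI allI)
      fix d j
      show "AE \<omega> in \<nu>. blinfun_apply (T (?g \<omega>)) (y d j) \<le> 1"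
        using ae_u[of "y d j"] bd[of "y d j"] by eventually_elim (use y(1)[of d j] in linarith)
    qed
    with AE_in_closure_of_values[OF gm lim0] show "AE \<omega> in \<nu>. norm (?g \<omega>) \<le> 1"
    proof eventually_elim
      case (elim \<omega>)
      show ?case
      proof (rule field_le_epsilon)
        fix e :: real assume "0 < e"
        \<comment> \<open>Three errors of \<open>e / 3\<close>: from \<open>?g\<close> to d in norm,
          norming d, and from d back to \<open>?g\<close> at the norming vector.\<close>
        hence e: "0 < e / 3" by simp
        obtain d where d: "d \<in> ?D" "dist d (?g \<omega>) < e / 3"
          using elim(1) e unfolding closure_approachable by blast
        obtain j where j: "1 / real (Suc j) < e / 3"
          using reals_Archimedean[OF e] by (auto simp: inverse_eq_divide)
        have "\<bar>blinfun_apply (T (d - ?g \<omega>)) (y d j)\<bar> \<le> norm (d - ?g \<omega>) * norm (y d j)"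
          using norm_blinfun[of "T (d - ?g \<omega>)" "y d j"] by (simp add: norm_T)
        also have "\<dots> \<le> norm (d - ?g \<omega>) * 1" using y(1) by (intro mult_left_mono) auto
        finally have "blinfun_apply (T d) (y d j) - blinfun_apply (T (?g \<omega>)) (y d j) \<le> norm (d - ?g \<omega>)"
          by (simp add: linear_diff[OF linear_T] blinfun.diff_left)
        moreover have "blinfun_apply (T (?g \<omega>)) (y d j) \<le> 1" using elim(2) d(1) by blast
        moreover have "norm (?g \<omega>) \<le> norm d + norm (d - ?g \<omega>)"
          using norm_triangle_ineq4[of d "d - ?g \<omega>"] by simp
        moreover have "norm d - 1 / real (Suc j) < blinfun_apply (T d) (y d j)" using y(2)[of d j] by (simp add: norm_T)
        ultimately show "norm (?g \<omega>) \<le> 1 + e" using d(2) j unfolding dist_norm by linarith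
      qed
    qed
  qed
qed

end

section \<open>The Lp-norm of a bounded random vector\<close>

text \<open>Convexity at positive arguments; when an argument vanishes, the claim comes down to
  \<open>r powr p \<le> r\<close> for r between 0 and 1.\<close>

lemma powr_convex_combination:
  fixes x y t p :: real
  assumes p: "1 \<le> p" and xy: "0 \<le> x" "0 \<le> y" and t: "0 \<le> t" "t \<le> 1"
  shows "((1 - t) * x + t * y) powr p \<le> (1 - t) * x powr p + t * y powr p"
proof -
  have small: "(r * z) powr p \<le> r * z powr p" if "0 \<le> r" "r \<le> 1" "0 \<le> z" for r z :: real
  proof -
    have "r powr p \<le> r powr 1" if "0 < r"
      using that \<open>r \<le> 1\<close> p by (intro powr_mono') auto
    hence "r powr p \<le> r" using \<open>0 \<le> r\<close> p by (cases "r = 0") auto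
    thus ?thesis using that by (simp add: powr_mult mult_right_mono)
  qed
  show ?thesis
  proof (cases "x = 0 \<or> y = 0")
    case True
    thus ?thesis using small[of t y] small[of "1 - t" x] xy t p by auto
  next
    case False
    thus ?thesis using convex_onD[OF powr_convex[OF p], of t x y] xy t by simp
  qed
qed

lemma powr_add_le:
  fixes x y p :: real
  assumes "1 \<le> p" "0 \<le> x" "0 \<le> y"
  shows "(x + y) powr p \<le> 2 powr p * (x powr p + y powr p)"
proof -
  have "(x + y) powr p \<le> (2 * max x y) powr p" using assms by (intro powr_mono2) auto
  also have "\<dots> = 2 powr p * max x y powr p" using assms by (simp add: powr_mult)
  also have "\<dots> \<le> 2 powr p * (x powr p + y powr p)"
    by (intro mult_left_mono) (auto simp: max_def)
  finally show ?thesis .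
qed

lemma integrable_powr_add:
  fixes a b :: "'w \<Rightarrow> real"
  assumes p: "1 \<le> p" and [measurable]: "a \<in> borel_measurable M" "b \<in> borel_measurable M"
    and ab: "integrable M (\<lambda>w. \<bar>a w\<bar> powr p)" "integrable M (\<lambda>w. \<bar>b w\<bar> powr p)"
  shows "integrable M (\<lambda>w. \<bar>a w + b w\<bar> powr p)"
proof (rule Bochner_Integration.integrable_bound)
  show "integrable M (\<lambda>w. 2 powr p * (\<bar>a w\<bar> powr p + \<bar>b w\<bar> powr p))" using ab by simp
  show "AE w in M. norm (\<bar>a w + b w\<bar> powr p) \<le> norm (2 powr p * (\<bar>a w\<bar> powr p + \<bar>b w\<bar> powr p))"
  proof (rule AE_I2)
    fix w
    have "\<bar>a w + b w\<bar> powr p \<le> (\<bar>a w\<bar> + \<bar>b w\<bar>) powr p" using p by (intro powr_mono2) auto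
    also have "\<dots> \<le> 2 powr p * (\<bar>a w\<bar> powr p + \<bar>b w\<bar> powr p)" using p by (intro powr_add_le) auto
    finally show "norm (\<bar>a w + b w\<bar> powr p) \<le> norm (2 powr p * (\<bar>a w\<bar> powr p + \<bar>b w\<bar> powr p))" by simp
  qed
qed measurable

text \<open>\<open>a / \<alpha>\<close> and \<open>b / \<beta>\<close> are combined convexly with
  weights proportional to \<alpha> and \<beta>, which exceed the two norms by \<open>e / 2\<close>
  and so are positive.\<close>

lemma Minkowski_integral:
  fixes a b :: "'w \<Rightarrow> real"
  assumes p: "1 \<le> p" and meas: "a \<in> borel_measurable M" "b \<in> borel_measurable M"
    and ab: "integrable M (\<lambda>w. \<bar>a w\<bar> powr p)" "integrable M (\<lambda>w. \<bar>b w\<bar> powr p)"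
  shows "(\<integral>w. \<bar>a w + b w\<bar> powr p \<partial>M) powr (1 / p)
    \<le> (\<integral>w. \<bar>a w\<bar> powr p \<partial>M) powr (1 / p) + (\<integral>w. \<bar>b w\<bar> powr p \<partial>M) powr (1 / p)"
proof (rule field_le_epsilon)
  fix e :: real assume e: "0 < e"
  define A where "A = (\<integral>w. \<bar>a w\<bar> powr p \<partial>M)"
  define B where "B = (\<integral>w. \<bar>b w\<bar> powr p \<partial>M)"
  define \<alpha> where "\<alpha> = A powr (1 / p) + e / 2"
  define \<beta> where "\<beta> = B powr (1 / p) + e / 2"
  have AB: "0 \<le> A" "0 \<le> B" unfolding A_def B_def by simp_all
  have pos: "0 < \<alpha>" "0 < \<beta>" using e by (auto simp: \<alpha>_def \<beta>_def add_nonneg_pos)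
  have "A = (A powr (1 / p)) powr p" using AB p by (simp add: powr_powr)
  also have "\<dots> \<le> \<alpha> powr p" using e p by (intro powr_mono2) (auto simp: \<alpha>_def)
  finally have A: "A / \<alpha> powr p \<le> 1" using pos by (simp add: pos_divide_le_eq)
  have "B = (B powr (1 / p)) powr p" using AB p by (simp add: powr_powr)
  also have "\<dots> \<le> \<beta> powr p" using e p by (intro powr_mono2) (auto simp: \<beta>_def)
  finally have B: "B / \<beta> powr p \<le> 1" using pos by (simp add: pos_divide_le_eq)
  define t where "t = \<beta> / (\<alpha> + \<beta>)"
  have t: "0 \<le> t" "t \<le> 1" "1 - t = \<alpha> / (\<alpha> + \<beta>)" using pos by (auto simp: t_def field_simps)
  have pointwise: "\<bar>a w + b w\<bar> powr p
      \<le> (\<alpha> + \<beta>) powr p * ((1 - t) * (\<bar>a w\<bar> powr p / \<alpha> powr p) + t * (\<bar>b w\<bar> powr p / \<beta> powr p))" for w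
  proof -
    have "\<bar>a w + b w\<bar> \<le> \<bar>a w\<bar> + \<bar>b w\<bar>" by simp
    also have "\<dots> = (\<alpha> + \<beta>) * ((1 - t) * (\<bar>a w\<bar> / \<alpha>) + t * (\<bar>b w\<bar> / \<beta>))"
    proof -
      have "(\<alpha> + \<beta>) * ((1 - t) * (\<bar>a w\<bar> / \<alpha>) + t * (\<bar>b w\<bar> / \<beta>))
          = ((\<alpha> + \<beta>) * (1 - t)) * (\<bar>a w\<bar> / \<alpha>) + ((\<alpha> + \<beta>) * t) * (\<bar>b w\<bar> / \<beta>)"
        by (simp only: distrib_left mult.assoc)
      moreover have "(\<alpha> + \<beta>) * (1 - t) = \<alpha>" "(\<alpha> + \<beta>) * t = \<beta>"
        using pos unfolding t(3) by (simp_all add: t_def)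
      ultimately show ?thesis using pos by simp
    qed
    finally have "\<bar>a w + b w\<bar> powr p \<le> ((\<alpha> + \<beta>) * ((1 - t) * (\<bar>a w\<bar> / \<alpha>) + t * (\<bar>b w\<bar> / \<beta>))) powr p"
      using p by (intro powr_mono2) auto
    also have "\<dots> = (\<alpha> + \<beta>) powr p * ((1 - t) * (\<bar>a w\<bar> / \<alpha>) + t * (\<bar>b w\<bar> / \<beta>)) powr p"
      by (rule powr_mult)
    also have "\<dots> \<le> (\<alpha> + \<beta>) powr p * ((1 - t) * (\<bar>a w\<bar> / \<alpha>) powr p + t * (\<bar>b w\<bar> / \<beta>) powr p)"
      using pos t p by (intro mult_left_mono powr_convex_combination) auto
    finally show ?thesis using pos by (simp add: powr_divide)
  qed
  have "(\<integral>w. \<bar>a w + b w\<bar> powr p \<partial>M)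
      \<le> (\<integral>w. (\<alpha> + \<beta>) powr p * ((1 - t) * (\<bar>a w\<bar> powr p / \<alpha> powr p) + t * (\<bar>b w\<bar> powr p / \<beta> powr p)) \<partial>M)"
    by (rule integral_mono[OF integrable_powr_add[OF p meas ab] _ pointwise]) (use ab in simp)
  also have "\<dots> = (\<alpha> + \<beta>) powr p * ((1 - t) * (A / \<alpha> powr p) + t * (B / \<beta> powr p))"
    using ab by (simp add: A_def B_def)
  also have "\<dots> \<le> (\<alpha> + \<beta>) powr p * ((1 - t) * 1 + t * 1)"
    using A B t by (intro mult_left_mono add_mono) auto
  finally have "(\<integral>w. \<bar>a w + b w\<bar> powr p \<partial>M) \<le> (\<alpha> + \<beta>) powr p" by simp
  hence "(\<integral>w. \<bar>a w + b w\<bar> powr p \<partial>M) powr (1 / p) \<le> ((\<alpha> + \<beta>) powr p) powr (1 / p)"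
    using p by (intro powr_mono2) auto
  also have "\<dots> = \<alpha> + \<beta>" using p pos by (simp add: powr_powr)
  finally show "(\<integral>w. \<bar>a w + b w\<bar> powr p \<partial>M) powr (1 / p) \<le> A powr (1 / p) + B powr (1 / p) + e"
    by (simp add: \<alpha>_def \<beta>_def)
qed

text \<open>The \<open>\<ell>\<^sub>p\<close>-norm of finitely many evaluations is a supremum of evaluations over the unit ball of
  the dual \<open>\<ell>\<^sub>q\<close>; restricting to a finite grid in that ball gives lattice expressions.\<close>

lemma lp_combination_approx_FVL:
  fixes w :: "nat \<Rightarrow> 'x::banach"
  assumes p: "1 \<le> p" and \<epsilon>: "0 < \<epsilon>"
  obtains f where "f \<in> FVL"
    "\<And>\<phi>. \<bar>(\<Sum>i<n. \<bar>blinfun_apply \<phi> (w i)\<bar> powr p) powr (1 / p) - f \<phi>\<bar> \<le> \<epsilon> * (\<Sum>i<n. \<bar>blinfun_apply \<phi> (w i)\<bar>)"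
proof -
  obtain N :: nat where N0: "0 < N" and N: "1 / real N < \<epsilon>"
    using nat_approx_posE[OF \<epsilon>] by (metis zero_less_Suc)
  \<comment> \<open>A grid of mesh \<open>1 / real N\<close> in the dual ball, finite because
    functions in \<open>PiE\<close> are fixed outside the index set.\<close>
  define A where "A = {a \<in> PiE {..<n} (\<lambda>_. (\<lambda>k. of_int k / real N) ` {- int N..int N}).
    lq_norm (conjugate_exponent p) n a \<le> 1}"
  have "finite (PiE {..<n} (\<lambda>_. (\<lambda>k. of_int k / real N) ` {- int N..int N}))"
    by (rule finite_PiE) auto
  hence finA: "finite A" by (rule rev_finite_subset) (auto simp: A_def)
  have round: "\<exists>a\<in>A. \<forall>i<n. \<bar>b i - a i\<bar> \<le> 1 / real N" if b: "lq_norm (conjugate_exponent p) n b \<le> 1" for b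
  proof
    \<comment> \<open>Rounding towards zero, so that the grid point stays in the ball.\<close>
    define r where "r i = sgn (b i) * (of_int \<lfloor>real N * \<bar>b i\<bar>\<rfloor> / real N)" for i
    have fl: "0 \<le> of_int \<lfloor>real N * \<bar>b i\<bar>\<rfloor> / real N" "of_int \<lfloor>real N * \<bar>b i\<bar>\<rfloor> / real N \<le> \<bar>b i\<bar>"
      "\<bar>b i\<bar> - 1 / real N \<le> of_int \<lfloor>real N * \<bar>b i\<bar>\<rfloor> / real N" for i
    proof -
      show "0 \<le> of_int \<lfloor>real N * \<bar>b i\<bar>\<rfloor> / real N" using N0 by simp
      show "of_int \<lfloor>real N * \<bar>b i\<bar>\<rfloor> / real N \<le> \<bar>b i\<bar>"
        using N0 of_int_floor_le[of "real N * \<bar>b i\<bar>"] by (simp add: divide_le_eq mult.commute)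
      have "(real N * \<bar>b i\<bar> - 1) / real N \<le> of_int \<lfloor>real N * \<bar>b i\<bar>\<rfloor> / real N"
        by (intro divide_right_mono) linarith+
      thus "\<bar>b i\<bar> - 1 / real N \<le> of_int \<lfloor>real N * \<bar>b i\<bar>\<rfloor> / real N" using N0 by (simp add: diff_divide_distrib)
    qed
    have r_le: "\<bar>r i\<bar> \<le> \<bar>b i\<bar>" for i using fl[of i] by (auto simp: r_def abs_mult sgn_if)
    have r_near: "\<bar>b i - r i\<bar> \<le> 1 / real N" for i
      using fl[of i] by (cases "b i" "0::real" rule: linorder_cases) (auto simp: r_def)
    have "restrict r {..<n} \<in> PiE {..<n} (\<lambda>_. (\<lambda>k. of_int k / real N) ` {- int N..int N})"
    proof (rule restrict_PiE_iff[THEN iffD2, rule_format])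
      fix i assume "i \<in> {..<n}"
      hence "\<bar>b i\<bar> \<le> 1" using lq_norm_conjugate_le_1_coord[OF p b] by simp
      hence "real N * \<bar>b i\<bar> \<le> real N" by (simp add: mult_left_le)
      hence le: "\<lfloor>real N * \<bar>b i\<bar>\<rfloor> \<le> int N" by (simp add: floor_le_iff)
      obtain k where k: "k = \<lfloor>real N * \<bar>b i\<bar>\<rfloor>" by blast
      have range: "k \<in> {- int N..int N}" "- k \<in> {- int N..int N}" "0 \<in> {- int N..int N}"
        using le zero_le_floor[of "real N * \<bar>b i\<bar>"] unfolding k[symmetric] by auto
      have "r i = of_int k / real N \<or> r i = of_int (- k) / real N \<or> r i = of_int 0 / real N"
        by (simp add: r_def k[symmetric] sgn_if)
      thus "r i \<in> (\<lambda>k. of_int k / real N) ` {- int N..int N}" using range by blast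
    qed
    thus "restrict r {..<n} \<in> A"
      using lq_norm_conjugate_le_1_mono[OF p b, of "restrict r {..<n}"] r_le by (auto simp: A_def)
    show "\<forall>i<n. \<bar>b i - restrict r {..<n} i\<bar> \<le> 1 / real N" using r_near by simp
  qed
  have A_ne: "A \<noteq> {}"
  proof -
    have "lq_norm (conjugate_exponent p) n (\<lambda>_. 0) \<le> 1" by (simp add: lq_norm_conjugate_le_1_iff[OF p])
    from round[OF this] show ?thesis by blast
  qed
  define f where "f \<phi> = Max ((\<lambda>a. blinfun_apply \<phi> (\<Sum>i<n. a i *\<^sub>R w i)) ` A)" for \<phi> :: "'x \<Rightarrow>\<^sub>L real"
  show ?thesis
  proof (rule that)
    show "f \<in> FVL" unfolding f_def by (rule FVL_Max[OF finA A_ne])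
    fix \<phi>
    let ?S = "(\<Sum>i<n. \<bar>blinfun_apply \<phi> (w i)\<bar> powr p) powr (1 / p)"
    let ?R = "\<Sum>i<n. \<bar>blinfun_apply \<phi> (w i)\<bar>"
    have ev: "blinfun_apply \<phi> (\<Sum>i<n. a i *\<^sub>R w i) = (\<Sum>i<n. a i * blinfun_apply \<phi> (w i))" for a
      by (simp add: blinfun.sum_right blinfun.scaleR_right)
    have "f \<phi> \<le> ?S"
      unfolding f_def
    proof (intro Max.boundedI finite_imageI finA)
      fix v assume "v \<in> (\<lambda>a. blinfun_apply \<phi> (\<Sum>i<n. a i *\<^sub>R w i)) ` A"
      then obtain a where a: "a \<in> A" "v = (\<Sum>i<n. a i * blinfun_apply \<phi> (w i))" unfolding ev by blast
      thus "v \<le> ?S" using Hoelder_sum[OF p, of n a "\<lambda>i. blinfun_apply \<phi> (w i)"] by (simp add: A_def)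
    qed (use A_ne in simp)
    moreover have "?S - 1 / real N * ?R \<le> f \<phi>"
    proof -
      obtain b where b: "lq_norm (conjugate_exponent p) n b \<le> 1" "(\<Sum>i<n. b i * blinfun_apply \<phi> (w i)) = ?S"
        using Hoelder_sum_attained[OF p] by metis
      obtain a where a: "a \<in> A" "\<forall>i<n. \<bar>b i - a i\<bar> \<le> 1 / real N" using round[OF b(1)] by blast
      have "?S - (\<Sum>i<n. a i * blinfun_apply \<phi> (w i)) = (\<Sum>i<n. (b i - a i) * blinfun_apply \<phi> (w i))"
        by (simp add: b(2)[symmetric] left_diff_distrib sum_subtractf)
      also have "\<dots> \<le> (\<Sum>i<n. 1 / real N * \<bar>blinfun_apply \<phi> (w i)\<bar>)"
      proof (rule sum_mono)
        fix i assume "i \<in> {..<n}"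
        hence "\<bar>b i - a i\<bar> * \<bar>blinfun_apply \<phi> (w i)\<bar> \<le> 1 / real N * \<bar>blinfun_apply \<phi> (w i)\<bar>"
          using a(2) by (intro mult_right_mono) auto
        thus "(b i - a i) * blinfun_apply \<phi> (w i) \<le> 1 / real N * \<bar>blinfun_apply \<phi> (w i)\<bar>"
          by (metis abs_ge_self abs_mult order_trans)
      qed
      also have "\<dots> = 1 / real N * ?R" by (rule sum_distrib_left[symmetric])
      finally have "?S - 1 / real N * ?R \<le> (\<Sum>i<n. a i * blinfun_apply \<phi> (w i))" by simp
      also have "\<dots> \<le> f \<phi>"
        unfolding f_def ev using finA a(1) by (intro Max_ge) auto
      finally show ?thesis .
    qed
    moreover have "1 / real N * ?R \<le> \<epsilon> * ?R" using N by (intro mult_right_mono) (auto simp: sum_nonneg)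
    moreover have "0 \<le> \<epsilon> * ?R" using \<epsilon> by (intro mult_nonneg_nonneg) (auto simp: sum_nonneg)
    ultimately show "\<bar>?S - f \<phi>\<bar> \<le> \<epsilon> * ?R" by linarith
  qed
qed

text \<open>Each term is at most the \<open>\<ell>\<^sub>p\<close>-norm; the factor
  \<open>real n powr p\<close> is absorbed by the choice of \<eta> in
  \<open>V_approx_FVL\<close>.\<close>

lemma powr_sum_le:
  fixes t :: "nat \<Rightarrow> real"
  assumes p: "1 \<le> p" and t: "\<And>j. j < n \<Longrightarrow> 0 \<le> t j"
  shows "(\<Sum>j<n. t j) powr p \<le> real n powr p * (\<Sum>j<n. t j powr p)"
proof -
  let ?S = "\<Sum>j<n. t j powr p"
  have "t j \<le> ?S powr (1 / p)" if "j < n" for j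
  proof -
    have "t j powr p \<le> ?S" using that by (intro member_le_sum) auto
    hence "(t j powr p) powr (1 / p) \<le> ?S powr (1 / p)" using p by (intro powr_mono2) auto
    thus ?thesis using t[OF that] p by (simp add: powr_powr)
  qed
  hence "(\<Sum>j<n. t j) \<le> (\<Sum>j<n. ?S powr (1 / p))" by (intro sum_mono) auto
  hence "(\<Sum>j<n. t j) powr p \<le> (real n * ?S powr (1 / p)) powr p"
    using p t by (intro powr_mono2 sum_nonneg) auto
  also have "\<dots> = real n powr p * ?S" using p by (simp add: powr_mult powr_powr sum_nonneg)
  finally show ?thesis .
qed

lemma sum_powr_add_le:
  fixes a b :: "nat \<Rightarrow> real"
  assumes p: "1 \<le> p" and A: "(\<Sum>i<n. \<bar>a i\<bar> powr p) \<le> A" and B: "(\<Sum>i<n. \<bar>b i\<bar> powr p) \<le> B"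
  shows "(\<Sum>i<n. \<bar>a i + b i\<bar> powr p) \<le> 2 powr p * (A + B)"
proof -
  have "(\<Sum>i<n. \<bar>a i + b i\<bar> powr p) \<le> (\<Sum>i<n. 2 powr p * (\<bar>a i\<bar> powr p + \<bar>b i\<bar> powr p))"
  proof (rule sum_mono)
    fix i
    have "\<bar>a i + b i\<bar> powr p \<le> (\<bar>a i\<bar> + \<bar>b i\<bar>) powr p" using p by (intro powr_mono2) auto
    also have "\<dots> \<le> 2 powr p * (\<bar>a i\<bar> powr p + \<bar>b i\<bar> powr p)" using p by (intro powr_add_le) auto
    finally show "\<bar>a i + b i\<bar> powr p \<le> 2 powr p * (\<bar>a i\<bar> powr p + \<bar>b i\<bar> powr p)" .
  qed
  also have "\<dots> = 2 powr p * ((\<Sum>i<n. \<bar>a i\<bar> powr p) + (\<Sum>i<n. \<bar>b i\<bar> powr p))"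
    by (simp add: sum.distrib flip: sum_distrib_left)
  also have "\<dots> \<le> 2 powr p * (A + B)" using A B by (intro mult_left_mono add_mono) auto
  finally show ?thesis .
qed

text \<open>The constant bounds the \<open>p\<close>-th power of the distance.\<close>

definition p_close :: "real \<Rightarrow> real \<Rightarrow> (('x::banach \<Rightarrow>\<^sub>L real) \<Rightarrow> real) \<Rightarrow> (('x \<Rightarrow>\<^sub>L real) \<Rightarrow> real) \<Rightarrow> bool" where
  "p_close p c V f \<longleftrightarrow> (\<forall>n z. (\<Sum>i<n. \<bar>V (z i) - f (z i)\<bar> powr p) \<le> c * weak_norm p n z powr p)"

lemma p_close_trans:
  fixes V f g :: "('x::banach \<Rightarrow>\<^sub>L real) \<Rightarrow> real"
  assumes p: "1 \<le> p" and "p_close p a V f" "p_close p b f g"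
  shows "p_close p (2 powr p * (a + b)) V g"
  unfolding p_close_def
proof (intro allI)
  fix n and z :: "nat \<Rightarrow> 'x \<Rightarrow>\<^sub>L real"
  have "(\<Sum>i<n. \<bar>(V (z i) - f (z i)) + (f (z i) - g (z i))\<bar> powr p)
      \<le> 2 powr p * (a * weak_norm p n z powr p + b * weak_norm p n z powr p)"
    using assms(2,3) unfolding p_close_def by (intro sum_powr_add_le[OF p]) auto
  thus "(\<Sum>i<n. \<bar>V (z i) - g (z i)\<bar> powr p) \<le> 2 powr p * (a + b) * weak_norm p n z powr p"
    by (simp add: algebra_simps)
qed

text \<open>Sequences of length one: the lattice norm dominates the uniform norm on the unit
  ball.\<close>

lemma p_close_imp_norm_le:
  assumes p: "1 \<le> p" and \<epsilon>: "0 \<le> \<epsilon>" and V: "p_close p (\<epsilon> powr p) V f"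
  shows "\<bar>f \<phi> - V \<phi>\<bar> \<le> \<epsilon> * norm \<phi>"
proof -
  have "(\<Sum>i<1::nat. \<bar>V \<phi> - f \<phi>\<bar> powr p) \<le> \<epsilon> powr p * weak_norm p 1 (\<lambda>_. \<phi>) powr p"
    using V unfolding p_close_def by (elim allE)
  also have "\<dots> \<le> \<epsilon> powr p * norm \<phi> powr p"
    using p weak_norm_single[OF p, of \<phi>] weak_norm_nonneg[OF p]
    by (intro mult_left_mono powr_mono2) auto
  also have "\<dots> = (\<epsilon> * norm \<phi>) powr p" using \<epsilon> by (simp add: powr_mult)
  finally have le: "\<bar>V \<phi> - f \<phi>\<bar> powr p \<le> (\<epsilon> * norm \<phi>) powr p" by simp
  have "(\<bar>V \<phi> - f \<phi>\<bar> powr p) powr (1 / p) \<le> ((\<epsilon> * norm \<phi>) powr p) powr (1 / p)"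
    using p by (intro powr_mono2[OF _ _ le]) auto
  thus ?thesis using p \<epsilon> by (simp add: powr_powr abs_minus_commute)
qed

text \<open>Approximation in the lattice norm does double duty: it puts \<open>V\<close> into the
  closure of \<open>FVL\<close>, and being uniform on bounded sets it makes \<open>V\<close> weak*
  continuous there.\<close>

lemma Hw_FBL_I:
  fixes V :: "('x::banach \<Rightarrow>\<^sub>L real) \<Rightarrow> real"
  assumes p: "1 \<le> p" and hom: "\<And>c \<phi>. 0 \<le> c \<Longrightarrow> V (c *\<^sub>R \<phi>) = c * V \<phi>"
    and bound: "0 \<le> C" "pnorm p V \<le> ennreal C"
    and approx: "\<And>\<epsilon>. 0 < \<epsilon> \<Longrightarrow> \<exists>f\<in>FVL. p_close p \<epsilon> V f"
  shows "V \<in> Hw" "V \<in> FBL p"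
proof -
  have approx': "\<exists>f\<in>FVL. p_close p (\<epsilon> powr p) V f" if "0 < \<epsilon>" for \<epsilon>
    using approx[of "\<epsilon> powr p"] that by simp
  show Hw: "V \<in> Hw"
  proof (rule Hw_uniform_limit[OF hom])
    fix \<epsilon> :: real assume \<epsilon>: "0 < \<epsilon>"
    then obtain f where "f \<in> FVL" "p_close p (\<epsilon> powr p) V f" using approx' by blast
    thus "\<exists>f\<in>Hw. \<forall>\<phi>. \<bar>f \<phi> - V \<phi>\<bar> \<le> \<epsilon> * norm \<phi>"
      using p_close_imp_norm_le[OF p, of \<epsilon> V f] \<epsilon> FVL_subset_Hw by auto
  qed
  show "V \<in> FBL p"
    unfolding FBL_def closure_Hwp_def
  proof (intro CollectI conjI allI impI)
    have "pnorm p V < \<infinity>" using bound(2) by (rule le_less_trans) simp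
    thus "V \<in> Hwp p" using Hw by (simp add: Hwp_def)
    fix \<epsilon> :: real assume \<epsilon>: "0 < \<epsilon>"
    obtain f where f: "f \<in> FVL" "p_close p ((\<epsilon> / 2) powr p) V f" using approx'[of "\<epsilon> / 2"] \<epsilon> by auto
    have "pnorm p (\<lambda>\<phi>. V \<phi> - f \<phi>) \<le> ennreal (\<epsilon> / 2)"
      using f(2) \<epsilon> unfolding p_close_def by (subst pnorm_le_iff[OF p]) auto
    also have "\<dots> < ennreal \<epsilon>" using \<epsilon> by (simp add: ennreal_less_iff)
    finally show "\<exists>g\<in>FVL. pnorm p (\<lambda>\<phi>. V \<phi> - g \<phi>) < ennreal \<epsilon>" using f(1) by blast
  qed
qed

section \<open>Approximating the function V by lattice expressions\<close>

locale essentially_bounded_strongly_measurable = prob_space \<nu> for \<nu> :: "'w measure" +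
  fixes g :: "'w \<Rightarrow> 'x::banach" and s :: "nat \<Rightarrow> 'w \<Rightarrow> 'x" and p :: real
  assumes p: "1 \<le> p" and g: "g \<in> borel_measurable \<nu>" and s: "\<And>k. simple_function \<nu> (s k)"
    and s_lim: "(\<lambda>k. \<integral>\<^sup>+w. ennreal (norm (g w - s k w)) \<partial>\<nu>) \<longlonglongrightarrow> 0"
    and g_le: "AE w in \<nu>. norm (g w) \<le> 1"
begin

text \<open>Errors t at most 3 satisfy \<open>t powr p \<le> 3 powr p * t\<close>, so truncated
  simple functions that converge in mean also converge in \<open>L\<^sub>p\<close>.\<close>

lemma simple_approx:
  assumes \<epsilon>: "0 < \<epsilon>"
  obtains r where "simple_function \<nu> r" "AE w in \<nu>. norm (g w - r w) \<le> 3"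
    "(\<integral>w. norm (g w - r w) powr p \<partial>\<nu>) \<le> \<epsilon>"
proof -
  define \<delta> where "\<delta> = \<epsilon> / 3 powr p"
  have "0 < \<delta>" using \<epsilon> by (simp add: \<delta>_def)
  hence "0 < ennreal \<delta>" by simp
  from order_tendstoD(2)[OF s_lim this]
  obtain k where k: "(\<integral>\<^sup>+w. ennreal (norm (g w - s k w)) \<partial>\<nu>) < ennreal \<delta>"
    by (auto simp: eventually_sequentially)
  \<comment> \<open>Since g has norm at most 1 almost surely, replacing values of norm above 2 by 0
    does not increase the distance to g, and all distances become at most 3.\<close>
  define r where "r = (\<lambda>v. if norm v \<le> 2 then v else 0) \<circ> s k"
  have r: "simple_function \<nu> r" unfolding r_def using s by (rule simple_function_compose)
  have meas: "(\<lambda>w. norm (g w - r w)) \<in> borel_measurable \<nu>" "(\<lambda>w. norm (g w - s k w)) \<in> borel_measurable \<nu>"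
    using g r s by (auto intro: borel_measurable_norm_diff_simple_function)
  have le: "AE w in \<nu>. norm (g w - r w) \<le> 3 \<and> norm (g w - r w) \<le> norm (g w - s k w)"
    using g_le
  proof eventually_elim
    case (elim w)
    show ?case
    proof (cases "norm (s k w) \<le> 2")
      case True
      thus ?thesis using elim norm_triangle_ineq4[of "g w" "s k w"] by (simp add: r_def)
    next
      case False
      thus ?thesis using elim norm_triangle_ineq2[of "s k w" "g w"] by (simp add: r_def norm_minus_commute)
    qed
  qed
  have "(\<integral>\<^sup>+w. ennreal (norm (g w - r w) powr p) \<partial>\<nu>) \<le> (\<integral>\<^sup>+w. ennreal (3 powr p) * ennreal (norm (g w - s k w)) \<partial>\<nu>)"
  proof (rule nn_integral_mono_AE)
    show "AE w in \<nu>. ennreal (norm (g w - r w) powr p) \<le> ennreal (3 powr p) * ennreal (norm (g w - s k w))"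
      using le
    proof eventually_elim
      case (elim w)
      let ?t = "norm (g w - r w)"
      have "?t powr p = ?t powr (p - 1) * ?t"
        using powr_mult_base[of ?t "p - 1"] by (simp add: mult.commute)
      also have "\<dots> \<le> 3 powr p * ?t"
      proof (rule mult_right_mono)
        have "?t powr (p - 1) \<le> 3 powr (p - 1)" using elim p by (intro powr_mono2) auto
        also have "\<dots> \<le> 3 powr p" by (intro powr_mono) auto
        finally show "?t powr (p - 1) \<le> 3 powr p" .
      qed simp
      also have "\<dots> \<le> 3 powr p * norm (g w - s k w)" using elim by (intro mult_left_mono) auto
      finally show ?case by (simp add: ennreal_mult[symmetric] ennreal_leI)
    qed
  qed
  also have "\<dots> = ennreal (3 powr p) * (\<integral>\<^sup>+w. ennreal (norm (g w - s k w)) \<partial>\<nu>)"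
    by (rule nn_integral_cmult) (use meas in measurable)
  also have "\<dots> \<le> ennreal (3 powr p) * ennreal \<delta>" using k by (intro mult_left_mono) auto
  also have "\<dots> = ennreal \<epsilon>" using \<open>0 < \<delta>\<close> by (simp add: ennreal_mult[symmetric] \<delta>_def)
  finally have "(\<integral>\<^sup>+w. ennreal (norm (g w - r w) powr p) \<partial>\<nu>) \<le> ennreal \<epsilon>" .
  hence "(\<integral>w. norm (g w - r w) powr p \<partial>\<nu>) \<le> \<epsilon>"
    using \<epsilon> meas by (subst integral_eq_nn_integral) (auto intro!: enn2real_leI)
  thus ?thesis using that r le by auto
qed

lemma measurable_apply: "(\<lambda>w. blinfun_apply \<phi> (g w)) \<in> borel_measurable \<nu>"
  using g by (rule measurable_compose)
    (rule borel_measurable_continuous_onI[OF linear_continuous_on[OF blinfun.bounded_linear_right]])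

lemma abs_apply_le: "norm x \<le> c \<Longrightarrow> \<bar>blinfun_apply \<phi> x\<bar> \<le> norm \<phi> * c"
  using norm_blinfun[of \<phi> x] mult_left_mono[of "norm x" c "norm \<phi>"] by simp

lemma integrable_powr_if_bounded:
  fixes f :: "'w \<Rightarrow> real"
  assumes "f \<in> borel_measurable \<nu>" "AE w in \<nu>. \<bar>f w\<bar> \<le> c"
  shows "integrable \<nu> (\<lambda>w. \<bar>f w\<bar> powr p)"
proof (rule integrable_const_bound[where B = "c powr p"])
  show "AE w in \<nu>. norm (\<bar>f w\<bar> powr p) \<le> c powr p"
    using assms(2) by eventually_elim (use p in \<open>auto intro!: powr_mono2\<close>)
qed (use assms in measurable)

definition V :: "('x \<Rightarrow>\<^sub>L real) \<Rightarrow> real" where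
  "V \<phi> = (\<integral>w. \<bar>blinfun_apply \<phi> (g w)\<bar> powr p \<partial>\<nu>) powr (1 / p)"

lemma V_powr: "V \<phi> powr p = (\<integral>w. \<bar>blinfun_apply \<phi> (g w)\<bar> powr p \<partial>\<nu>)"
  unfolding V_def using p by (intro powr_inverse_powr) auto

lemma V_nonneg: "0 \<le> V \<phi>" by (simp add: V_def)

lemma V_homogeneous: "0 \<le> c \<Longrightarrow> V (c *\<^sub>R \<phi>) = c * V \<phi>"
  using p by (simp add: V_def blinfun.scaleR_left abs_mult powr_mult powr_powr)

lemma integrable_V: "integrable \<nu> (\<lambda>w. \<bar>blinfun_apply \<phi> (g w)\<bar> powr p)"
  using g_le abs_apply_le[of _ 1 \<phi>] by (intro integrable_powr_if_bounded[where c = "norm \<phi>"] measurable_apply) auto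

text \<open>The pointwise estimate by the weak norm, integrated. It gives the norm of
  \<open>V\<close> for h = g, and the error of a simple approximation r for h = g - r.\<close>

lemma sum_integral_powr_le:
  assumes h: "\<And>i. integrable \<nu> (\<lambda>w. \<bar>blinfun_apply (z i) (h w)\<bar> powr p)"
    and hn: "integrable \<nu> (\<lambda>w. norm (h w) powr p)"
  shows "(\<Sum>i<n. \<integral>w. \<bar>blinfun_apply (z i) (h w)\<bar> powr p \<partial>\<nu>)
    \<le> (\<integral>w. norm (h w) powr p \<partial>\<nu>) * weak_norm p n z powr p"
proof -
  have "(\<Sum>i<n. \<integral>w. \<bar>blinfun_apply (z i) (h w)\<bar> powr p \<partial>\<nu>) = (\<integral>w. (\<Sum>i<n. \<bar>blinfun_apply (z i) (h w)\<bar> powr p) \<partial>\<nu>)"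
    using h by (subst Bochner_Integration.integral_sum) auto
  also have "\<dots> \<le> (\<integral>w. norm (h w) powr p * weak_norm p n z powr p \<partial>\<nu>)"
    using h hn sum_powr_apply_le_weak_norm(2)[OF p] by (intro integral_mono) (auto simp: mult.commute)
  finally show ?thesis using hn by simp
qed

lemma pnorm_V: "pnorm p V \<le> ennreal 1"
  unfolding pnorm_le_iff[OF p zero_le_one]
proof (intro allI)
  fix n and z :: "nat \<Rightarrow> 'x \<Rightarrow>\<^sub>L real"
  have meas: "(\<lambda>w. norm (g w)) \<in> borel_measurable \<nu>"
    using borel_measurable_norm_diff_simple_function[OF g simple_function_const[of _ 0]] by simp
  have int: "integrable \<nu> (\<lambda>w. norm (g w) powr p)"
    using integrable_powr_if_bounded[OF meas, of 1] g_le by simp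
  have "(\<Sum>i<n. \<bar>V (z i)\<bar> powr p) = (\<Sum>i<n. \<integral>w. \<bar>blinfun_apply (z i) (g w)\<bar> powr p \<partial>\<nu>)"
    by (simp add: V_powr V_nonneg)
  also have "\<dots> \<le> (\<integral>w. norm (g w) powr p \<partial>\<nu>) * weak_norm p n z powr p"
    by (intro sum_integral_powr_le integrable_V int)
  also have "\<dots> \<le> 1 * weak_norm p n z powr p"
  proof (rule mult_right_mono)
    have "(\<integral>w. norm (g w) powr p \<partial>\<nu>) \<le> (\<integral>w. 1 \<partial>\<nu>)"
    proof (rule integral_mono_AE[OF int])
      show "AE w in \<nu>. norm (g w) powr p \<le> 1"
        using g_le by eventually_elim (use p in \<open>simp add: powr_le_one_iff_base\<close>)
    qed simp
    thus "(\<integral>w. norm (g w) powr p \<partial>\<nu>) \<le> 1" by (simp add: prob_space)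
  qed simp
  finally show "(\<Sum>i<n. \<bar>V (z i)\<bar> powr p) \<le> 1 powr p * weak_norm p n z powr p" by simp
qed

lemma integral_simple_function:
  fixes h :: "'x \<Rightarrow> real"
  assumes r: "simple_function \<nu> r"
  shows "(\<integral>w. h (r w) \<partial>\<nu>) = (\<Sum>v\<in>r ` space \<nu>. measure \<nu> (r -` {v} \<inter> space \<nu>) * h v)"
proof -
  have fin: "finite (r ` space \<nu>)" and sets: "\<And>v. r -` {v} \<inter> space \<nu> \<in> sets \<nu>"
    using r simple_functionD[OF r] by auto
  have "(\<integral>w. h (r w) \<partial>\<nu>) = (\<integral>w. (\<Sum>v\<in>r ` space \<nu>. h v * indicator (r -` {v} \<inter> space \<nu>) w) \<partial>\<nu>)"
  proof (rule Bochner_Integration.integral_cong[OF refl])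
    fix w assume w: "w \<in> space \<nu>"
    have "(\<Sum>v\<in>r ` space \<nu>. h v * indicator (r -` {v} \<inter> space \<nu>) w) = (\<Sum>v\<in>r ` space \<nu>. if v = r w then h v else 0)"
      using w by (intro sum.cong) (auto simp: indicator_def)
    thus "h (r w) = (\<Sum>v\<in>r ` space \<nu>. h v * indicator (r -` {v} \<inter> space \<nu>) w)" using fin w by simp
  qed
  also have "\<dots> = (\<Sum>v\<in>r ` space \<nu>. measure \<nu> (r -` {v} \<inter> space \<nu>) * h v)"
    using sets by (subst Bochner_Integration.integral_sum) (auto simp: mult.commute less_top[symmetric])
  finally show ?thesis .
qed

text \<open>For simple r in place of g the function is an \<open>\<ell>\<^sub>p\<close>-norm of
  finitely many evaluations, which \<open>lp_combination_approx_FVL\<close> handles; the reverse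
  triangle inequality and \<open>sum_integral_powr_le\<close> control the replacement.\<close>

lemma V_approx_FVL:
  assumes \<epsilon>: "0 < \<epsilon>"
  shows "\<exists>f\<in>FVL. p_close p \<epsilon> V f"
proof -
  \<comment> \<open>Halved for the two errors, and divided by the factor \<open>2 powr p\<close> of
    \<open>p_close_trans\<close>.\<close>
  define \<delta> where "\<delta> = \<epsilon> / 2 / 2 powr p"
  have \<delta>: "0 < \<delta>" "2 powr p * (\<delta> + \<delta>) = \<epsilon>" using \<epsilon> by (auto simp: \<delta>_def)
  obtain r where r: "simple_function \<nu> r" and r3: "AE w in \<nu>. norm (g w - r w) \<le> 3"
    and r\<delta>: "(\<integral>w. norm (g w - r w) powr p \<partial>\<nu>) \<le> \<delta>"
    using simple_approx[OF \<delta>(1)] by metis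
  define S where "S \<phi> = (\<integral>w. \<bar>blinfun_apply \<phi> (r w)\<bar> powr p \<partial>\<nu>) powr (1 / p)" for \<phi>
  have r_apply: "(\<lambda>w. blinfun_apply \<phi> (r w)) \<in> borel_measurable \<nu>" for \<phi> :: "'x \<Rightarrow>\<^sub>L real"
    by (rule borel_measurable_simple_function[OF simple_function_compose1[OF r]])
  have diff_apply: "(\<lambda>w. blinfun_apply \<phi> (g w - r w)) \<in> borel_measurable \<nu>" for \<phi> :: "'x \<Rightarrow>\<^sub>L real"
    unfolding blinfun.diff_right by (intro borel_measurable_diff measurable_apply r_apply)
  have int_diff: "integrable \<nu> (\<lambda>w. \<bar>blinfun_apply \<phi> (g w - r w)\<bar> powr p)" for \<phi>
    using r3 abs_apply_le[of _ 3 \<phi>]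
    by (intro integrable_powr_if_bounded[where c = "norm \<phi> * 3"] diff_apply) auto
  have int_norm: "integrable \<nu> (\<lambda>w. norm (g w - r w) powr p)"
    using integrable_powr_if_bounded[OF borel_measurable_norm_diff_simple_function[OF g r], of 3] r3 by simp
  have int_r: "integrable \<nu> (\<lambda>w. \<bar>blinfun_apply \<phi> (r w)\<bar> powr p)" for \<phi>
  proof (rule integrable_powr_if_bounded[where c = "norm \<phi> * 4", OF r_apply])
    show "AE w in \<nu>. \<bar>blinfun_apply \<phi> (r w)\<bar> \<le> norm \<phi> * 4"
      using r3 g_le
    proof eventually_elim
      case (elim w)
      have "norm (r w) \<le> 4" using elim norm_triangle_ineq4[of "g w" "g w - r w"] by simp
      thus ?case by (rule abs_apply_le)
    qed
  qed
  have VS: "p_close p \<delta> V S"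
    unfolding p_close_def
  proof (intro allI)
    fix n and z :: "nat \<Rightarrow> 'x \<Rightarrow>\<^sub>L real"
    have "\<bar>V \<phi> - S \<phi>\<bar> powr p \<le> (\<integral>w. \<bar>blinfun_apply \<phi> (g w - r w)\<bar> powr p \<partial>\<nu>)" for \<phi>
    proof -
      let ?D = "(\<integral>w. \<bar>blinfun_apply \<phi> (g w - r w)\<bar> powr p \<partial>\<nu>) powr (1 / p)"
      have "V \<phi> \<le> ?D + S \<phi>"
        using Minkowski_integral[OF p diff_apply r_apply int_diff int_r, of \<phi> \<phi>]
        by (simp add: V_def S_def blinfun.diff_right)
      moreover have "S \<phi> \<le> ?D + V \<phi>"
      proof -
        have "integrable \<nu> (\<lambda>w. \<bar>- blinfun_apply \<phi> (g w - r w)\<bar> powr p)" using int_diff by simp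
        from Minkowski_integral[OF p borel_measurable_uminus[OF diff_apply] measurable_apply this integrable_V[of \<phi>]]
        show ?thesis unfolding abs_minus_cancel by (simp add: V_def S_def blinfun.diff_right)
      qed
      ultimately have "\<bar>V \<phi> - S \<phi>\<bar> \<le> ?D" by linarith
      hence "\<bar>V \<phi> - S \<phi>\<bar> powr p \<le> ?D powr p" using p by (intro powr_mono2) auto
      thus ?thesis using p by (simp add: powr_powr)
    qed
    hence "(\<Sum>i<n. \<bar>V (z i) - S (z i)\<bar> powr p) \<le> (\<Sum>i<n. \<integral>w. \<bar>blinfun_apply (z i) (g w - r w)\<bar> powr p \<partial>\<nu>)"
      by (intro sum_mono)
    also have "\<dots> \<le> (\<integral>w. norm (g w - r w) powr p \<partial>\<nu>) * weak_norm p n z powr p"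
      by (intro sum_integral_powr_le int_diff int_norm)
    also have "\<dots> \<le> \<delta> * weak_norm p n z powr p" using r\<delta> by (intro mult_right_mono) auto
    finally show "(\<Sum>i<n. \<bar>V (z i) - S (z i)\<bar> powr p) \<le> \<delta> * weak_norm p n z powr p" .
  qed
  define m where "m = card (r ` space \<nu>)"
  have "finite (r ` space \<nu>)" using r by (simp add: simple_function_def)
  then obtain e where e: "bij_betw e {..<m} (r ` space \<nu>)"
    using ex_bij_betw_nat_finite by (auto simp: m_def atLeast0LessThan)
  \<comment> \<open>The p-th roots of the probabilities are absorbed into the vectors, so that the
    integral is an unweighted sum of p-th powers.\<close>
  define v where "v i = measure \<nu> (r -` {e i} \<inter> space \<nu>) powr (1 / p) *\<^sub>R e i" for i
  have S_eq: "S \<phi> = (\<Sum>i<m. \<bar>blinfun_apply \<phi> (v i)\<bar> powr p) powr (1 / p)" for \<phi>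
  proof -
    have "(\<integral>w. \<bar>blinfun_apply \<phi> (r w)\<bar> powr p \<partial>\<nu>)
        = (\<Sum>x\<in>r ` space \<nu>. measure \<nu> (r -` {x} \<inter> space \<nu>) * \<bar>blinfun_apply \<phi> x\<bar> powr p)"
      by (rule integral_simple_function[OF r, of "\<lambda>x. \<bar>blinfun_apply \<phi> x\<bar> powr p"])
    also have "\<dots> = (\<Sum>i<m. measure \<nu> (r -` {e i} \<inter> space \<nu>) * \<bar>blinfun_apply \<phi> (e i)\<bar> powr p)"
      by (rule sum.reindex_bij_betw[OF e, symmetric])
    also have "\<dots> = (\<Sum>i<m. \<bar>blinfun_apply \<phi> (v i)\<bar> powr p)"
      using p by (intro sum.cong) (auto simp: v_def blinfun.scaleR_right abs_mult powr_mult powr_powr)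
    finally show ?thesis by (simp add: S_def)
  qed
  \<comment> \<open>\<open>B\<close> bounds, in p-th powers, the lattice norm of the sum of the
    absolute evaluations at the \<open>v j\<close>; the 1 added in \<eta> covers B = 0.\<close>
  define B where "B = real m powr p * (\<Sum>j<m. norm (v j) powr p)"
  have B: "0 \<le> B" by (simp add: B_def sum_nonneg)
  define \<eta> where "\<eta> = (\<delta> / (B + 1)) powr (1 / p)"
  have \<eta>: "0 < \<eta>" "\<eta> powr p * B \<le> \<delta>"
  proof -
    show "0 < \<eta>" using \<delta> B by (simp add: \<eta>_def)
    have "\<eta> powr p * B = \<delta> * (B / (B + 1))" using \<delta> B p by (simp add: \<eta>_def powr_powr)
    also have "\<dots> \<le> \<delta> * 1" using \<delta> B by (intro mult_left_mono) auto
    finally show "\<eta> powr p * B \<le> \<delta>" by simp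
  qed
  obtain f where f: "f \<in> FVL" "\<And>\<phi>. \<bar>S \<phi> - f \<phi>\<bar> \<le> \<eta> * (\<Sum>j<m. \<bar>blinfun_apply \<phi> (v j)\<bar>)"
    using lp_combination_approx_FVL[OF p \<eta>(1), where n = m and w = v] unfolding S_eq by metis
  have Sf: "p_close p \<delta> S f"
    unfolding p_close_def
  proof (intro allI)
    fix n and z :: "nat \<Rightarrow> 'x \<Rightarrow>\<^sub>L real"
    have "(\<Sum>i<n. \<bar>S (z i) - f (z i)\<bar> powr p) \<le> (\<Sum>i<n. \<eta> powr p * (real m powr p * (\<Sum>j<m. \<bar>blinfun_apply (z i) (v j)\<bar> powr p)))"
    proof (rule sum_mono)
      fix i
      have "\<bar>S (z i) - f (z i)\<bar> powr p \<le> (\<eta> * (\<Sum>j<m. \<bar>blinfun_apply (z i) (v j)\<bar>)) powr p"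
        using f(2) p by (intro powr_mono2) auto
      also have "\<dots> = \<eta> powr p * (\<Sum>j<m. \<bar>blinfun_apply (z i) (v j)\<bar>) powr p" by (rule powr_mult)
      also have "\<dots> \<le> \<eta> powr p * (real m powr p * (\<Sum>j<m. \<bar>blinfun_apply (z i) (v j)\<bar> powr p))"
        by (intro mult_left_mono powr_sum_le[OF p]) auto
      finally show "\<bar>S (z i) - f (z i)\<bar> powr p \<le> \<eta> powr p * (real m powr p * (\<Sum>j<m. \<bar>blinfun_apply (z i) (v j)\<bar> powr p))" .
    qed
    also have "\<dots> = \<eta> powr p * (real m powr p * (\<Sum>j<m. \<Sum>i<n. \<bar>blinfun_apply (z i) (v j)\<bar> powr p))"
      unfolding sum_distrib_left[symmetric] by (subst sum.swap) rule
    also have "\<dots> \<le> \<eta> powr p * (real m powr p * (\<Sum>j<m. weak_norm p n z powr p * norm (v j) powr p))"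
      by (intro mult_left_mono sum_mono sum_powr_apply_le_weak_norm[OF p]) auto
    also have "\<dots> = (\<eta> powr p * B) * weak_norm p n z powr p"
      unfolding B_def sum_distrib_left[symmetric] by (simp only: ac_simps)
    also have "\<dots> \<le> \<delta> * weak_norm p n z powr p" using \<eta> by (intro mult_right_mono) auto
    finally show "(\<Sum>i<n. \<bar>S (z i) - f (z i)\<bar> powr p) \<le> \<delta> * weak_norm p n z powr p" .
  qed
  show ?thesis using p_close_trans[OF p VS Sf] f(1) unfolding \<delta>(2) by blast
qed

end

section \<open>Upper bounds of directed sets\<close>

lemma FVL_cmult:
  fixes f :: "('x::banach \<Rightarrow>\<^sub>L real) \<Rightarrow> real"
  assumes "f \<in> FVL"
  shows "(\<lambda>\<phi>. c * f \<phi>) \<in> FVL"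
proof -
  have "function_subspace (FVL :: (('x \<Rightarrow>\<^sub>L real) \<Rightarrow> real) set)"
    using vector_sublattice_FVL unfolding vector_sublattice_def by (elim conjE)
  thus ?thesis using assms by (simp add: function_subspace_def)
qed

lemma p_close_cmult:
  fixes V f :: "('x::banach \<Rightarrow>\<^sub>L real) \<Rightarrow> real"
  assumes "p_close p \<epsilon> V f" "\<bar>c\<bar> powr p * \<epsilon> \<le> \<delta>"
  shows "p_close p \<delta> (\<lambda>\<phi>. c * V \<phi>) (\<lambda>\<phi>. c * f \<phi>)"
  unfolding p_close_def
proof (intro allI)
  fix n and z :: "nat \<Rightarrow> 'x \<Rightarrow>\<^sub>L real"
  have "(\<Sum>i<n. \<bar>c * V (z i) - c * f (z i)\<bar> powr p) = \<bar>c\<bar> powr p * (\<Sum>i<n. \<bar>V (z i) - f (z i)\<bar> powr p)"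
    by (simp add: sum_distrib_left abs_mult powr_mult flip: right_diff_distrib)
  also have "\<dots> \<le> \<bar>c\<bar> powr p * (\<epsilon> * weak_norm p n z powr p)"
    using assms(1) unfolding p_close_def by (intro mult_left_mono) auto
  also have "\<dots> \<le> \<delta> * weak_norm p n z powr p"
    using assms(2) unfolding mult.assoc[symmetric] by (intro mult_right_mono) auto
  finally show "(\<Sum>i<n. \<bar>c * V (z i) - c * f (z i)\<bar> powr p) \<le> \<delta> * weak_norm p n z powr p" .
qed

context predual
begin

lemma FBL_upper_bound:
  fixes Z :: "(('x \<Rightarrow>\<^sub>L real) \<Rightarrow> real) set"
  assumes rnp: "radon_nikodym_property TYPE('x)"
    and p: "1 \<le> p" and C: "0 \<le> C" and Z: "Z \<noteq> {}" "Z \<subseteq> Hw" "\<And>f \<phi>. f \<in> Z \<Longrightarrow> 0 \<le> f \<phi>"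
      "\<And>f. f \<in> Z \<Longrightarrow> pnorm p f \<le> ennreal C"
    and dir: "\<And>f g. f \<in> Z \<Longrightarrow> g \<in> Z \<Longrightarrow> \<exists>h\<in>Z. f \<le> h \<and> g \<le> h"
  obtains h where "h \<in> FBL p" "\<And>f. f \<in> Z \<Longrightarrow> f \<le> h" "pnorm p h \<le> ennreal C"
proof -
  obtain L where L: "L \<in> means (cball 0 1)"
    and dom: "\<And>f \<phi>. f \<in> Z \<Longrightarrow> f \<phi> powr p \<le> C powr p * L (\<lambda>x. \<bar>blinfun_apply \<phi> x\<bar> powr p)"
    by (rule mean_dominating_directed_set[OF p C Z(1,2)]) (use Z(3,4) dir in blast)+
  obtain \<nu> :: "(('x \<Rightarrow>\<^sub>L real) \<Rightarrow> real) measure" and U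
    where prob: "prob_space \<nu>" and meas: "\<And>\<phi>. U \<phi> \<in> borel_measurable \<nu>"
      and bd: "\<And>\<phi>. AE \<omega> in \<nu>. \<bar>U \<phi> \<omega>\<bar> \<le> norm \<phi>"
      and add: "\<And>\<phi> \<psi>. AE \<omega> in \<nu>. U (\<phi> + \<psi>) \<omega> = U \<phi> \<omega> + U \<psi> \<omega>"
      and scale: "\<And>c \<phi>. AE \<omega> in \<nu>. U (c *\<^sub>R \<phi>) \<omega> = c * U \<phi> \<omega>"
      and L_le: "\<And>\<phi> p. 1 \<le> p \<Longrightarrow> L (\<lambda>x. \<bar>blinfun_apply \<phi> x\<bar> powr p) \<le> (\<integral>\<omega>. \<bar>U \<phi> \<omega>\<bar> powr p \<partial>\<nu>)"
    using random_functional_of_mean[OF L] by blast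
  have bd': "AE \<omega> in \<nu>. \<bar>U (J y) \<omega>\<bar> \<le> norm y" for y
    using bd[of "J y"] by eventually_elim (use norm_J_le[of y] in linarith)
  obtain g s where gs: "g \<in> borel_measurable \<nu>" "\<And>k. simple_function \<nu> (s k)"
      "(\<lambda>k. \<integral>\<^sup>+\<omega>. ennreal (norm (g \<omega> - s k \<omega>)) \<partial>\<nu>) \<longlonglongrightarrow> 0"
      "AE \<omega> in \<nu>. norm (g \<omega>) \<le> 1"
    and g_eq: "\<And>y. AE \<omega> in \<nu>. blinfun_apply (T (g \<omega>)) y = U (J y) \<omega>"
  proof (rule radon_nikodym_density[OF prob rnp, of "\<lambda>y. U (J y)"])
    show "U (J y) \<in> borel_measurable \<nu>" for y by (rule meas)
    show "AE \<omega> in \<nu>. \<bar>U (J y) \<omega>\<bar> \<le> norm y" for y by (rule bd')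
    show "AE \<omega> in \<nu>. U (J (y + z)) \<omega> = U (J y) \<omega> + U (J z) \<omega>" for y z
      unfolding J_add by (rule add)
    show "AE \<omega> in \<nu>. U (J (c *\<^sub>R y)) \<omega> = c * U (J y) \<omega>" for c y
      unfolding J_scaleR by (rule scale)
  qed (rule that)
  interpret essentially_bounded_strongly_measurable \<nu> g s p
    by (rule essentially_bounded_strongly_measurable.intro
        [OF prob essentially_bounded_strongly_measurable_axioms.intro[OF p gs]])
  define h where "h \<phi> = C * V \<phi>" for \<phi>
  have pnorm_h: "pnorm p h \<le> ennreal C"
    unfolding pnorm_le_iff[OF p C]
  proof (intro allI)
    fix n and z :: "nat \<Rightarrow> 'x \<Rightarrow>\<^sub>L real"
    have "(\<Sum>i<n. \<bar>V (z i)\<bar> powr p) \<le> weak_norm p n z powr p"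
      using pnorm_V unfolding pnorm_le_iff[OF p zero_le_one] by simp
    hence "C powr p * (\<Sum>i<n. \<bar>V (z i)\<bar> powr p) \<le> C powr p * weak_norm p n z powr p"
      by (intro mult_left_mono) auto
    thus "(\<Sum>i<n. \<bar>h (z i)\<bar> powr p) \<le> C powr p * weak_norm p n z powr p"
      using C by (simp add: h_def abs_mult powr_mult sum_distrib_left)
  qed
  have approx: "\<exists>f\<in>FVL. p_close p \<epsilon> h f" if \<epsilon>: "0 < \<epsilon>" for \<epsilon>
  proof -
    \<comment> \<open>The added 1 covers C = 0.\<close>
    have C1: "0 < \<bar>C\<bar> powr p + 1" by (simp add: add_nonneg_pos)
    hence "0 < \<epsilon> / (\<bar>C\<bar> powr p + 1)" using \<epsilon> by simp
    then obtain f where f: "f \<in> FVL" "p_close p (\<epsilon> / (\<bar>C\<bar> powr p + 1)) V f" using V_approx_FVL by blast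
    have "\<bar>C\<bar> powr p * (\<epsilon> / (\<bar>C\<bar> powr p + 1)) \<le> \<epsilon>"
      using C1 \<epsilon> by (simp add: pos_divide_le_eq algebra_simps)
    from p_close_cmult[OF f(2) this] FVL_cmult[OF f(1), of C] show ?thesis
      unfolding h_def[abs_def] by blast
  qed
  have h: "h \<in> Hw" "h \<in> FBL p"
    by (rule Hw_FBL_I[OF p _ C pnorm_h approx]; simp add: h_def V_homogeneous)+
  show ?thesis
  proof (rule that[OF h(2) _ pnorm_h])
    fix f assume f: "f \<in> Z"
    \<comment> \<open>Only on the image of \<open>J\<close> is the random functional identified with
      evaluation at g; the remaining functionals are reached by weak* continuity.\<close>
    have le: "f (J y) \<le> h (J y)" for y
    proof -
      have "f (J y) powr p \<le> C powr p * L (\<lambda>x. \<bar>blinfun_apply (J y) x\<bar> powr p)" by (rule dom[OF f])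
      also have "\<dots> \<le> C powr p * (\<integral>\<omega>. \<bar>U (J y) \<omega>\<bar> powr p \<partial>\<nu>)" by (intro mult_left_mono L_le[OF p]) simp
      also have "(\<integral>\<omega>. \<bar>U (J y) \<omega>\<bar> powr p \<partial>\<nu>) = (\<integral>\<omega>. \<bar>blinfun_apply (J y) (g \<omega>)\<bar> powr p \<partial>\<nu>)"
      proof (rule integral_cong_AE)
        show "(\<lambda>\<omega>. \<bar>U (J y) \<omega>\<bar> powr p) \<in> borel_measurable \<nu>" using meas by measurable
        show "(\<lambda>\<omega>. \<bar>blinfun_apply (J y) (g \<omega>)\<bar> powr p) \<in> borel_measurable \<nu>"
          using measurable_apply by measurable
        show "AE \<omega> in \<nu>. \<bar>U (J y) \<omega>\<bar> powr p = \<bar>blinfun_apply (J y) (g \<omega>)\<bar> powr p"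
          using g_eq[of y] by eventually_elim (simp add: J_apply)
      qed
      also have "C powr p * \<dots> = h (J y) powr p"
        unfolding h_def powr_mult V_powr ..
      finally have le: "f (J y) powr p \<le> h (J y) powr p" .
      have "(f (J y) powr p) powr (1 / p) \<le> (h (J y) powr p) powr (1 / p)"
        using p by (intro powr_mono2[OF _ _ le]) auto
      thus ?thesis using p C Z(3)[OF f] V_nonneg by (simp add: powr_powr h_def)
    qed
    show "f \<le> h"
      by (rule le_funI, rule Hw_le_if_le_on_predual[OF _ h(1) le]) (use Z(2) f in auto)
  qed
qed

end

theorem corollary4p5:
  fixes p :: real
  assumes "1 \<le> p"
    and "is_dual_of TYPE('x::banach) TYPE('y::banach)"
    and "radon_nikodym_property TYPE('x)"
  shows "monotonically_bounded TYPE('i) 1 (FBL p :: (('x \<Rightarrow>\<^sub>L real) \<Rightarrow> real) set) (pnorm p) \<and>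
         monotonically_bounded TYPE('i) 1 (Iwp_closure p :: (('x \<Rightarrow>\<^sub>L real) \<Rightarrow> real) set) (pnorm p)"
proof -
  obtain T :: "'x \<Rightarrow> ('y \<Rightarrow>\<^sub>L real)" where "linear T" "\<And>x. norm (T x) = norm x" "surj T"
    using assms(2) unfolding is_dual_of_def by blast
  then interpret predual T by (rule predual.intro)
  have FBL_sub: "FBL p \<subseteq> (Iwp_closure p :: (('x \<Rightarrow>\<^sub>L real) \<Rightarrow> real) set)"
    unfolding FBL_def Iwp_closure_def by (rule closure_Hwp_mono[OF FVL_subset_Iw])
  \<comment> \<open>Stated for every \<open>Z\<close> between \<open>FBL p\<close> and
    \<open>Hw\<close>, so that both lattices are instances.\<close>
  have "monotonically_bounded TYPE('i) 1 Z (pnorm p)"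
    if Z: "FBL p \<subseteq> Z" "Z \<subseteq> Hw" for Z :: "(('x \<Rightarrow>\<^sub>L real) \<Rightarrow> real) set"
    unfolding monotonically_bounded_def
  proof (intro allI impI)
    fix I :: "'i set" and le and z :: "'i \<Rightarrow> ('x \<Rightarrow>\<^sub>L real) \<Rightarrow> real"
    assume I: "directed_index I le" and z: "\<forall>i\<in>I. z i \<in> Z \<and> (\<lambda>_. 0) \<le> z i"
      and mono: "\<forall>i\<in>I. \<forall>j\<in>I. le i j \<longrightarrow> z i \<le> z j" and fin: "(SUP i\<in>I. pnorm p (z i)) < \<infinity>"
    obtain C where C: "0 \<le> C" "(SUP i\<in>I. pnorm p (z i)) = ennreal C"
      using fin by (cases "SUP i\<in>I. pnorm p (z i)") auto
    obtain h where h: "h \<in> FBL p" "\<And>f. f \<in> z ` I \<Longrightarrow> f \<le> h" "pnorm p h \<le> ennreal C"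
    proof (rule FBL_upper_bound[OF assms(3,1) C(1), of "z ` I"])
      show "z ` I \<noteq> {}" using I by (simp add: directed_index_def)
      show "z ` I \<subseteq> Hw" using z Z(2) by auto
      show "0 \<le> f \<phi>" if "f \<in> z ` I" for f \<phi> using z that by (auto simp: le_fun_def)
      show "pnorm p f \<le> ennreal C" if "f \<in> z ` I" for f
        using that unfolding C(2)[symmetric] by (auto intro: SUP_upper)
      show "\<exists>h\<in>z ` I. f \<le> h \<and> g \<le> h" if "f \<in> z ` I" "g \<in> z ` I" for f g
      proof -
        from that obtain i j where ij: "i \<in> I" "j \<in> I" "f = z i" "g = z j" by auto
        then obtain k where "k \<in> I" "le i k" "le j k" using I unfolding directed_index_def by blast
        thus ?thesis using mono ij by blast
      qed
    qed (rule that)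
    show "\<exists>z0\<in>Z. (\<forall>i\<in>I. z i \<le> z0) \<and> pnorm p z0 \<le> ennreal 1 * (SUP i\<in>I. pnorm p (z i))"
      using h Z(1) unfolding C(2) by (intro bexI[of _ h]) auto
  qed
  moreover have "Iwp_closure p \<subseteq> (Hw :: (('x \<Rightarrow>\<^sub>L real) \<Rightarrow> real) set)"
    by (auto simp: Iwp_closure_def closure_Hwp_def Hwp_def)
  ultimately show ?thesis using FBL_sub by blast
qed

end
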